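(* For integers $\varepsilon\in\{0,1\}$, $\alpha,\beta\ge0$, write $f=\varphi^\varepsilon\theta_3^\alpha\Delta_8^\beta=\sum_{m\ge0}a_mq^m$ and $\mathrm{Sh}f=\sum_{m\in\alpha/4+2\mathbb N}b_mq^m$. In what follows $a,b$ denote nonnegative integers (in the "unless" statements, arbitrary integers), and "$m=\dots$" means: the coefficient with index $m$ vanishes whenever $m$ is of that form (and lies in the index set). (a) For $f=(\theta_3^4\Delta_8)^k$: $a_m=0$ whenever $m-k$ is odd. For $\mathrm{Sh}\bigl((\theta_3^{16}\Delta_8)^k\bigr)$: $b_m=0$ whenever $m\equiv2\pmod4$. (b) $\theta_3$: $a_m=0$ unless $m$ is a perfect square; $\mathrm{Sh}(\theta_3)$: $b_m=0$ unless $m=a^2/4$; $\theta_3^2$: $a_m=0$ unless $m=a^2+b^2$; $\mathrm{Sh}(\theta_3^2)$: $b_m=0$ unless $m=(a^2+b^2)/4$; $\theta_3^3$: $a_m=0$ for $m=4^a(8b+7)$; $\varphi\theta_3^{12}$: $a_1=0$. (c) $\theta_3\Delta_8$: $a_m=0$ for $m=4^a(8b+5)$; $\theta_3^2\Delta_8$: $a_m=0$ unless $m=a^2+b^2$; $\mathrm{Sh}(\theta_3^2\Delta_8)$: $b_m=0$ unless $m=(a^2+b^2)/4$; $\theta_3^3\Delta_8$: $a_m=0$ for $m=4^a(8b+7)$; $\theta_3^7\Delta_8$: $a_m=0$ for $m=4^a(8b+3)$; $\varphi\theta_3^3\Delta_8$: $a_m=0$ for $m=4^a(8b+7)$; $\varphi\theta_3^{16}\Delta_8$: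 $a_m=0$ for $m=2\cdot4^a$; $\mathrm{Sh}(\varphi\theta_3^{16}\Delta_8)$: $b_m=0$ for $m=2\cdot4^a$; $\mathrm{Sh}(\varphi\theta_3^{40}\Delta_8)$: $b_{24}=0$. (d) $\theta_3^5\Delta_8^2$: $a_m=0$ for $m=4^a(8b+1)$; $\theta_3^{12}\Delta_8^2$: $a_m=0$ for $m=4^a$; $\varphi\theta_3^8\Delta_8^2$: $a_m=0$ for $m=4^a$; $\mathrm{Sh}(\varphi\theta_3^8\Delta_8^2)$: $b_m=0$ for $m=4^a$; $\varphi\theta_3^{20}\Delta_8^2$: $a_3=0$; $\varphi\theta_3^{33}\Delta_8^2$: $a_4=0$; $\mathrm{Sh}(\varphi\theta_3^{33}\Delta_8^2)$: $b_{49/4}=0$. (e) $\theta_3^4\Delta_8^3$: $a_m=0$ for $m=2\cdot4^a$; $\varphi\theta_3^{24}\Delta_8^3$: $a_m=0$ for $m=2^a$; $\mathrm{Sh}(\varphi\theta_3^{24}\Delta_8^3)$: $b_m=0$ for $m=2^a$.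
   Context: For $z$ in the upper half-plane $\mathbb H$ let $q^m=e^{i\pi zm}$. Define $\theta_2=\sum_{m\in\mathbb Z+1/2}q^{m^2}$, $\theta_3=\sum_{m\in\mathbb Z}q^{m^2}$, $\theta_4=\sum_{m\in\mathbb Z}(-q)^{m^2}$, $\Delta_8=\tfrac1{16}\theta_2^4\theta_4^4$, $\varphi=\theta_4^4-\theta_2^4$. A function $f=\varphi^\varepsilon\theta_3^\alpha\Delta_8^\beta$ has weight $\omega=2\varepsilon+\alpha/2+4\beta$, and its shadow is $(\mathrm{Sh}f)(z)=(i/z)^\omega f(1-1/z)$, using the principal branch of the power (note $|\arg(i/z)|<\pi/2$). The shadow is multiplicative; e.g. $\mathrm{Sh}\theta_3=\theta_2$, $\mathrm{Sh}\Delta_8=-\tfrac1{16}+q^2-7q^4+\cdots$, $\mathrm{Sh}\varphi=2+48q^2+\cdots$, and $\mathrm{Sh}f$ has a Fourier expansion in powers $q^m$, $m\in\alpha/4+2\mathbb N$. *)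

theory Defs
  imports "HOL-Analysis.Analysis"
begin

text \<open>Notation: q^m = exp(i pi z m). Theta functions as sums over the integers.\<close>

definition theta2 :: "complex \<Rightarrow> complex" where
  "theta2 z = (\<Sum>\<^sub>\<infinity>n::int. exp (\<i> * of_real pi * z * (of_int n + 1/2)^2))"

definition theta3 :: "complex \<Rightarrow> complex" where
  "theta3 z = (\<Sum>\<^sub>\<infinity>n::int. exp (\<i> * of_real pi * z * (of_int n)^2))"

text \<open>theta4 = sum of (-q)^(m^2) with -q = exp(i pi (z+1)).\<close>
definition theta4 :: "complex \<Rightarrow> complex" where
  "theta4 z = (\<Sum>\<^sub>\<infinity>n::int. exp (\<i> * of_real pi * (z + 1) * (of_int n)^2))"

definition Delta8 :: "complex \<Rightarrow> complex" where
  "Delta8 z = (theta2 z ^ 4 * theta4 z ^ 4) / 16"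

definition phi8 :: "complex \<Rightarrow> complex" where
  "phi8 z = theta4 z ^ 4 - theta2 z ^ 4"

definition mf :: "nat \<Rightarrow> nat \<Rightarrow> nat \<Rightarrow> complex \<Rightarrow> complex" where
  "mf eps alpha beta z = phi8 z ^ eps * theta3 z ^ alpha * Delta8 z ^ beta"

definition weight :: "nat \<Rightarrow> nat \<Rightarrow> nat \<Rightarrow> real" where
  "weight eps alpha beta = 2 * real eps + real alpha / 2 + 4 * real beta"

text \<open>Shadow (Sh F)(z) = (i/z)^w F(1 - 1/z), principal branch (complex powr uses Ln).\<close>
definition Sh :: "real \<Rightarrow> (complex \<Rightarrow> complex) \<Rightarrow> complex \<Rightarrow> complex" where
  "Sh w F z = (\<i> / z) powr (of_real w) * F (1 - 1 / z)"

text \<open>Fourier coefficient of q^m (q^m = exp(i pi z m)), extracted on the line Im z = 1;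
  this is the coefficient of a Fourier expansion with exponents in a coset of 2Z.\<close>
definition fcoeff :: "(complex \<Rightarrow> complex) \<Rightarrow> real \<Rightarrow> complex" where
  "fcoeff F m = (1/2) * integral {0..2::real}
      (\<lambda>x. F (of_real x + \<i>) * exp (- \<i> * of_real pi * of_real m * (of_real x + \<i>)))"

definition acoef :: "nat \<Rightarrow> nat \<Rightarrow> nat \<Rightarrow> nat \<Rightarrow> complex" where
  "acoef eps alpha beta m = fcoeff (mf eps alpha beta) (real m)"

definition bcoef :: "nat \<Rightarrow> nat \<Rightarrow> nat \<Rightarrow> real \<Rightarrow> complex" where
  "bcoef eps alpha beta m = fcoeff (Sh (weight eps alpha beta) (mf eps alpha beta)) m"

definition sh_index :: "nat \<Rightarrow> real set" where
  "sh_index alpha = {real alpha / 4 + 2 * real n | n. n \<in> (UNIV :: nat set)}"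

end

theory Submission
  imports Defs "HOL-Complex_Analysis.Complex_Analysis" "HOL-Probability.Probability"
begin

text \<open>
  Every form involved is a polynomial in theta constants, and the duplication formulas rewrite the
  theta constants at \<open>z\<close> as polynomials in \<open>theta3\<close> and \<open>theta2\<close> at \<open>2 z\<close> or \<open>4 z\<close>. Sorting the
  monomials by their behaviour under translation of \<open>z\<close> isolates the coefficients in a residue
  class. For half-integral weight the exponents divisible by 4 give back a multiple of the form, so
  \<open>a(4 m) = c a(m)\<close>, and an odd residue class modulo 4 turns out to live in a single class
  modulo 8. For integral weight the operator \<open>a(m) \<mapsto> a(2 m)\<close> maps all forms into the span of three
  forms that it permutes up to constants. The two-squares case rests on
  \<open>theta3\<^sup>2 Delta8\<close> being a multiple of \<open>\<Sum> (m + n \<i>) ^ 4 q ^ (m\<^sup>2 + n\<^sup>2)\<close>. Shadows are made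
  explicit by the inversion formula for \<open>theta3\<close>, proved by Poisson summation on the imaginary
  axis and analytic continuation.
\<close>

subsection \<open>Expansions in powers of the nome\<close>

text \<open>Why odd residue classes collapse: let a, b be theta3, theta2 at 4 z. The part of a form
  with b-exponents in the relevant class modulo 4 turns out to be b^j times a polynomial in a^4 (a^4
  - b^4) and 2 a^4 - b^4. Since a^4 - b^4 = theta4(4z)^4, both are symmetric in theta3 and theta4,
  hence fixed by z -> z + 1/4, which multiplies b by a primitive eighth root of unity. The three
  forms of integral weight are powers of theta2, theta3, theta4 times phi8(z + 1) = theta3^4 +
  theta2^4. Their weights are 14, 14 and 26; the theta2 factor forces orders of at least 2, 1 and 3,
  which starts the inductions. The constants 16 * 256 and 4096 are both 2^12. An obstacle throughout
  is that theta2 is not a power series in q; it enters as theta2^4, as theta2(4z), or as q^(1/4)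
  times \<open>psi2\<close>. No dimension count for spaces of modular forms is used: identities are
  polynomial ones in theta values or, where derivatives occur, come from comparing lowest
  coefficients in a relation between X(q) and X(q^2).\<close>

abbreviation nome :: "complex \<Rightarrow> complex" where
  "nome z \<equiv> exp (\<i> * of_real pi * z)"

lemma norm_nome: "norm (nome z) = exp (- pi * Im z)"
  by simp

lemma norm_nome_less_1: "Im z > 0 \<Longrightarrow> norm (nome z) < 1"
  by simp

text \<open>Pairs a function with a power series, so that questions about integrals become formal.
  Radius at least 1 is what evaluation on the whole half-plane requires, as the nome sweeps out the
  punctured unit disc.\<close>

definition qexp :: "(complex \<Rightarrow> complex) \<Rightarrow> complex fps \<Rightarrow> bool" where
  "qexp F A \<longleftrightarrow> fps_conv_radius A \<ge> 1 \<and> (\<forall>z. Im z > 0 \<longrightarrow> F z = eval_fps A (nome z))"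

lemma qexp_radius:
  assumes "qexp F A" "Im z > 0"
  shows "ereal (norm (nome z)) < fps_conv_radius A"
proof -
  have "ereal (norm (nome z)) < 1"
    using norm_nome_less_1[OF assms(2)] by (simp add: one_ereal_def)
  also have "1 \<le> fps_conv_radius A" using assms(1) by (simp add: qexp_def)
  finally show ?thesis .
qed

lemma qexp_eval: "qexp F A \<Longrightarrow> Im z > 0 \<Longrightarrow> F z = eval_fps A (nome z)"
  by (simp add: qexp_def)

lemma qexp_sums:
  assumes "qexp F A" "Im z > 0"
  shows "(\<lambda>n. fps_nth A n * nome z ^ n) sums F z"
  using sums_eval_fps[OF qexp_radius[OF assms]] qexp_eval[OF assms] by simp

text \<open>The radius comes for free: each r in (0,1) is the modulus of the nome at z = i (- ln r /
  pi), so pointwise convergence on the half-plane gives convergence at every radius below 1.\<close>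

lemma qexpI:
  assumes "\<And>z. Im z > 0 \<Longrightarrow> (\<lambda>n. fps_nth A n * nome z ^ n) sums F z"
  shows "qexp F A"
  unfolding qexp_def
proof (intro conjI allI impI)
  have "conv_radius (fps_nth A) \<ge> 1"
  proof (rule conv_radius_geI_ex)
    fix r :: real assume r: "0 < r" "ereal r < 1"
    hence r1: "r < 1" by (simp add: one_ereal_def)
    define z where "z = \<i> * of_real (- ln r / pi)"
    have z: "Im z > 0" using r r1 by (simp add: z_def divide_neg_pos)
    have "norm (nome z) = r" using r by (simp add: norm_nome z_def)
    with sums_summable[OF assms[OF z]] show "\<exists>z. norm z = r \<and> summable (\<lambda>n. fps_nth A n * z ^ n)"
      by blast
  qed
  thus "1 \<le> fps_conv_radius A" by (simp add: fps_conv_radius_def)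
next
  fix z :: complex assume "Im z > 0"
  from sums_unique[OF assms[OF this]] show "F z = eval_fps A (nome z)"
    by (simp add: eval_fps_def)
qed

lemma qexp_cong:
  assumes "qexp F A" "\<And>z. Im z > 0 \<Longrightarrow> F z = G z"
  shows "qexp G A"
  using assms by (auto simp: qexp_def)

lemma qexp_const: "qexp (\<lambda>_. c) (fps_const c)"
  by (simp add: qexp_def)

lemma qexp_add: "qexp F A \<Longrightarrow> qexp G B \<Longrightarrow> qexp (\<lambda>z. F z + G z) (A + B)"
  by (rule qexpI) (auto simp: ring_distribs intro!: sums_add qexp_sums)

lemma qexp_diff: "qexp F A \<Longrightarrow> qexp G B \<Longrightarrow> qexp (\<lambda>z. F z - G z) (A - B)"
  by (rule qexpI) (auto simp: ring_distribs intro!: sums_diff qexp_sums)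

lemma qexp_mult:
  assumes "qexp F A" "qexp G B"
  shows "qexp (\<lambda>z. F z * G z) (A * B)"
proof -
  have "fps_conv_radius (A * B) \<ge> 1"
    using assms by (intro order_trans[OF _ fps_conv_radius_mult]) (simp add: qexp_def)
  moreover have "F z * G z = eval_fps (A * B) (nome z)" if "Im z > 0" for z
    using eval_fps_mult[OF qexp_radius[OF assms(1) that] qexp_radius[OF assms(2) that]]
      qexp_eval[OF assms(1) that] qexp_eval[OF assms(2) that] by simp
  ultimately show ?thesis by (simp add: qexp_def)
qed

lemma qexp_power: "qexp F A \<Longrightarrow> qexp (\<lambda>z. F z ^ n) (A ^ n)"
proof (induction n)
  case 0 then show ?case using qexp_const[of 1] by simp
next
  case (Suc n) then show ?case using qexp_mult[of F A "\<lambda>z. F z ^ n" "A ^ n"] by simp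
qed

lemma qexp_cmult: "qexp F A \<Longrightarrow> qexp (\<lambda>z. c * F z) (fps_const c * A)"
  by (rule qexp_mult[OF qexp_const])

lemma qexp_divide:
  assumes "qexp F A" shows "qexp (\<lambda>z. F z / c) (fps_const (1 / c) * A)"
  using qexp_cmult[OF assms, of "1 / c"] by simp

lemma qexp_translate:
  assumes "qexp F A"
  shows "qexp (\<lambda>z. F (z + of_real s)) (A oo (fps_const (nome (of_real s)) * fps_X))"
proof (rule qexpI)
  fix z :: complex assume "Im z > 0"
  hence "(\<lambda>n. fps_nth A n * nome (z + of_real s) ^ n) sums F (z + of_real s)"
    by (intro qexp_sums[OF assms]) simp
  moreover have "nome (z + of_real s) = nome (of_real s) * nome z"
    by (simp add: ring_distribs add.commute flip: exp_add)
  ultimately show "(\<lambda>n. fps_nth (A oo (fps_const (nome (of_real s)) * fps_X)) n * nome z ^ n)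
      sums F (z + of_real s)"
    unfolding fps_nth_compose_linear by (simp only: power_mult_distrib mult_ac)
qed

lemma qexp_dilate:
  assumes "qexp F A" "N > 0"
  shows "qexp (\<lambda>z. F (of_nat N * z)) (A oo fps_X ^ N)"
proof (rule qexpI)
  fix z :: complex assume "Im z > 0"
  hence "(\<lambda>n. fps_nth A n * nome (of_nat N * z) ^ n) sums F (of_nat N * z)"
    using assms(2) by (intro qexp_sums[OF assms(1)]) simp
  also have "nome (of_nat N * z) = nome z ^ N"
    by (simp add: mult_ac flip: exp_of_nat_mult)
  also have "(\<lambda>n. fps_nth A n * (nome z ^ N) ^ n) =
      (\<lambda>n. fps_nth (A oo fps_X ^ N) (N * n) * nome z ^ (N * n))"
    using assms(2) by (simp add: fps_nth_compose_X_power power_mult)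
  finally show "(\<lambda>n. fps_nth (A oo fps_X ^ N) n * nome z ^ n) sums F (of_nat N * z)"
    using assms(2)
    by (subst (asm) sums_mono_reindex)
       (auto simp: strict_mono_def fps_nth_compose_X_power elim!: dvdE)
qed

lemma integral_nome:
  fixes k :: int
  shows "integral {0..2::real} (\<lambda>x. nome (of_int k * (of_real x + \<i>))) = (if k = 0 then 2 else 0)"
proof (cases "k = 0")
  case False
  define f where "f = (\<lambda>x::real. nome (of_int k * (of_real x + \<i>)) / (\<i> * of_real pi * of_int k))"
  have "((\<lambda>x. nome (of_int k * (of_real x + \<i>))) has_integral (f 2 - f 0)) {0..2}"
    using False unfolding f_def
    by (intro fundamental_theorem_of_calculus)
       (auto intro!: derivative_eq_intros has_vector_derivative_real_field simp: field_simps)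
  moreover have "f 2 = f 0"
  proof -
    have "exp (2 * of_int k * of_real pi * \<i> :: complex) = 1"
      using exp_integer_2pi[of "of_int k"] by (simp add: mult_ac)
    moreover have "\<i> * of_real pi * (of_int k * (of_real 2 + \<i>)) =
      2 * of_int k * of_real pi * \<i> + \<i> * of_real pi * (of_int k * \<i>)"
      by (simp add: algebra_simps)
    ultimately show ?thesis unfolding f_def by (simp add: exp_add)
  qed
  ultimately show ?thesis using False by (simp add: has_integral_iff)
qed (auto simp: scaleR_conv_of_real)

text \<open>Termwise integration over one period. On Im z = 1 each term has modulus independent of
  x, so the M-test applies with the summable values at z = i, and the partial sums integrate to
  twice the coefficient once they include index m.\<close>

lemma qexp_fcoeff:
  assumes "qexp F A"
  shows "fcoeff F (real m) = fps_nth A m"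
proof -
  define L where "L = (\<lambda>x::real. of_real x + \<i>)"
  define g where "g = (\<lambda>n x. fps_nth A n * nome (of_int (int n - int m) * L x))"
  have L: "Im (L x) > 0" for x by (simp add: L_def)
  have gs: "(\<lambda>n. g n x) sums (F (L x) * exp (- \<i> * of_real pi * of_real (real m) * L x))" for x
  proof -
    have "fps_nth A n * nome (L x) ^ n * exp (- \<i> * of_real pi * of_real (real m) * L x) = g n x" for n
    proof -
      have "nome (L x) ^ n * exp (- \<i> * of_real pi * of_real (real m) * L x) = nome (of_int (int n - int m) * L x)"
        by (simp add: algebra_simps flip: exp_of_nat_mult exp_add)
      thus ?thesis by (simp add: g_def mult.assoc)
    qed
    with sums_mult2[OF qexp_sums[OF assms L[of x]], of "exp (- \<i> * of_real pi * of_real (real m) * L x)"]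
    show ?thesis by simp
  qed
  have summ: "summable (\<lambda>n. norm (fps_nth A n * nome \<i> ^ n) * exp (pi * real m))"
    using norm_summable_fps[OF qexp_radius[OF assms, of \<i>]] by (intro summable_mult2) simp
  have nrm: "norm (g n x) \<le> norm (fps_nth A n * nome \<i> ^ n) * exp (pi * real m)" for n x
    by (simp add: g_def L_def norm_mult norm_power algebra_simps flip: exp_of_nat_mult exp_add)
  have ul: "uniform_limit {0..2} (\<lambda>N x. \<Sum>n<N. g n x) (\<lambda>x. \<Sum>n. g n x) sequentially"
    by (rule Weierstrass_m_test[OF _ summ]) (rule nrm)
  have cont: "continuous_on {0..2} (\<lambda>x. \<Sum>n<N. g n x)" for N
    by (auto simp: g_def L_def intro!: continuous_intros)
  obtain I J where I: "\<And>N. ((\<lambda>x. \<Sum>n<N. g n x) has_integral I N) {0..2}"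
    and J: "((\<lambda>x. \<Sum>n. g n x) has_integral J) {0..2}" and IJ: "I \<longlonglongrightarrow> J"
    using uniform_limit_integral[OF ul cont] by auto
  have Ival: "I N = (if m < N then 2 * fps_nth A m else 0)" for N
  proof -
    have "I N = integral {0..2} (\<lambda>x. \<Sum>n<N. g n x)" using I[of N] by (simp add: has_integral_iff)
    also have "\<dots> = (\<Sum>n<N. integral {0..2} (g n))"
      by (subst integral_sum) (auto simp: g_def L_def intro!: integrable_continuous_real continuous_intros)
    also have "\<dots> = (\<Sum>n<N. fps_nth A n * (if int n - int m = 0 then 2 else 0))"
      unfolding g_def L_def integral_mult_right integral_nome ..
    also have "\<dots> = (\<Sum>n<N. if n = m then 2 * fps_nth A m else 0)"
      by (intro sum.cong) auto
    finally show ?thesis by simp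
  qed
  have "I \<longlonglongrightarrow> 2 * fps_nth A m"
    by (rule tendsto_eventually) (auto simp: Ival eventually_sequentially intro!: exI[of _ "Suc m"])
  with IJ have "J = 2 * fps_nth A m" using LIMSEQ_unique by blast
  moreover have "(\<Sum>n. g n x) = F (L x) * exp (- \<i> * of_real pi * of_real (real m) * L x)" for x
    using sums_unique[OF gs] by simp
  ultimately show ?thesis
    using J by (simp add: fcoeff_def L_def has_integral_iff)
qed

text \<open>Carries an identity of functions on the half-plane over to formal power series;
  \<open>T3_T4_dil_prod\<close> is obtained this way.\<close>

lemma qexp_unique: "qexp F A \<Longrightarrow> qexp F B \<Longrightarrow> A = B"
  by (intro fps_ext) (simp flip: qexp_fcoeff)

subsection \<open>Theta constants and their duplication formulas\<close>

lemma summable_on_geometric_int: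
  fixes r :: real
  assumes "0 \<le> r" "r < 1"
  shows "(\<lambda>n::int. r ^ nat \<bar>n\<bar>) summable_on UNIV"
proof -
  have g: "(\<lambda>n. r ^ n) summable_on UNIV"
    using assms by (intro norm_summable_imp_summable_on) (simp add: summable_geometric)
  have "(\<lambda>n::int. r ^ nat \<bar>n\<bar>) summable_on range int"
    using g by (subst summable_on_reindex) (auto simp: o_def)
  moreover have "(\<lambda>n::int. r ^ nat \<bar>n\<bar>) summable_on range (\<lambda>n. - int n)"
    using g by (subst summable_on_reindex) (auto simp: o_def inj_on_def)
  ultimately have "(\<lambda>n::int. r ^ nat \<bar>n\<bar>) summable_on (range int \<union> range (\<lambda>n. - int n))"
    by (rule summable_on_union)
  also have "range int \<union> range (\<lambda>n. - int n) = UNIV"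
  proof -
    have "n \<in> range int \<union> range (\<lambda>n. - int n)" for n
      by (cases n rule: int_cases2) auto
    thus ?thesis by blast
  qed
  finally show ?thesis .
qed

lemma summable_on_int_comparison:
  fixes f :: "int \<Rightarrow> 'a :: banach"
  assumes "0 \<le> r" "r < 1" "\<And>n. norm (f n) \<le> C * r ^ nat \<bar>n\<bar>"
  shows "f summable_on UNIV" "(\<lambda>n. norm (f n)) summable_on UNIV"
proof -
  have "(\<lambda>n::int. C * r ^ nat \<bar>n\<bar>) summable_on UNIV"
    by (intro summable_on_cmult_right summable_on_geometric_int assms)
  thus "(\<lambda>n. norm (f n)) summable_on UNIV"
    by (rule summable_on_comparison_test) (use assms(3) in auto)
  thus "f summable_on UNIV" by (rule abs_summable_summable)
qed

lemma abs_le_square_int: "\<bar>n\<bar> \<le> (n::int)\<^sup>2"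
proof (cases "n = 0")
  case False
  hence "1 \<le> \<bar>n\<bar>" by arith
  thus ?thesis using self_le_power[of "\<bar>n\<bar>" 2] by simp
qed simp

text \<open>The slack of one admits the exponents n^2 + n, which vanish at n = -1. It costs a factor
  1 / |q|, so q = 0 is separate: there only the finitely many n with exponent 0 contribute.\<close>

lemma summable_on_int_power:
  fixes q :: complex and e :: "int \<Rightarrow> nat"
  assumes "norm q < 1" and e: "\<And>n. nat \<bar>n\<bar> \<le> e n + 1"
  shows "(\<lambda>n. q ^ e n) summable_on UNIV"
proof (cases "q = 0")
  case False
  show ?thesis
  proof (rule summable_on_int_comparison)
    fix n
    have "norm q * norm (q ^ e n) = norm q ^ (e n + 1)" by (simp add: norm_power)
    also have "\<dots> \<le> norm q ^ nat \<bar>n\<bar>" using assms by (intro power_decreasing) auto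
    finally show "norm (q ^ e n) \<le> (1 / norm q) * norm q ^ nat \<bar>n\<bar>"
      using False by (simp add: field_simps)
  qed (use assms in auto)
next
  case True
  have "finite {n. e n = 0}"
  proof (rule finite_subset)
    show "{n. e n = 0} \<subseteq> {-1..1}"
    proof
      fix n assume "n \<in> {n. e n = 0}"
      with e[of n] show "n \<in> {-1..1}" by (auto simp: nat_le_iff abs_le_iff)
    qed
  qed simp
  hence "(\<lambda>n. q ^ e n) summable_on {n. e n = 0}" by (rule summable_on_finite)
  thus ?thesis by (rule summable_on_cong_neutral[THEN iffD1, rotated -1]) (auto simp: True)
qed

text \<open>Unconditional summability permits grouping the integers into the finite fibres of the
  exponent function; the fibre sizes are the coefficients.\<close>

lemma qexp_theta:
  fixes e :: "int \<Rightarrow> nat"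
  assumes e: "\<And>n. nat \<bar>n\<bar> \<le> e n + 1"
  shows "qexp (\<lambda>z. \<Sum>\<^sub>\<infinity>n. nome z ^ e n) (Abs_fps (\<lambda>N. of_nat (card {n. e n = N})))"
proof (rule qexpI)
  fix z :: complex assume z: "Im z > 0"
  define q where "q = nome z"
  have fin: "finite {n. e n = N}" for N
  proof (rule finite_subset)
    show "{n. e n = N} \<subseteq> {- int (N+1)..int (N+1)}"
    proof
      fix n assume "n \<in> {n. e n = N}"
      with e[of n] show "n \<in> {- int (N+1)..int (N+1)}" by (auto simp: nat_le_iff abs_le_iff)
    qed
  qed simp
  define S where "S = (\<Sum>\<^sub>\<infinity>n. q ^ e n)"
  have "((\<lambda>n. q ^ e n) has_sum S) UNIV"
    unfolding S_def using z e by (intro has_sum_infsum summable_on_int_power) (auto simp: q_def)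
  also have "UNIV = snd ` (SIGMA N:UNIV. {n. e n = N})" by force
  finally have "(((\<lambda>n. q ^ e n) \<circ> snd) has_sum S) (SIGMA N:UNIV. {n. e n = N})"
    by (subst (asm) has_sum_reindex) (auto simp: inj_on_def)
  hence "((\<lambda>N. of_nat (card {n. e n = N}) * q ^ N) has_sum S) UNIV"
  proof (rule has_sum_SigmaD)
    fix N :: nat
    show "((\<lambda>n. ((\<lambda>n. q ^ e n) \<circ> snd) (N, n)) has_sum of_nat (card {n. e n = N}) * q ^ N) {n. e n = N}"
      using fin[of N] by (intro has_sum_finiteI) auto
  qed
  thus "(\<lambda>N. fps_nth (Abs_fps (\<lambda>N. of_nat (card {n. e n = N}))) N * nome z ^ N) sums (\<Sum>\<^sub>\<infinity>n. nome z ^ e n)"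
    using has_sum_imp_sums by (simp add: q_def S_def)
qed

text \<open>Theta series with a weight on the summation variable. Besides \<open>T3\<close> it
  covers its q-derivatives (weights m^2 and m^4), so one product formula over
  \<open>two_squares\<close> serves both.\<close>

definition sqfps :: "(int \<Rightarrow> complex) \<Rightarrow> complex fps" where
  "sqfps u = Abs_fps (\<lambda>N. \<Sum>m | m\<^sup>2 = int N. u m)"

definition two_squares :: "nat \<Rightarrow> (int \<times> int) set" where
  "two_squares N = {(m, n). m\<^sup>2 + n\<^sup>2 = int N}"

lemma finite_squares: "finite {m::int. m\<^sup>2 = int N}"
proof (rule finite_subset)
  show "{m::int. m\<^sup>2 = int N} \<subseteq> {- int N..int N}"
  proof
    fix m :: int assume "m \<in> {m. m\<^sup>2 = int N}"
    with abs_le_square_int[of m] show "m \<in> {- int N..int N}" by simp arith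
  qed
qed simp

lemma two_squares_conv_Sigma:
  "bij_betw (\<lambda>(i, m, n). (m, n)) (SIGMA i:{0..N}. {m. m\<^sup>2 = int i} \<times> {n. n\<^sup>2 = int (N - i)}) (two_squares N)"
proof (rule bij_betwI[where g = "\<lambda>(m, n). (nat (m\<^sup>2), m, n)"])
  show "(\<lambda>(m, n). (nat (m\<^sup>2), m, n)) \<in> two_squares N \<rightarrow> (SIGMA i:{0..N}. {m. m\<^sup>2 = int i} \<times> {n. n\<^sup>2 = int (N - i)})"
  proof
    fix p assume "p \<in> two_squares N"
    then obtain m n where p: "p = (m, n)" and eq: "m\<^sup>2 + n\<^sup>2 = int N"
      by (cases p) (auto simp: two_squares_def)
    have "m\<^sup>2 \<ge> 0" "n\<^sup>2 \<ge> 0" by auto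
    with eq have le: "nat (m\<^sup>2) \<le> N" by linarith
    hence "int (N - nat (m\<^sup>2)) = n\<^sup>2" using eq by (simp add: of_nat_diff)
    with le show "(\<lambda>(m, n). (nat (m\<^sup>2), m, n)) p \<in> (SIGMA i:{0..N}. {m. m\<^sup>2 = int i} \<times> {n. n\<^sup>2 = int (N - i)})"
      by (simp add: p)
  qed
qed (auto simp: two_squares_def of_nat_diff)

lemma sqfps_mult_nth: "fps_nth (sqfps u * sqfps v) N = (\<Sum>(m, n)\<in>two_squares N. u m * v n)"
proof -
  have "fps_nth (sqfps u * sqfps v) N =
      (\<Sum>i=0..N. \<Sum>(m, n)\<in>{m. m\<^sup>2 = int i} \<times> {n. n\<^sup>2 = int (N - i)}. u m * v n)"
    unfolding fps_mult_nth sqfps_def by (simp add: sum_product sum.cartesian_product)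
  also have "\<dots> = (\<Sum>(i, m, n)\<in>(SIGMA i:{0..N}. {m. m\<^sup>2 = int i} \<times> {n. n\<^sup>2 = int (N - i)}). u m * v n)"
    by (subst sum.Sigma) (auto intro!: sum.cong finite_cartesian_product simp: finite_squares simp del: of_nat_diff)
  also have "\<dots> = (\<Sum>(m, n)\<in>two_squares N. u m * v n)"
    using two_squares_conv_Sigma by (rule sum.reindex_bij_betw[of _ _ _ "\<lambda>(m, n). u m * v n", THEN trans[rotated]])
      (auto intro!: sum.cong)
  finally show ?thesis .
qed

text \<open>In the Gaussian integers the map is (1 + i) (u - v i) = (u + v) + (u - v) i. It is onto
  because an even norm forces divisibility by 1 + i, which here is the parity of m + n.\<close>

lemma two_squares_double:
  "bij_betw (\<lambda>(u, v). (u + v, u - v)) (two_squares N) (two_squares (2 * N))"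
proof (rule bij_betwI[where g = "\<lambda>(m, n). ((m + n) div 2, (m - n) div 2)"])
  show "(\<lambda>(m, n). ((m + n) div 2, (m - n) div 2)) \<in> two_squares (2 * N) \<rightarrow> two_squares N"
  proof
    fix p assume "p \<in> two_squares (2 * N)"
    then obtain m n where p: "p = (m, n)" and eq: "m\<^sup>2 + n\<^sup>2 = 2 * int N"
      by (cases p) (auto simp: two_squares_def)
    hence "even (m\<^sup>2 + n\<^sup>2)" by simp
    hence "even (m + n)" by simp
    then obtain u where u: "m + n = 2 * u" by (rule evenE)
    have m: "m = u + (u - n)" and v: "m - n = 2 * (u - n)" using u by auto
    have "2 * (u\<^sup>2 + (u - n)\<^sup>2) = m\<^sup>2 + n\<^sup>2" by (subst m) (simp add: power2_eq_square algebra_simps)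
    thus "(\<lambda>(m, n). ((m + n) div 2, (m - n) div 2)) p \<in> two_squares N"
      using eq by (simp add: p two_squares_def u v)
  qed
  fix p assume "p \<in> two_squares (2 * N)"
  then obtain m n where p: "p = (m, n)" "m\<^sup>2 + n\<^sup>2 = 2 * int N" by (cases p) (auto simp: two_squares_def)
  hence "even (m\<^sup>2 + n\<^sup>2)" by simp
  hence "even (m + n)" by simp
  then obtain u where u: "m + n = 2 * u" by (rule evenE)
  have v: "m - n = 2 * (u - n)" using u by auto
  show "(\<lambda>(u, v). (u + v, u - v)) ((\<lambda>(m, n). ((m + n) div 2, (m - n) div 2)) p) = p"
    using u v unfolding p prod.case by (simp only: prod.inject) presburger
qed (auto simp: two_squares_def power2_eq_square algebra_simps)

section \<open>The three theta constants as series\<close>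

definition T3 :: "complex fps" where "T3 = sqfps (\<lambda>_. 1)"
definition T4 :: "complex fps" where "T4 = T3 oo - fps_X"

lemma T3_nth: "fps_nth T3 N = of_nat (card {m::int. m\<^sup>2 = int N})"
  by (simp add: T3_def sqfps_def)

lemma nome_power: "nome z ^ n = exp (\<i> * of_real pi * z * of_nat n)"
  by (simp add: mult_ac flip: exp_of_nat_mult)

lemma theta3_conv_nome: "theta3 z = (\<Sum>\<^sub>\<infinity>n::int. nome z ^ nat (n\<^sup>2))"
proof -
  have "exp (\<i> * of_real pi * z * (of_int n)^2) = nome z ^ nat (n\<^sup>2)" for n :: int
  proof -
    have "of_nat (nat (n\<^sup>2)) = (of_int n ^ 2 :: complex)" by simp
    thus ?thesis by (simp only: nome_power)
  qed
  thus ?thesis by (simp add: theta3_def)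
qed

lemma qexp_theta3: "qexp theta3 T3"
proof -
  have "nat \<bar>n\<bar> \<le> nat (n\<^sup>2) + 1" for n :: int
    using abs_le_square_int[of n] by simp
  from qexp_theta[of "\<lambda>n. nat (n\<^sup>2)", OF this]
  have "qexp theta3 (Abs_fps (\<lambda>N. of_nat (card {n::int. nat (n\<^sup>2) = N})))"
    by (simp flip: theta3_conv_nome)
  moreover have "{n::int. nat (n\<^sup>2) = N} = {n. n\<^sup>2 = int N}" for N by (auto simp: nat_eq_iff)
  moreover have "Abs_fps (\<lambda>N. of_nat (card {n::int. n\<^sup>2 = int N})) = T3"
    by (simp add: fps_eq_iff T3_nth)
  ultimately show ?thesis by simp
qed

text \<open>This is theta2 with the factor q^(1/4) removed: (n + 1/2)^2 = 1/4 + n^2 + n, so what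
  remains is a power series in the nome.\<close>

definition psi2 :: "complex \<Rightarrow> complex" where
  "psi2 z = (\<Sum>\<^sub>\<infinity>n::int. nome z ^ nat (n\<^sup>2 + n))"

definition Psi2 :: "complex fps" where
  "Psi2 = Abs_fps (\<lambda>N. of_nat (card {n::int. n\<^sup>2 + n = int N}))"

lemma int_square_add_nonneg: "n\<^sup>2 + n \<ge> (0::int)"
  using abs_le_square_int[of n] by arith

lemma qexp_psi2: "qexp psi2 Psi2"
proof -
  have "nat \<bar>n\<bar> \<le> nat (n\<^sup>2 + n) + 1" for n :: int
  proof -
    have "\<bar>n\<bar> \<le> n\<^sup>2 + n + 1"
    proof (cases "n \<ge> 0")
      case False
      have "0 \<le> (n + 1)\<^sup>2" by simp
      also have "(n + 1)\<^sup>2 = n\<^sup>2 + n + 1 + n" by (simp add: power2_eq_square algebra_simps)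
      finally show ?thesis using False by simp
    qed auto
    thus ?thesis using int_square_add_nonneg[of n] by (simp add: nat_le_iff)
  qed
  from qexp_theta[of "\<lambda>n. nat (n\<^sup>2 + n)", OF this]
  have "qexp psi2 (Abs_fps (\<lambda>N. of_nat (card {n::int. nat (n\<^sup>2 + n) = N})))"
    by (simp add: psi2_def[abs_def])
  moreover have "{n::int. nat (n\<^sup>2 + n) = N} = {n. n\<^sup>2 + n = int N}" for N
    using int_square_add_nonneg by (auto simp: nat_eq_iff)
  ultimately show ?thesis by (simp add: Psi2_def)
qed

lemma theta2_conv_psi2: "theta2 z = nome (z / 4) * psi2 z"
proof -
  have "exp (\<i> * of_real pi * z * (of_int n + 1/2)^2) = nome (z / 4) * nome z ^ nat (n\<^sup>2 + n)" for n :: int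
  proof -
    have "of_nat (nat (n\<^sup>2 + n)) = (of_int (n\<^sup>2 + n) :: complex)"
      using int_square_add_nonneg[of n] by simp
    hence "\<i> * of_real pi * z * (of_int n + 1/2)^2 =
        \<i> * of_real pi * (z / 4) + \<i> * of_real pi * z * of_nat (nat (n\<^sup>2 + n))"
      by (simp add: power2_eq_square algebra_simps)
    thus ?thesis by (simp only: nome_power exp_add)
  qed
  thus ?thesis by (simp add: theta2_def psi2_def infsum_cmult_right')
qed

lemma theta4_conv_theta3: "theta4 z = theta3 (z + 1)"
  by (simp add: theta4_def theta3_def)

lemma exp_\<i>_pi_2_int: "exp (\<i> * of_real pi * (2 * of_int n)) = 1"
  using exp_integer_2pi[of "of_int n"] by (simp add: mult_ac)

lemma theta3_plus_2: "theta3 (z + 2) = theta3 z"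
proof -
  have "exp (\<i> * of_real pi * (z + 2) * (of_int n)^2) = exp (\<i> * of_real pi * z * (of_int n)^2)" for n :: int
    using exp_\<i>_pi_2_int[of "n^2"] by (simp add: ring_distribs exp_add mult_ac)
  thus ?thesis by (simp add: theta3_def)
qed

lemma theta4_plus_1: "theta4 (z + 1) = theta3 z"
  using theta3_plus_2[of z] by (simp add: theta4_conv_theta3 add.assoc)

lemma theta2_plus_1: "theta2 (z + 1) = nome (1/4) * theta2 z"
proof -
  have "nome (z + 1) ^ nat (n\<^sup>2 + n) = nome z ^ nat (n\<^sup>2 + n)" for n :: int
  proof -
    have "even (nat (n\<^sup>2 + n))" using int_square_add_nonneg[of n] by (simp add: even_nat_iff)
    moreover have "nome (z + 1) = - nome z" by (simp add: ring_distribs exp_add)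
    ultimately show ?thesis by (simp only: power_minus_even)
  qed
  hence "psi2 (z + 1) = psi2 z" by (simp add: psi2_def)
  thus ?thesis by (simp add: theta2_conv_psi2 add_divide_distrib ring_distribs exp_add mult_ac)
qed

text \<open>Splits the summation index by parity; odd squares are (2 n + 1)^2 = 4 (n + 1/2)^2, the
  theta2 exponents at 4 z.\<close>

lemma theta3_split:
  assumes "Im z > 0"
  shows "theta3 z = theta3 (4 * z) + theta2 (4 * z)"
proof -
  define f where "f = (\<lambda>n::int. exp (\<i> * of_real pi * z * (of_int n)^2))"
  have "(\<lambda>n::int. nome z ^ nat (n\<^sup>2)) summable_on UNIV"
  proof (rule summable_on_int_power)
    show "norm (nome z) < 1" using assms by simp
    show "nat \<bar>n\<bar> \<le> nat (n\<^sup>2) + 1" for n :: int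
      using abs_le_square_int[of n] by simp
  qed
  moreover have "nome z ^ nat (n\<^sup>2) = f n" for n
  proof -
    have "of_nat (nat (n\<^sup>2)) = (of_int n ^ 2 :: complex)" by simp
    thus ?thesis by (simp only: nome_power f_def)
  qed
  ultimately have f: "f summable_on UNIV" by simp
  have U: "UNIV = range (\<lambda>n::int. 2 * n) \<union> range (\<lambda>n. 2 * n + 1)"
    by (auto, metis evenE oddE rangeI)
  have "theta3 z = infsum f (range (\<lambda>n::int. 2 * n) \<union> range (\<lambda>n. 2 * n + 1))"
    by (simp add: theta3_def f_def flip: U)
  also have "\<dots> = infsum f (range (\<lambda>n::int. 2 * n)) + infsum f (range (\<lambda>n. 2 * n + 1))"
    using f by (intro infsum_Un_disjoint) (auto elim: summable_on_subset_banach, presburger)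
  also have "infsum f (range (\<lambda>n::int. 2 * n)) = theta3 (4 * z)"
    by (subst infsum_reindex) (auto simp: inj_on_def theta3_def f_def o_def power2_eq_square mult_ac)
  also have "infsum f (range (\<lambda>n::int. 2 * n + 1)) = theta2 (4 * z)"
    by (subst infsum_reindex) (auto simp: inj_on_def theta2_def f_def o_def power2_eq_square algebra_simps)
  finally show ?thesis .
qed

lemma qexp_theta4: "qexp theta4 T4"
proof -
  have "qexp (\<lambda>z. theta3 (z + of_real 1)) (T3 oo (fps_const (nome (of_real 1)) * fps_X))"
    by (rule qexp_translate[OF qexp_theta3])
  moreover have "fps_const (nome (of_real 1)) * fps_X = - fps_X"
    by (simp flip: fps_const_neg)
  ultimately have "qexp (\<lambda>z. theta3 (z + of_real 1)) T4" by (simp only: T4_def)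
  thus ?thesis by (simp add: theta4_conv_theta3[abs_def])
qed

text \<open>Replacing q by -q cancels the odd coefficients of T3^2 and doubles the even ones, and by
  \<open>two_squares_double\<close> a number and its double have equally many
  representations.\<close>

lemma T3_T4_squares: "T3\<^sup>2 + T4\<^sup>2 = 2 * (T3 oo fps_X ^ 2)\<^sup>2"
proof (rule fps_ext)
  fix N
  have d: "fps_nth (T3\<^sup>2) (2 * M) = fps_nth (T3\<^sup>2) M" for M
    unfolding power2_eq_square T3_def sqfps_mult_nth
    using bij_betw_same_card[OF two_squares_double[of M]] by simp
  have "T4\<^sup>2 = T3\<^sup>2 oo - fps_X" by (simp add: T4_def fps_compose_power)
  moreover have "(T3 oo fps_X ^ 2)\<^sup>2 = T3\<^sup>2 oo fps_X ^ 2" by (subst fps_compose_power) simp_all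
  ultimately show "fps_nth (T3\<^sup>2 + T4\<^sup>2) N = fps_nth (2 * (T3 oo fps_X ^ 2)\<^sup>2) N"
    by (cases "even N") (auto simp: fps_compose_uminus' fps_nth_compose_X_power d elim!: evenE)
qed

lemma theta3_theta4_squares:
  assumes "Im z > 0"
  shows "theta3 z ^ 2 + theta4 z ^ 2 = 2 * theta3 (2 * z) ^ 2"
proof -
  have "qexp (\<lambda>z. theta3 z ^ 2 + theta4 z ^ 2) (T3\<^sup>2 + T4\<^sup>2)"
    by (intro qexp_add qexp_power qexp_theta3 qexp_theta4)
  moreover have "qexp (\<lambda>z. 2 * theta3 (of_nat 2 * z) ^ 2) (fps_const 2 * (T3 oo fps_X ^ 2)\<^sup>2)"
    by (intro qexp_cmult qexp_power qexp_dilate qexp_theta3) simp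
  moreover have "fps_const 2 * (T3 oo fps_X ^ 2)\<^sup>2 = T3\<^sup>2 + T4\<^sup>2"
    unfolding T3_T4_squares by (simp add: numeral_fps_const)
  ultimately have "theta3 z ^ 2 + theta4 z ^ 2 = eval_fps (T3\<^sup>2 + T4\<^sup>2) (nome z)"
    "2 * theta3 (of_nat 2 * z) ^ 2 = eval_fps (T3\<^sup>2 + T4\<^sup>2) (nome z)"
    using assms by (auto dest: qexp_eval)
  thus ?thesis by simp
qed

text \<open>Writing \<open>a = theta3 (4 z)\<close>, \<open>b = theta2 (4 z)\<close>, all theta constants at \<open>z\<close> and \<open>2 z\<close>
  become polynomials in \<open>a\<close> and \<open>b\<close>.\<close>

lemma theta4_split:
  assumes "Im z > 0"
  shows "theta4 z = theta3 (4 * z) - theta2 (4 * z)"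
proof -
  have "theta3 (4 * z + 2 + 2) = theta3 (4 * z)" by (simp only: theta3_plus_2)
  moreover have "theta2 (4 * z + 1 + 1 + 1 + 1) = nome (1/4) ^ 4 * theta2 (4 * z)"
    by (simp only: theta2_plus_1 power4_eq_xxxx mult.assoc)
  moreover have "nome (1/4) ^ 4 = -1" by (simp only: nome_power) simp
  ultimately show ?thesis
    using theta3_split[of "z + 1"] assms by (simp add: theta4_conv_theta3 ring_distribs add.assoc)
qed

lemma theta3_double_split:
  assumes "Im z > 0"
  shows "theta3 (2 * z) ^ 2 = theta3 (4 * z) ^ 2 + theta2 (4 * z) ^ 2"
  using theta3_theta4_squares[OF assms] theta3_split[OF assms] theta4_split[OF assms] by algebra

lemma theta3_sq_split:
  assumes "Im z > 0"
  shows "theta3 z ^ 2 = theta3 (2 * z) ^ 2 + theta2 (2 * z) ^ 2"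
  using theta3_double_split[of "z / 2"] assms by simp

lemma theta4_sq_split:
  assumes "Im z > 0"
  shows "theta4 z ^ 2 = theta3 (2 * z) ^ 2 - theta2 (2 * z) ^ 2"
  using theta3_theta4_squares[OF assms] theta3_sq_split[OF assms] by (simp add: algebra_simps)

lemma theta2_double_split:
  assumes "Im z > 0"
  shows "theta2 (2 * z) ^ 2 = 2 * theta3 (4 * z) * theta2 (4 * z)"
  using theta3_sq_split[OF assms] theta3_double_split[OF assms] theta3_split[OF assms]
  by (simp add: power2_eq_square algebra_simps)

lemma theta2_sq_split:
  assumes "Im z > 0"
  shows "theta2 z ^ 2 = 2 * theta3 (2 * z) * theta2 (2 * z)"
  using theta2_double_split[of "z / 2"] assms by simp

lemma theta2_pow4_split:
  assumes "Im z > 0"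
  shows "theta2 z ^ 4 = 4 * theta3 (2 * z) ^ 2 * theta2 (2 * z) ^ 2"
proof -
  have "theta2 z ^ 4 = (theta2 z ^ 2) ^ 2" by simp
  thus ?thesis unfolding theta2_sq_split[OF assms] by (simp add: power2_eq_square)
qed

text \<open>With p = theta3(2z)^2 and r = theta2(2z)^2 this is (p + r)^2 - (p - r)^2 = 4 p
  r.\<close>

lemma jacobi_identity:
  assumes "Im z > 0"
  shows "theta2 z ^ 4 = theta3 z ^ 4 - theta4 z ^ 4"
proof -
  have "theta3 z ^ 4 - theta4 z ^ 4 = (theta3 z ^ 2) ^ 2 - (theta4 z ^ 2) ^ 2" by simp
  thus ?thesis
    unfolding theta2_pow4_split[OF assms] theta3_sq_split[OF assms] theta4_sq_split[OF assms]
    by (simp add: power2_eq_square algebra_simps)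
qed

lemma theta3_theta4_mult:
  assumes "Im z > 0"
  shows "theta3 z * theta4 z = theta4 (2 * z) ^ 2"
proof -
  have "theta4 (2 * z) ^ 2 = theta3 (4 * z) ^ 2 - theta2 (4 * z) ^ 2"
    using theta4_sq_split[of "2 * z"] assms by simp
  thus ?thesis
    unfolding theta3_split[OF assms] theta4_split[OF assms] by (simp add: power2_eq_square algebra_simps)
qed

text \<open>The route through the Jacobi identity avoids the fractional exponents of theta2.\<close>

lemma qexp_theta2_pow4: "qexp (\<lambda>z. theta2 z ^ 4) (T3 ^ 4 - T4 ^ 4)"
  by (rule qexp_cong[OF qexp_diff[OF qexp_power[OF qexp_theta3] qexp_power[OF qexp_theta4]]])
     (simp add: jacobi_identity)

subsection \<open>Coefficient extraction\<close>

definition has_qexp :: "(complex \<Rightarrow> complex) \<Rightarrow> bool" where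
  "has_qexp F \<longleftrightarrow> (\<exists>A. qexp F A)"

definition cf :: "(complex \<Rightarrow> complex) \<Rightarrow> nat \<Rightarrow> complex" where
  "cf F n = fcoeff F (real n)"

lemma qexp_cf: "qexp F A \<Longrightarrow> cf F n = fps_nth A n"
  unfolding cf_def by (rule qexp_fcoeff)

lemma qexp_imp_nice: "qexp F A \<Longrightarrow> has_qexp F"
  by (auto simp: has_qexp_def)

named_theorems has_qexp_intros

lemma has_qexp_const [has_qexp_intros]: "has_qexp (\<lambda>_. c)"
  using qexp_const by (auto simp: has_qexp_def)

lemma has_qexp_add [has_qexp_intros]: "has_qexp F \<Longrightarrow> has_qexp G \<Longrightarrow> has_qexp (\<lambda>z. F z + G z)"
  unfolding has_qexp_def by (elim exE, rule exI, erule (1) qexp_add)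

lemma has_qexp_diff [has_qexp_intros]: "has_qexp F \<Longrightarrow> has_qexp G \<Longrightarrow> has_qexp (\<lambda>z. F z - G z)"
  unfolding has_qexp_def by (elim exE, rule exI, erule (1) qexp_diff)

lemma has_qexp_mult [has_qexp_intros]: "has_qexp F \<Longrightarrow> has_qexp G \<Longrightarrow> has_qexp (\<lambda>z. F z * G z)"
  unfolding has_qexp_def by (elim exE, rule exI, erule (1) qexp_mult)

lemma has_qexp_minus [has_qexp_intros]: "has_qexp F \<Longrightarrow> has_qexp (\<lambda>z. - F z)"
  using has_qexp_mult[OF has_qexp_const[of "-1"], of F] by simp

lemma has_qexp_divide [has_qexp_intros]: "has_qexp F \<Longrightarrow> has_qexp (\<lambda>z. F z / c)"
  unfolding has_qexp_def by (elim exE, rule exI, erule qexp_divide)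

lemma has_qexp_power [has_qexp_intros]: "has_qexp F \<Longrightarrow> has_qexp (\<lambda>z. F z ^ n)"
  unfolding has_qexp_def by (elim exE, rule exI, erule qexp_power)

lemma has_qexp_sum [has_qexp_intros]: "(\<And>i. i \<in> I \<Longrightarrow> has_qexp (F i)) \<Longrightarrow> has_qexp (\<lambda>z. \<Sum>i\<in>I. F i z)"
  by (induction I rule: infinite_finite_induct) (simp_all add: has_qexp_const has_qexp_add)

lemma has_qexp_dilate: "has_qexp F \<Longrightarrow> N > 0 \<Longrightarrow> has_qexp (\<lambda>z. F (of_nat N * z))"
  unfolding has_qexp_def by (elim exE, rule exI, erule (1) qexp_dilate)

lemma has_qexp_dilate_numeral: "has_qexp F \<Longrightarrow> has_qexp (\<lambda>z. F (numeral k * z))"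
  using has_qexp_dilate[of F "numeral k"] by simp

lemma has_qexp_cong: "has_qexp F \<Longrightarrow> (\<And>z. Im z > 0 \<Longrightarrow> F z = G z) \<Longrightarrow> has_qexp G"
  unfolding has_qexp_def by (elim exE, rule exI, erule qexp_cong) blast

lemma has_qexp_theta3 [has_qexp_intros]: "has_qexp theta3"
  using qexp_theta3 by (rule qexp_imp_nice)

lemma has_qexp_theta4 [has_qexp_intros]: "has_qexp theta4"
  using qexp_theta4 by (rule qexp_imp_nice)

lemma has_qexp_psi2 [has_qexp_intros]: "has_qexp psi2"
  using qexp_psi2 by (rule qexp_imp_nice)

lemmas has_qexp_dilated_thetas [has_qexp_intros] =
  has_qexp_dilate_numeral[OF has_qexp_theta3] has_qexp_dilate_numeral[OF has_qexp_theta4]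
  has_qexp_dilate_numeral[OF has_qexp_psi2]

lemma has_qexp_theta2_pow4: "has_qexp (\<lambda>z. theta2 z ^ 4)"
  using qexp_theta2_pow4 by (rule qexp_imp_nice)

lemma has_qexp_theta2_power [has_qexp_intros]:
  assumes "4 dvd n" shows "has_qexp (\<lambda>z. theta2 z ^ n)"
proof -
  obtain k where "n = 4 * k" using assms by blast
  thus ?thesis using has_qexp_power[OF has_qexp_theta2_pow4, of k] by (simp add: power_mult)
qed

lemma has_qexp_theta2_4 [has_qexp_intros]: "has_qexp (\<lambda>z. theta2 (4 * z))"
proof (rule has_qexp_cong)
  show "has_qexp (\<lambda>z. theta3 z - theta3 (4 * z))" by (intro has_qexp_intros)
  show "theta3 z - theta3 (4 * z) = theta2 (4 * z)" if "Im z > 0" for z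
    by (subst theta3_split[OF that]) simp
qed

lemma has_qexp_Delta8 [has_qexp_intros]: "has_qexp Delta8"
  unfolding Delta8_def[abs_def] by (intro has_qexp_intros) auto

lemma has_qexp_phi8 [has_qexp_intros]: "has_qexp phi8"
  unfolding phi8_def[abs_def] by (intro has_qexp_intros) auto

lemma has_qexp_mf [has_qexp_intros]: "has_qexp (mf e a b)"
  unfolding mf_def[abs_def] by (intro has_qexp_intros)

lemma cf_cong: "(\<And>z. Im z > 0 \<Longrightarrow> F z = G z) \<Longrightarrow> cf F n = cf G n"
  unfolding cf_def fcoeff_def by (intro arg_cong[where f = "\<lambda>x. 1/2 * x"] integral_cong) simp

lemma cf_add: "has_qexp F \<Longrightarrow> has_qexp G \<Longrightarrow> cf (\<lambda>z. F z + G z) n = cf F n + cf G n"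
proof -
  assume "has_qexp F" "has_qexp G"
  then obtain A B where "qexp F A" "qexp G B" by (auto simp: has_qexp_def)
  thus ?thesis using qexp_cf[OF qexp_add[of F A G B]] by (simp add: qexp_cf)
qed

lemma cf_mult: "has_qexp F \<Longrightarrow> has_qexp G \<Longrightarrow> cf (\<lambda>z. F z * G z) n = (\<Sum>i=0..n. cf F i * cf G (n - i))"
proof -
  assume "has_qexp F" "has_qexp G"
  then obtain A B where "qexp F A" "qexp G B" by (auto simp: has_qexp_def)
  thus ?thesis using qexp_cf[OF qexp_mult[of F A G B]] by (simp add: qexp_cf fps_mult_nth)
qed

lemma cf_cmult: "has_qexp F \<Longrightarrow> cf (\<lambda>z. c * F z) n = c * cf F n"
proof -
  assume "has_qexp F"
  then obtain A where "qexp F A" by (auto simp: has_qexp_def)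
  thus ?thesis using qexp_cf[OF qexp_cmult[of F A c]] by (simp add: qexp_cf)
qed

lemma cf_sum:
  "(\<And>i. i \<in> I \<Longrightarrow> has_qexp (F i)) \<Longrightarrow> cf (\<lambda>z. \<Sum>i\<in>I. F i z) n = (\<Sum>i\<in>I. cf (F i) n)"
proof (induction I rule: infinite_finite_induct)
  case (insert x I)
  thus ?case by (simp add: cf_add has_qexp_sum)
qed (auto simp: cf_def fcoeff_def)

lemma cf_dilate: "has_qexp F \<Longrightarrow> N > 0 \<Longrightarrow> cf (\<lambda>z. F (of_nat N * z)) (N * m) = cf F m"
proof -
  assume "has_qexp F" and N: "N > 0"
  then obtain A where A: "qexp F A" by (auto simp: has_qexp_def)
  show ?thesis using qexp_cf[OF qexp_dilate[OF A N], of "N * m"] qexp_cf[OF A] N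
    by (simp add: fps_nth_compose_X_power)
qed

lemma cf_translate: "has_qexp F \<Longrightarrow> cf (\<lambda>z. F (z + of_real s)) n = nome (of_real s) ^ n * cf F n"
proof -
  assume "has_qexp F"
  then obtain A where A: "qexp F A" by (auto simp: has_qexp_def)
  show ?thesis unfolding qexp_cf[OF qexp_translate[OF A]] qexp_cf[OF A] by (rule fps_nth_compose_linear)
qed

text \<open>Translation by 2 / N multiplies the n-th coefficient by the n-th power of a primitive
  N-th root of unity. A function scaled by the j-th power of that root therefore only has exponents
  congruent to j modulo N.\<close>

lemma cf_eq_0_of_twist:
  assumes F: "has_qexp F" and N: "N > 0"
    and tw: "\<And>z. Im z > 0 \<Longrightarrow> F (z + of_real (2 / real N)) = nome (of_real (2 / real N)) ^ j * F z"
    and n: "n mod N \<noteq> j mod N"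
  shows "cf F n = 0"
proof -
  let ?w = "nome (of_real (2 / real N))"
  have "?w ^ n * cf F n = cf (\<lambda>z. F (z + of_real (2 / real N))) n"
    by (rule cf_translate[OF F, symmetric])
  also have "\<dots> = cf (\<lambda>z. ?w ^ j * F z) n"
    by (rule cf_cong) (rule tw)
  also have "\<dots> = ?w ^ j * cf F n" by (rule cf_cmult[OF F])
  finally have "?w ^ n * cf F n = ?w ^ j * cf F n" .
  moreover have "?w ^ n \<noteq> ?w ^ j"
  proof -
    have "?w ^ k = exp (2 * of_real pi * \<i> * of_nat k / of_nat N)" for k
      unfolding nome_power by (rule arg_cong[where f = exp]) simp
    thus ?thesis using complex_root_unity_eq[of N n j] N n by (simp add: cong_def)
  qed
  ultimately show ?thesis by simp
qed

text \<open>The nome changes sign under z -> z + 1, so adding the two values keeps twice the even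
  part of the expansion.\<close>

lemma cf_U2:
  assumes F: "has_qexp F" and G: "has_qexp G" and eq: "\<And>z. Im z > 0 \<Longrightarrow> F z + F (z + 1) = 2 * G (2 * z)"
  shows "cf F (2 * m) = cf G m"
proof -
  have F1: "has_qexp (\<lambda>z. F (z + of_real 1))" using F qexp_translate[of F _ 1] unfolding has_qexp_def by blast
  have "2 * cf F (2 * m) = cf F (2 * m) + cf (\<lambda>z. F (z + of_real 1)) (2 * m)"
    using cf_translate[OF F, of 1 "2 * m"] by (simp add: power_mult)
  also have "\<dots> = cf (\<lambda>z. F z + F (z + of_real 1)) (2 * m)"
    by (rule cf_add[OF F F1, symmetric])
  also have "\<dots> = cf (\<lambda>z. 2 * G (of_nat 2 * z)) (2 * m)"
    by (rule cf_cong) (simp add: eq)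
  also have "\<dots> = 2 * cf G m"
    by (simp only: cf_cmult[OF has_qexp_dilate[OF G zero_less_numeral]] cf_dilate[OF G zero_less_numeral])
  finally show ?thesis by simp
qed

lemma theta2_plus_2: "theta2 (z + 2) = \<i> * theta2 z"
proof -
  have "theta2 (z + 1 + 1) = nome (1/4) ^ 2 * theta2 z"
    by (simp only: theta2_plus_1 power2_eq_square mult.assoc)
  moreover have "nome (1/4) ^ 2 = \<i>"
    by (simp only: nome_power) (simp add: exp_eq_polar cis_pi_half flip: cis_conv_exp)
  ultimately show ?thesis by (simp add: add.assoc)
qed

text \<open>A binary form in \<open>theta3 (4 z)\<close> and \<open>theta2 (4 z)\<close> splits by the exponent of the second
  variable modulo 4, because \<open>theta2 (4 z)\<close> only has exponents that are 1 modulo 8.\<close>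

primrec bform :: "complex list \<Rightarrow> nat \<Rightarrow> nat \<Rightarrow> nat \<Rightarrow> complex \<Rightarrow> complex \<Rightarrow> complex" where
  "bform [] d j r a b = 0"
| "bform (c # cs) d j r a b = (if j mod 4 = r then c * a ^ d * b ^ j else 0) + bform cs (d - 1) (Suc j) r a b"

lemma has_qexp_bform: "has_qexp (\<lambda>z. bform cs d j r (theta3 (4 * z)) (theta2 (4 * z)))"
proof (induction cs arbitrary: d j)
  case (Cons c cs)
  have "has_qexp (\<lambda>z. (if j mod 4 = r then c else 0) * theta3 (4 * z) ^ d * theta2 (4 * z) ^ j +
      bform cs (d - 1) (Suc j) r (theta3 (4 * z)) (theta2 (4 * z)))"
    by (intro has_qexp_intros Cons.IH)
  thus ?case by (rule has_qexp_cong) simp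
qed (simp add: has_qexp_const)

lemma \<i>_power_mod_4: "\<i> ^ j = \<i> ^ (j mod 4)"
proof -
  have "\<i> ^ j = \<i> ^ (4 * (j div 4) + j mod 4)" by simp
  also have "\<dots> = \<i> ^ (j mod 4)" by (simp only: power_add power_mult) simp
  finally show ?thesis .
qed

lemma bform_twist: "bform cs d j r a (\<i> * b) = \<i> ^ r * bform cs d j r a b"
proof (induction cs arbitrary: d j)
  case (Cons c cs)
  thus ?case using \<i>_power_mod_4[of j] by (auto simp: power_mult_distrib algebra_simps)
qed simp

text \<open>Translation by 1/2 fixes theta3(4z) and multiplies theta2(4z) by i, so the r-th summand
  can only contribute to indices congruent to r modulo 4.\<close>

lemma cf_bform:
  assumes "\<And>z. Im z > 0 \<Longrightarrow> F z = (\<Sum>r<4. bform cs d j r (theta3 (4 * z)) (theta2 (4 * z)))"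
  shows "cf F n = cf (\<lambda>z. bform cs d j (n mod 4) (theta3 (4 * z)) (theta2 (4 * z))) n"
proof -
  define R where "R = (\<lambda>r z. bform cs d j r (theta3 (4 * z)) (theta2 (4 * z)))"
  have R: "has_qexp (R r)" for r
    unfolding R_def by (rule has_qexp_bform)
  have tw: "R r (z + of_real (2 / real 4)) = nome (of_real (2 / real 4)) ^ r * R r z" for r z
  proof -
    have half: "nome (of_real (2 / real 4)) = \<i>"
      by (simp add: exp_eq_polar cis_pi_half flip: cis_conv_exp)
    have "4 * (z + of_real (2 / real 4)) = 4 * z + 2" by (simp add: algebra_simps)
    hence "R r (z + of_real (2 / real 4)) = bform cs d j r (theta3 (4 * z)) (\<i> * theta2 (4 * z))"
      by (simp only: R_def theta3_plus_2 theta2_plus_2)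
    thus ?thesis by (simp only: half bform_twist R_def)
  qed
  have z: "cf (R r) n = 0" if "r < 4" "r \<noteq> n mod 4" for r
    by (rule cf_eq_0_of_twist[OF R _ tw]) (use that in auto)
  have "cf F n = cf (\<lambda>z. \<Sum>r<4. R r z) n"
    by (rule cf_cong) (simp only: assms R_def)
  also have "\<dots> = (\<Sum>r<4. cf (R r) n)" by (intro cf_sum R)
  also have "\<dots> = (\<Sum>r\<in>{n mod 4}. cf (R r) n)"
    by (rule sum.mono_neutral_right) (auto intro!: z)
  finally show ?thesis by (simp add: R_def)
qed

lemma theta3_theta4_4z_twist:
  "theta3 (4 * (z + of_real (2 / real 8))) = theta4 (4 * z)"
  "theta4 (4 * (z + of_real (2 / real 8))) = theta3 (4 * z)"
  "theta2 (4 * (z + of_real (2 / real 8))) = nome (of_real (2 / real 8)) * theta2 (4 * z)"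
proof -
  have e: "4 * (z + of_real (2 / real 8)) = 4 * z + 1" by (simp add: algebra_simps)
  show "theta3 (4 * (z + of_real (2 / real 8))) = theta4 (4 * z)" by (simp only: e theta4_conv_theta3)
  show "theta4 (4 * (z + of_real (2 / real 8))) = theta3 (4 * z)" by (simp only: e theta4_plus_1)
  have "nome (of_real (2 / real 8)) = nome (1 / 4)" by simp
  thus "theta2 (4 * (z + of_real (2 / real 8))) = nome (of_real (2 / real 8)) * theta2 (4 * z)"
    by (simp only: e theta2_plus_1)
qed

text \<open>The factor \<open>2 ^ \<beta>\<close> clears the denominator in Delta8 = a b (a^2 + b^2)
  (a - b)^4 / 2; what remains is a binary polynomial with integer coefficients.\<close>

lemma mf_split:
  assumes "Im z > 0"
  shows "2 ^ \<beta> * mf e \<alpha> \<beta> z = (let a = theta3 (4 * z); b = theta2 (4 * z) in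
    ((a - b) ^ 4 - 8 * a * b * (a\<^sup>2 + b\<^sup>2)) ^ e * (a + b) ^ \<alpha> * (a * b * (a\<^sup>2 + b\<^sup>2) * (a - b) ^ 4) ^ \<beta>)"
proof -
  have "theta2 z ^ 4 = 8 * theta3 (4 * z) * theta2 (4 * z) * (theta3 (4 * z) ^ 2 + theta2 (4 * z) ^ 2)"
    unfolding theta2_pow4_split[OF assms] theta3_double_split[OF assms] theta2_double_split[OF assms] by simp
  hence D: "Delta8 z = theta3 (4 * z) * theta2 (4 * z) * (theta3 (4 * z) ^ 2 + theta2 (4 * z) ^ 2) *
      (theta3 (4 * z) - theta2 (4 * z)) ^ 4 / 2"
    and P: "phi8 z = (theta3 (4 * z) - theta2 (4 * z)) ^ 4 -
      8 * theta3 (4 * z) * theta2 (4 * z) * (theta3 (4 * z) ^ 2 + theta2 (4 * z) ^ 2)"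
    unfolding Delta8_def phi8_def theta4_split[OF assms] by simp_all
  show ?thesis unfolding mf_def D P theta3_split[OF assms] Let_def by (simp add: power_divide)
qed

lemma mf_at_4z:
  assumes "Im z > 0"
  shows "16 ^ \<beta> * mf e \<alpha> \<beta> (4 * z) = (let a = theta3 (4 * z); b = theta2 (4 * z) in
    (a ^ 4 - 2 * b ^ 4) ^ e * a ^ \<alpha> * (b ^ 4 * (a ^ 4 - b ^ 4)) ^ \<beta>)"
proof -
  have "theta4 (4 * z) ^ 4 = theta3 (4 * z) ^ 4 - theta2 (4 * z) ^ 4"
    using jacobi_identity[of "4 * z"] assms by simp
  thus ?thesis unfolding mf_def phi8_def Delta8_def Let_def by (simp add: power_divide)
qed

subsection \<open>Forms of half-integral weight\<close>

lemma acoef_conv_cf: "acoef e a b m = cf (mf e a b) m"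
  by (simp add: acoef_def cf_def)

text \<open>Translation by 1/4 exchanges theta3 and theta4 at 4 z, so it fixes both arguments of
  \<open>K\<close>, while theta2(4z) acquires a primitive eighth root of unity.\<close>

lemma cf_eq_0_mod_8:
  assumes "has_qexp F" "n mod 8 \<noteq> j mod 8"
    and "\<And>z. Im z > 0 \<Longrightarrow> F z = K (theta3 (4 * z) * theta4 (4 * z)) (theta3 (4 * z) ^ 4 + theta4 (4 * z) ^ 4) * theta2 (4 * z) ^ j"
  shows "cf F n = 0"
proof (rule cf_eq_0_of_twist[OF assms(1), of 8 j])
  fix z :: complex assume z: "Im z > 0"
  let ?s = "of_real (2 / real 8) :: complex"
  have "Im (z + ?s) > 0" using z by simp
  from assms(3)[OF this]
  have "F (z + ?s) = K (theta4 (4 * z) * theta3 (4 * z)) (theta4 (4 * z) ^ 4 + theta3 (4 * z) ^ 4) * (nome ?s * theta2 (4 * z)) ^ j"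
    by (simp only: theta3_theta4_4z_twist)
  thus "F (z + ?s) = nome ?s ^ j * F z"
    by (simp add: assms(3)[OF z] power_mult_distrib mult.commute add.commute mult.left_commute)
qed (use assms(2) in auto)

lemma cf_eigen_4:
  assumes "\<And>n. cf F (4 * n) = c * cf F n" "cf F n = 0"
  shows "cf F (4 ^ a * n) = 0"
  by (induction a) (use assms in \<open>auto simp: mult.assoc\<close>)

lemma sum_lessThan_4: "(\<Sum>r<(4::nat). f r) = f 0 + f 1 + f 2 + (f 3 :: complex)"
  by (simp add: eval_nat_numeral)

text \<open>Every half-integral weight case has the same shape: the exponents divisible by 4 reproduce the
  form itself, and the relevant odd residue class modulo 4 is a form in \<open>theta3 theta4\<close>,
  \<open>theta3\<^sup>4 + theta4\<^sup>4\<close> and one power of \<open>theta2\<close>, all at \<open>4 z\<close>,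
  which pins it down modulo 8.\<close>

lemma cf_mf_form:
  assumes form: "\<And>z. Im z > 0 \<Longrightarrow> 2 ^ \<beta> * mf e \<alpha> \<beta> z = (\<Sum>r<4. bform cs d 0 r (theta3 (4 * z)) (theta2 (4 * z)))"
  shows "2 ^ \<beta> * cf (mf e \<alpha> \<beta>) n = cf (\<lambda>z. bform cs d 0 (n mod 4) (theta3 (4 * z)) (theta2 (4 * z))) n"
  using cf_cmult[OF has_qexp_mf, of "2 ^ \<beta>" e \<alpha> \<beta> n] cf_bform[OF form, of n] by simp

text \<open>Here \<open>eig\<close> yields a(4 m) = c 8^\<beta> a(m), as 16^\<beta> / 2^\<beta> =
  8^\<beta>, which spreads a zero from n to 4^a n; \<open>res\<close> supplies the zero at
  n.\<close>

lemma acoef_form_eq_0: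
  assumes form: "\<And>z. Im z > 0 \<Longrightarrow> 2 ^ \<beta> * mf e \<alpha> \<beta> z = (\<Sum>r<4. bform cs d 0 r (theta3 (4 * z)) (theta2 (4 * z)))"
    and eig: "\<And>z. Im z > 0 \<Longrightarrow> bform cs d 0 0 (theta3 (4 * z)) (theta2 (4 * z)) = c * (16 ^ \<beta> * mf e \<alpha> \<beta> (4 * z))"
    and res: "\<And>z. Im z > 0 \<Longrightarrow> bform cs d 0 r (theta3 (4 * z)) (theta2 (4 * z)) =
       K (theta3 (4 * z) * theta4 (4 * z)) (theta3 (4 * z) ^ 4 + theta4 (4 * z) ^ 4) * theta2 (4 * z) ^ j"
    and n: "n mod 4 = r" "n mod 8 \<noteq> j mod 8"
  shows "acoef e \<alpha> \<beta> (4 ^ a * n) = 0"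
  unfolding acoef_conv_cf
proof (rule cf_eigen_4)
  fix m
  have "2 ^ \<beta> * cf (mf e \<alpha> \<beta>) (4 * m) = cf (\<lambda>z. bform cs d 0 ((4 * m) mod 4) (theta3 (4 * z)) (theta2 (4 * z))) (4 * m)"
    by (rule cf_mf_form[OF form])
  also have "\<dots> = cf (\<lambda>z. c * 16 ^ \<beta> * mf e \<alpha> \<beta> (of_nat 4 * z)) (4 * m)"
    by (rule cf_cong) (simp only: eig mod_mult_self1_is_0 mult.assoc of_nat_numeral)
  also have "\<dots> = c * 16 ^ \<beta> * cf (mf e \<alpha> \<beta>) m"
    by (simp only: cf_cmult[OF has_qexp_dilate[OF has_qexp_mf zero_less_numeral]] cf_dilate[OF has_qexp_mf zero_less_numeral])
  finally show "cf (mf e \<alpha> \<beta>) (4 * m) = c * 16 ^ \<beta> / 2 ^ \<beta> * cf (mf e \<alpha> \<beta>) m"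
    by (simp add: field_simps)
next
  have "2 ^ \<beta> * cf (mf e \<alpha> \<beta>) n = 0"
    using cf_mf_form[OF form, of n] cf_eq_0_mod_8[OF has_qexp_bform n(2) res] n(1) by simp
  thus "cf (mf e \<alpha> \<beta>) n = 0" by simp
qed

lemma theta4_pow4_4z:
  assumes "Im z > 0" shows "theta4 (4 * z) ^ 4 = theta3 (4 * z) ^ 4 - theta2 (4 * z) ^ 4"
  using jacobi_identity[of "4 * z"] assms by simp

text \<open>The list expands 2 theta3 Delta8 = a b (a - b)^3 (a^4 - b^4) in increasing powers of b.
  The terms in b^4 and b^8 combine to - a b^4 (a^4 - b^4), those in b and b^5 to a^4 b (a^4 - b^4).
  As a^4 - b^4 = theta4(4z)^4, the latter lives in exponents 1 modulo 8 and the class 5 is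
  empty.\<close>

lemma acoef_0_1_1: "acoef 0 1 1 (4 ^ a * (8 * b + 5)) = 0"
proof (rule acoef_form_eq_0[where cs = "[0,1,-3,3,-1,-1,3,-3,1]" and d = 9
      and c = "-1" and r = 1 and j = 1 and K = "\<lambda>x y. x ^ 4"])
  fix z :: complex assume z: "Im z > 0"
  show "2 ^ 1 * mf 0 1 1 z =
      (\<Sum>r<4. bform [0,1,-3,3,-1,-1,3,-3,1] 9 0 r (theta3 (4 * z)) (theta2 (4 * z)))"
    unfolding mf_split[OF z] sum_lessThan_4 Let_def by simp algebra
  show "bform [0,1,-3,3,-1,-1,3,-3,1] 9 0 0 (theta3 (4 * z)) (theta2 (4 * z)) =
      -1 * (16 ^ 1 * mf 0 1 1 (4 * z))"
    unfolding mf_at_4z[OF z] Let_def by simp algebra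
  show "bform [0,1,-3,3,-1,-1,3,-3,1] 9 0 1 (theta3 (4 * z)) (theta2 (4 * z)) =
      (theta3 (4 * z) * theta4 (4 * z)) ^ 4 * theta2 (4 * z) ^ 1"
    using theta4_pow4_4z[OF z] by simp algebra
qed presburger+

lemma acoef_0_3_1: "acoef 0 3 1 (4 ^ a * (8 * b + 7)) = 0"
proof (rule acoef_form_eq_0[where cs = "[0,1,-1,-2,2,0,0,2,-2,-1,1]" and d = 11
      and c = "2" and r = 3 and j = 3 and K = "\<lambda>x y. -2 * x ^ 4"])
  fix z :: complex assume z: "Im z > 0"
  show "2 ^ 1 * mf 0 3 1 z =
      (\<Sum>r<4. bform [0,1,-1,-2,2,0,0,2,-2,-1,1] 11 0 r (theta3 (4 * z)) (theta2 (4 * z)))"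
    unfolding mf_split[OF z] sum_lessThan_4 Let_def by simp algebra
  show "bform [0,1,-1,-2,2,0,0,2,-2,-1,1] 11 0 0 (theta3 (4 * z)) (theta2 (4 * z)) =
      2 * (16 ^ 1 * mf 0 3 1 (4 * z))"
    unfolding mf_at_4z[OF z] Let_def by simp algebra
  show "bform [0,1,-1,-2,2,0,0,2,-2,-1,1] 11 0 3 (theta3 (4 * z)) (theta2 (4 * z)) =
      -2 * (theta3 (4 * z) * theta4 (4 * z)) ^ 4 * theta2 (4 * z) ^ 3"
    using theta4_pow4_4z[OF z] by simp algebra
qed presburger+

text \<open>The coefficient of b^3 cancels, so the class 3 part is 8 a^4 b^7 (a^4 - b^4). It sits in
  exponents 7 modulo 8, hence the empty class is 3, whereas for theta3^3 Delta8 it is 7.\<close>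

lemma acoef_0_7_1: "acoef 0 7 1 (4 ^ a * (8 * b + 3)) = 0"
proof (rule acoef_form_eq_0[where cs = "[0,1,3,0,-8,-7,3,8,8,3,-7,-8,0,3,1]" and d = 15
      and c = "-8" and r = 3 and j = 7 and K = "\<lambda>x y. 8 * x ^ 4"])
  fix z :: complex assume z: "Im z > 0"
  show "2 ^ 1 * mf 0 7 1 z =
      (\<Sum>r<4. bform [0,1,3,0,-8,-7,3,8,8,3,-7,-8,0,3,1] 15 0 r (theta3 (4 * z)) (theta2 (4 * z)))"
    unfolding mf_split[OF z] sum_lessThan_4 Let_def by simp algebra
  show "bform [0,1,3,0,-8,-7,3,8,8,3,-7,-8,0,3,1] 15 0 0 (theta3 (4 * z)) (theta2 (4 * z)) =
      -8 * (16 ^ 1 * mf 0 7 1 (4 * z))"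
    unfolding mf_at_4z[OF z] Let_def by simp algebra
  show "bform [0,1,3,0,-8,-7,3,8,8,3,-7,-8,0,3,1] 15 0 3 (theta3 (4 * z)) (theta2 (4 * z)) =
      8 * (theta3 (4 * z) * theta4 (4 * z)) ^ 4 * theta2 (4 * z) ^ 7"
    using theta4_pow4_4z[OF z] by simp algebra
qed presburger+

text \<open>The class 3 part is 8 a^4 b^3 (a^4 - b^4) (2 a^4 - b^4). The last factor is theta3^4 +
  theta4^4 at 4 z, the second argument of \<open>K\<close>.\<close>

lemma acoef_1_3_1: "acoef 1 3 1 (4 ^ a * (8 * b + 7)) = 0"
proof (rule acoef_form_eq_0[where cs = "[0,1,-13,16,8,-23,35,-24,-24,35,-23,8,16,-13,1]" and d = 15
      and c = "8" and r = 3 and j = 3 and K = "\<lambda>x y. 8 * x ^ 4 * y"])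
  fix z :: complex assume z: "Im z > 0"
  show "2 ^ 1 * mf 1 3 1 z =
      (\<Sum>r<4. bform [0,1,-13,16,8,-23,35,-24,-24,35,-23,8,16,-13,1] 15 0 r (theta3 (4 * z)) (theta2 (4 * z)))"
    unfolding mf_split[OF z] sum_lessThan_4 Let_def by simp algebra
  show "bform [0,1,-13,16,8,-23,35,-24,-24,35,-23,8,16,-13,1] 15 0 0 (theta3 (4 * z)) (theta2 (4 * z)) =
      8 * (16 ^ 1 * mf 1 3 1 (4 * z))"
    unfolding mf_at_4z[OF z] Let_def by simp algebra
  show "bform [0,1,-13,16,8,-23,35,-24,-24,35,-23,8,16,-13,1] 15 0 3 (theta3 (4 * z)) (theta2 (4 * z)) =
      8 * (theta3 (4 * z) * theta4 (4 * z)) ^ 4 * (theta3 (4 * z) ^ 4 + theta4 (4 * z) ^ 4) * theta2 (4 * z) ^ 3"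
    using theta4_pow4_4z[OF z] by simp algebra
qed presburger+

text \<open>The coefficient of b vanishes; what is left of class 1 is 8 a^8 b^5 (a^4 - b^4)^2, in
  exponents 5 modulo 8.\<close>

lemma acoef_0_5_2: "acoef 0 5 2 (4 ^ a * (8 * b + 1)) = 0"
proof (rule acoef_form_eq_0[where cs = "[0,0,1,-3,0,8,-8,0,8,-16,10,10,-16,8,0,-8,8,0,-3,1]" and d = 21
      and c = "8" and r = 1 and j = 5 and K = "\<lambda>x y. 8 * x ^ 8"])
  fix z :: complex assume z: "Im z > 0"
  show "2 ^ 2 * mf 0 5 2 z =
      (\<Sum>r<4. bform [0,0,1,-3,0,8,-8,0,8,-16,10,10,-16,8,0,-8,8,0,-3,1] 21 0 r (theta3 (4 * z)) (theta2 (4 * z)))"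
    unfolding mf_split[OF z] sum_lessThan_4 Let_def by simp algebra
  show "bform [0,0,1,-3,0,8,-8,0,8,-16,10,10,-16,8,0,-8,8,0,-3,1] 21 0 0 (theta3 (4 * z)) (theta2 (4 * z)) =
      8 * (16 ^ 2 * mf 0 5 2 (4 * z))"
    unfolding mf_at_4z[OF z] Let_def by simp algebra
  show "bform [0,0,1,-3,0,8,-8,0,8,-16,10,10,-16,8,0,-8,8,0,-3,1] 21 0 1 (theta3 (4 * z)) (theta2 (4 * z)) =
      8 * (theta3 (4 * z) * theta4 (4 * z)) ^ 8 * theta2 (4 * z) ^ 5"
    using theta4_pow4_4z[OF z] by simp algebra
qed presburger+

text \<open>Doubling the index of a coefficient exchanges \<open>H1\<close> and \<open>H2\<close> up to constants and multiplies
  \<open>H3\<close> by a constant; all forms of integral weight considered here are carried to multiples of these.\<close>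

definition H1 :: "complex \<Rightarrow> complex" where
  "H1 z = theta3 z ^ 8 * theta2 z ^ 8 * theta4 z ^ 8 * (theta3 z ^ 4 + theta2 z ^ 4)"

definition H2 :: "complex \<Rightarrow> complex" where
  "H2 z = theta3 z ^ 4 * theta2 z ^ 4 * theta4 z ^ 16 * (theta3 z ^ 4 + theta2 z ^ 4)"

definition H3 :: "complex \<Rightarrow> complex" where
  "H3 z = theta3 z ^ 12 * theta2 z ^ 12 * theta4 z ^ 24 * (theta3 z ^ 4 + theta2 z ^ 4)"

lemma has_qexp_H [has_qexp_intros]: "has_qexp H1" "has_qexp H2" "has_qexp H3"
  unfolding H1_def[abs_def] H2_def[abs_def] H3_def[abs_def] by (intro has_qexp_intros; simp)+

text \<open>The form taken by the shadow of \<open>mf e \<alpha> \<beta>\<close>.\<close>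

definition shf :: "nat \<Rightarrow> nat \<Rightarrow> nat \<Rightarrow> complex \<Rightarrow> complex" where
  "shf e \<alpha> \<beta> z = (theta3 z ^ 4 + theta4 z ^ 4) ^ e * theta2 z ^ \<alpha> * (- (theta3 z ^ 4 * theta4 z ^ 4) / 16) ^ \<beta>"

lemma has_qexp_shf: "4 dvd \<alpha> \<Longrightarrow> has_qexp (shf e \<alpha> \<beta>)"
  unfolding shf_def[abs_def] by (intro has_qexp_intros)

lemma theta2_pow4_plus_1: "theta2 (z + 1) ^ 4 = - (theta2 z ^ 4)"
proof -
  have "nome (1/4) ^ 4 = -1" by (simp only: nome_power) simp
  thus ?thesis by (simp only: theta2_plus_1 power_mult_distrib) simp
qed

text \<open>With p = theta3(2z)^2 and r = theta2(2z)^2, the arguments of \<Phi> are p + r, p - r, 4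
  p r, and z -> z + 1 amounts to r -> - r. Those of \<Gamma> at 2 z are p^2, p^2 - r^2, r^2.
  Doubling an index thus becomes one polynomial identity in p and r.\<close>

lemma cf_U2_form:
  assumes has_qexp: "has_qexp F" "has_qexp G"
    and F: "\<And>z. F z = \<Phi> (theta3 z ^ 2) (theta4 z ^ 2) (theta2 z ^ 4)"
    and G: "\<And>z. G z = \<Gamma> (theta3 z ^ 4) (theta4 z ^ 4) (theta2 z ^ 4)"
    and eq: "\<And>p r. \<Phi> (p + r) (p - r) (4 * p * r) + \<Phi> (p - r) (p + r) (- (4 * p * r)) =
      2 * c * \<Gamma> (p\<^sup>2) (p\<^sup>2 - r\<^sup>2) (r\<^sup>2)"
  shows "cf F (2 * m) = c * cf G m"
proof -
  have "cf F (2 * m) = cf (\<lambda>z. c * G z) m"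
  proof (rule cf_U2[OF has_qexp(1)])
    show "has_qexp (\<lambda>z. c * G z)" by (intro has_qexp_intros has_qexp)
    fix z :: complex assume z: "Im z > 0"
    define p where "p = theta3 (2 * z) ^ 2"
    define r where "r = theta2 (2 * z) ^ 2"
    have 1: "theta3 z ^ 2 = p + r" "theta4 z ^ 2 = p - r" "theta2 z ^ 4 = 4 * p * r"
      using theta3_sq_split[OF z] theta4_sq_split[OF z] theta2_pow4_split[OF z] by (auto simp: p_def r_def)
    have 2: "theta3 (2 * z) ^ 4 = p\<^sup>2" "theta2 (2 * z) ^ 4 = r\<^sup>2" by (simp_all add: p_def r_def)
    have 3: "theta4 (2 * z) ^ 4 = p\<^sup>2 - r\<^sup>2"
      using jacobi_identity[of "2 * z"] z 2 by simp
    have 4: "theta3 (z + 1) = theta4 z" "theta4 (z + 1) = theta3 z"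
      by (simp_all add: theta4_conv_theta3[of z] theta4_plus_1)
    show "F z + F (z + 1) = 2 * (c * G (2 * z))"
      using eq[of p r] by (simp only: F G 1 2 3 4 theta2_pow4_plus_1 mult.assoc)
  qed
  thus ?thesis by (simp add: cf_cmult has_qexp)
qed

lemma cf_H1_double: "cf H1 (2 * m) = 16 * cf H2 m"
proof (rule cf_U2_form[where \<Phi> = "\<lambda>x y w. x ^ 4 * w ^ 2 * y ^ 4 * (x ^ 2 + w)" and \<Gamma> = "\<lambda>x y w. x * w * y ^ 4 * (x + w)"])
  fix p r :: complex
  show "(p + r) ^ 4 * (4 * p * r) ^ 2 * (p - r) ^ 4 * ((p + r) ^ 2 + 4 * p * r) +
      (p - r) ^ 4 * (- (4 * p * r)) ^ 2 * (p + r) ^ 4 * ((p - r) ^ 2 + - (4 * p * r)) =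
      2 * 16 * (p\<^sup>2 * r\<^sup>2 * (p\<^sup>2 - r\<^sup>2) ^ 4 * (p\<^sup>2 + r\<^sup>2))"
    by algebra
qed (intro has_qexp_intros, intro has_qexp_intros, simp_all add: H1_def H2_def flip: power_mult)

lemma cf_H2_double: "cf H2 (2 * m) = 256 * cf H1 m"
proof (rule cf_U2_form[where \<Phi> = "\<lambda>x y w. x ^ 2 * w * y ^ 8 * (x ^ 2 + w)" and \<Gamma> = "\<lambda>x y w. x ^ 2 * w ^ 2 * y ^ 2 * (x + w)"])
  fix p r :: complex
  show "(p + r) ^ 2 * (4 * p * r) * (p - r) ^ 8 * ((p + r) ^ 2 + 4 * p * r) +
      (p - r) ^ 2 * (- (4 * p * r)) * (p + r) ^ 8 * ((p - r) ^ 2 + - (4 * p * r)) =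
      2 * 256 * ((p\<^sup>2) ^ 2 * (r\<^sup>2) ^ 2 * (p\<^sup>2 - r\<^sup>2) ^ 2 * (p\<^sup>2 + r\<^sup>2))"
    by algebra
qed (intro has_qexp_intros, intro has_qexp_intros, simp_all add: H1_def H2_def flip: power_mult)

lemma cf_H3_double: "cf H3 (2 * m) = 4096 * cf H3 m"
proof (rule cf_U2_form[where \<Phi> = "\<lambda>x y w. x ^ 6 * w ^ 3 * y ^ 12 * (x ^ 2 + w)" and \<Gamma> = "\<lambda>x y w. x ^ 3 * w ^ 3 * y ^ 6 * (x + w)"])
  fix p r :: complex
  have *: "64 * p ^ 3 * r ^ 3 * X ^ 6 * (128 * (p ^ 3 * r ^ 3 * Y)) = 2 * 4096 * ((p\<^sup>2) ^ 3 * (r\<^sup>2) ^ 3 * X ^ 6 * Y)" for X Y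
    by algebra
  \<comment> \<open>The common factor is split off so that the remaining cancellation is an identity
    of degree 8 only.\<close>
  have "(p + r) ^ 6 * (4 * p * r) ^ 3 * (p - r) ^ 12 * ((p + r) ^ 2 + 4 * p * r) +
      (p - r) ^ 6 * (- (4 * p * r)) ^ 3 * (p + r) ^ 12 * ((p - r) ^ 2 + - (4 * p * r)) =
      64 * p ^ 3 * r ^ 3 * ((p + r) * (p - r)) ^ 6 *
      ((p - r) ^ 6 * ((p + r) ^ 2 + 4 * p * r) - (p + r) ^ 6 * ((p - r) ^ 2 - 4 * p * r))"
    by algebra
  also have "(p - r) ^ 6 * ((p + r) ^ 2 + 4 * p * r) - (p + r) ^ 6 * ((p - r) ^ 2 - 4 * p * r) =
      128 * (p ^ 3 * r ^ 3 * (p\<^sup>2 + r\<^sup>2))"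
    by algebra
  also have "(p + r) * (p - r) = p\<^sup>2 - r\<^sup>2" by algebra
  finally show "(p + r) ^ 6 * (4 * p * r) ^ 3 * (p - r) ^ 12 * ((p + r) ^ 2 + 4 * p * r) +
      (p - r) ^ 6 * (- (4 * p * r)) ^ 3 * (p + r) ^ 12 * ((p - r) ^ 2 + - (4 * p * r)) =
      2 * 4096 * ((p\<^sup>2) ^ 3 * (r\<^sup>2) ^ 3 * (p\<^sup>2 - r\<^sup>2) ^ 6 * (p\<^sup>2 + r\<^sup>2))"
    using *[of "p\<^sup>2 - r\<^sup>2" "p\<^sup>2 + r\<^sup>2"] by simp
qed (intro has_qexp_intros, intro has_qexp_intros, simp_all add: H3_def flip: power_mult)

subsection \<open>Forms of integral weight and sums of squares\<close>

definition vanishes :: "nat \<Rightarrow> (complex \<Rightarrow> complex) \<Rightarrow> bool" where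
  "vanishes k F \<longleftrightarrow> has_qexp F \<and> (\<forall>n<k. cf F n = 0)"

lemma vanishes_0: "has_qexp F \<Longrightarrow> vanishes 0 F"
  by (simp add: vanishes_def)

lemma vanishes_mult:
  assumes "vanishes k F" "vanishes l G"
  shows "vanishes (k + l) (\<lambda>z. F z * G z)"
proof -
  have n: "has_qexp F" "has_qexp G" using assms by (auto simp: vanishes_def)
  have "cf (\<lambda>z. F z * G z) m = 0" if "m < k + l" for m
    unfolding cf_mult[OF n]
  proof (rule sum.neutral, rule ballI)
    fix i assume i: "i \<in> {0..m}"
    hence "i < k \<or> m - i < l" using that by auto
    thus "cf F i * cf G (m - i) = 0" using assms by (auto simp: vanishes_def)
  qed
  thus ?thesis using has_qexp_mult[OF n] by (simp add: vanishes_def)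
qed

lemma vanishes_mult_left: "vanishes k F \<Longrightarrow> has_qexp G \<Longrightarrow> vanishes k (\<lambda>z. F z * G z)"
  using vanishes_mult[of k F 0 G] vanishes_0 by simp

lemma vanishes_mult_right: "has_qexp F \<Longrightarrow> vanishes k G \<Longrightarrow> vanishes k (\<lambda>z. F z * G z)"
  using vanishes_mult[of 0 F k G] vanishes_0 by simp

lemma vanishes_power: "vanishes k F \<Longrightarrow> vanishes (k * n) (\<lambda>z. F z ^ n)"
proof (induction n)
  case 0 then show ?case using vanishes_0[OF has_qexp_const[of 1]] by simp
next
  case (Suc n) then show ?case using vanishes_mult[of k F "k * n" "\<lambda>z. F z ^ n"] by simp
qed

lemma T3_nth_0 [simp]: "fps_nth T3 0 = 1"
  by (simp add: T3_nth)

lemma T4_nth: "fps_nth T4 n = (-1) ^ n * fps_nth T3 n"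
  by (simp add: T4_def fps_compose_uminus')

lemma vanishes_theta2_power:
  assumes "n = 4 * k" shows "vanishes k (\<lambda>z. theta2 z ^ n)"
proof -
  have "vanishes 1 (\<lambda>z. theta2 z ^ 4)"
    using has_qexp_theta2_pow4 by (simp add: vanishes_def qexp_cf[OF qexp_theta2_pow4] fps_nth_power_0 T4_nth)
  from vanishes_power[OF this, of k] show ?thesis by (simp add: assms power_mult)
qed

lemma vanishes_Delta8: "vanishes 1 Delta8"
proof -
  have "vanishes 1 (\<lambda>z. theta2 z ^ 4 * (theta4 z ^ 4 / 16))"
    by (intro vanishes_mult_left vanishes_theta2_power has_qexp_intros) simp
  thus ?thesis by (simp add: Delta8_def[abs_def])
qed

lemma vanishes_mf: "vanishes \<beta> (mf e \<alpha> \<beta>)"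
  unfolding mf_def[abs_def]
  using vanishes_mult_right[OF _ vanishes_power[OF vanishes_Delta8, of \<beta>]]
  by (simp add: has_qexp_intros)

lemma vanishes_shf:
  assumes "\<alpha> = 4 * k" shows "vanishes k (shf e \<alpha> \<beta>)"
  unfolding shf_def[abs_def]
  by (intro vanishes_mult_left vanishes_mult_right vanishes_theta2_power assms has_qexp_intros)

lemma vanishes_H: "vanishes 2 H1" "vanishes 3 H3"
  unfolding H1_def[abs_def] H3_def[abs_def]
  by (intro vanishes_mult_left vanishes_mult_right vanishes_theta2_power has_qexp_intros; simp)+

lemma cf_vanishes: "vanishes k F \<Longrightarrow> n < k \<Longrightarrow> cf F n = 0"
  by (simp add: vanishes_def)

text \<open>Two doublings lead from H1 back to H1, and the chain starts at index 1, which lies below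
  the order 2 forced by theta2^8.\<close>

lemma cf_H1_pow4: "cf H1 (4 ^ a) = 0"
proof (induction a)
  case (Suc a)
  thus ?case using cf_H1_double[of "2 * 4 ^ a"] cf_H2_double[of "4 ^ a"] by simp
qed (simp add: cf_vanishes[OF vanishes_H(1)])

lemma cf_H2_two_pow4: "cf H2 (2 * 4 ^ a) = 0"
  by (simp add: cf_H2_double cf_H1_pow4)

lemma cf_H3_pow2: "cf H3 (2 ^ a) = 0"
  by (induction a) (simp_all add: cf_vanishes[OF vanishes_H(2)] cf_H3_double)

text \<open>Writing theta3^\<alpha> as a power of theta3^2 requires \<alpha> even; the shadow
  version has theta2^\<alpha> instead and so takes \<alpha> divisible by 4. In both,
  \<open>16 ^ \<beta>\<close> clears the denominator of Delta8.\<close>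

lemma cf_mf_double:
  assumes has_qexp: "has_qexp G"
    and G: "\<And>z. G z = \<Gamma> (theta3 z ^ 4) (theta4 z ^ 4) (theta2 z ^ 4)"
    and \<alpha>: "\<alpha> = 2 * k"
    and eq: "\<And>p r. ((p - r)\<^sup>2 - 4 * p * r) ^ e * (p + r) ^ k * (4 * p * r * (p - r)\<^sup>2) ^ \<beta> +
        ((p + r)\<^sup>2 + 4 * p * r) ^ e * (p - r) ^ k * (- (4 * p * r) * (p + r)\<^sup>2) ^ \<beta> =
      2 * c * \<Gamma> (p\<^sup>2) (p\<^sup>2 - r\<^sup>2) (r\<^sup>2)"
  shows "16 ^ \<beta> * cf (mf e \<alpha> \<beta>) (2 * m) = c * cf G m"
proof -
  have "cf (\<lambda>z. 16 ^ \<beta> * mf e \<alpha> \<beta> z) (2 * m) = c * cf G m"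
  proof (rule cf_U2_form[OF _ has_qexp _ G, where \<Phi> = "\<lambda>x y w. (y\<^sup>2 - w) ^ e * x ^ k * (w * y\<^sup>2) ^ \<beta>"])
    show "has_qexp (\<lambda>z. 16 ^ \<beta> * mf e \<alpha> \<beta> z)" by (intro has_qexp_intros)
    show "16 ^ \<beta> * mf e \<alpha> \<beta> z = (((theta4 z)\<^sup>2)\<^sup>2 - theta2 z ^ 4) ^ e * ((theta3 z)\<^sup>2) ^ k * (theta2 z ^ 4 * ((theta4 z)\<^sup>2)\<^sup>2) ^ \<beta>" for z
      by (simp add: mf_def phi8_def Delta8_def \<alpha> power_divide flip: power_mult)
  qed (use eq in simp)
  thus ?thesis by (simp add: cf_cmult has_qexp_mf)
qed

lemma cf_shf_double:
  assumes has_qexp: "has_qexp G"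
    and G: "\<And>z. G z = \<Gamma> (theta3 z ^ 4) (theta4 z ^ 4) (theta2 z ^ 4)"
    and \<alpha>: "\<alpha> = 4 * k"
    and eq: "\<And>p r. ((p + r)\<^sup>2 + (p - r)\<^sup>2) ^ e * (4 * p * r) ^ k * (- ((p + r)\<^sup>2 * (p - r)\<^sup>2)) ^ \<beta> +
        ((p - r)\<^sup>2 + (p + r)\<^sup>2) ^ e * (- (4 * p * r)) ^ k * (- ((p - r)\<^sup>2 * (p + r)\<^sup>2)) ^ \<beta> =
      2 * c * \<Gamma> (p\<^sup>2) (p\<^sup>2 - r\<^sup>2) (r\<^sup>2)"
  shows "16 ^ \<beta> * cf (shf e \<alpha> \<beta>) (2 * m) = c * cf G m"
proof -
  have n: "has_qexp (shf e \<alpha> \<beta>)" by (rule has_qexp_shf) (simp add: \<alpha>)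
  have "cf (\<lambda>z. 16 ^ \<beta> * shf e \<alpha> \<beta> z) (2 * m) = c * cf G m"
  proof (rule cf_U2_form[OF _ has_qexp _ G, where \<Phi> = "\<lambda>x y w. (x\<^sup>2 + y\<^sup>2) ^ e * w ^ k * (- (x\<^sup>2 * y\<^sup>2)) ^ \<beta>"])
    show "has_qexp (\<lambda>z. 16 ^ \<beta> * shf e \<alpha> \<beta> z)" by (intro has_qexp_intros n)
    show "16 ^ \<beta> * shf e \<alpha> \<beta> z = (((theta3 z)\<^sup>2)\<^sup>2 + ((theta4 z)\<^sup>2)\<^sup>2) ^ e * (theta2 z ^ 4) ^ k * (- (((theta3 z)\<^sup>2)\<^sup>2 * ((theta4 z)\<^sup>2)\<^sup>2)) ^ \<beta>" for z
    proof -
      have "(16::complex) ^ \<beta> * (- (theta3 z ^ 4 * theta4 z ^ 4) / 16) ^ \<beta> = (- (theta3 z ^ 4 * theta4 z ^ 4)) ^ \<beta>"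
        by (subst power_mult_distrib[symmetric]) simp
      moreover have "16 ^ \<beta> * shf e \<alpha> \<beta> z = (theta3 z ^ 4 + theta4 z ^ 4) ^ e * theta2 z ^ \<alpha> *
          (16 ^ \<beta> * (- (theta3 z ^ 4 * theta4 z ^ 4) / 16) ^ \<beta>)"
        by (simp only: shf_def mult_ac)
      ultimately show ?thesis by (simp add: \<alpha> flip: power_mult)
    qed
  qed (use eq in simp)
  thus ?thesis by (simp add: cf_cmult n)
qed

lemma H1_form: "H1 z = (theta3 z ^ 4)\<^sup>2 * (theta2 z ^ 4)\<^sup>2 * (theta4 z ^ 4)\<^sup>2 * (theta3 z ^ 4 + theta2 z ^ 4)"
  by (simp add: H1_def)

lemma H2_form: "H2 z = theta3 z ^ 4 * theta2 z ^ 4 * (theta4 z ^ 4) ^ 4 * (theta3 z ^ 4 + theta2 z ^ 4)"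
  by (simp add: H2_def flip: power_mult)

lemma H3_form: "H3 z = (theta3 z ^ 4) ^ 3 * (theta2 z ^ 4) ^ 3 * (theta4 z ^ 4) ^ 6 * (theta3 z ^ 4 + theta2 z ^ 4)"
  by (simp add: H3_def flip: power_mult)


lemma cf_mf_1_16_1: "16 ^ 1 * cf (mf 1 16 1) (2 * m) = -256 * cf H1 m"
  by (rule cf_mf_double[where k = 8 and \<Gamma> = "\<lambda>x y w. x\<^sup>2 * w\<^sup>2 * y\<^sup>2 * (x + w)", OF has_qexp_H(1) H1_form])
     (simp, simp only: power_one_right power_0, algebra)

lemma cf_mf_0_12_2: "16 ^ 2 * cf (mf 0 12 2) (2 * m) = 16 * cf H2 m"
  by (rule cf_mf_double[where k = 6 and \<Gamma> = "\<lambda>x y w. x * w * y ^ 4 * (x + w)", OF has_qexp_H(2) H2_form])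
     (simp, simp only: power_one_right power_0, algebra)

lemma cf_mf_1_8_2: "16 ^ 2 * cf (mf 1 8 2) (2 * m) = 16 * cf H2 m"
  by (rule cf_mf_double[where k = 4 and \<Gamma> = "\<lambda>x y w. x * w * y ^ 4 * (x + w)", OF has_qexp_H(2) H2_form])
     (simp, simp only: power_one_right power_0, algebra)

lemma cf_mf_0_4_3: "16 ^ 3 * cf (mf 0 4 3) (2 * m) = -256 * cf H1 m"
  by (rule cf_mf_double[where k = 2 and \<Gamma> = "\<lambda>x y w. x\<^sup>2 * w\<^sup>2 * y\<^sup>2 * (x + w)", OF has_qexp_H(1) H1_form])
     (simp, simp only: power_one_right power_0, algebra)

lemma cf_shf_1_16_1: "16 ^ 1 * cf (shf 1 16 1) (2 * m) = -512 * cf H1 m"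
  by (rule cf_shf_double[where k = 4 and \<Gamma> = "\<lambda>x y w. x\<^sup>2 * w\<^sup>2 * y\<^sup>2 * (x + w)", OF has_qexp_H(1) H1_form])
     (simp, simp only: power_one_right power_0, algebra)

lemma cf_shf_1_8_2: "16 ^ 2 * cf (shf 1 8 2) (2 * m) = 32 * cf H2 m"
  by (rule cf_shf_double[where k = 2 and \<Gamma> = "\<lambda>x y w. x * w * y ^ 4 * (x + w)", OF has_qexp_H(2) H2_form])
     (simp, simp only: power_one_right power_0, algebra)

lemma cf_mf_1_24_3: "16 ^ 3 * cf (mf 1 24 3) (2 * m) = -4096 * cf H3 m"
proof (rule cf_mf_double[where k = 12 and \<Gamma> = "\<lambda>x y w. x ^ 3 * w ^ 3 * y ^ 6 * (x + w)", OF has_qexp_H(3) H3_form])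
  fix p r :: complex
  have *: "64 * p ^ 3 * r ^ 3 * X ^ 6 * (- 128 * (p ^ 3 * r ^ 3 * Y)) = 2 * - 4096 * ((p\<^sup>2) ^ 3 * (r\<^sup>2) ^ 3 * X ^ 6 * Y)" for X Y
    by algebra
  have "((p - r)\<^sup>2 - 4 * p * r) ^ 1 * (p + r) ^ 12 * (4 * p * r * (p - r)\<^sup>2) ^ 3 +
      ((p + r)\<^sup>2 + 4 * p * r) ^ 1 * (p - r) ^ 12 * (- (4 * p * r) * (p + r)\<^sup>2) ^ 3 =
      64 * p ^ 3 * r ^ 3 * ((p + r) * (p - r)) ^ 6 *
      ((p + r) ^ 6 * ((p - r)\<^sup>2 - 4 * p * r) - (p - r) ^ 6 * ((p + r)\<^sup>2 + 4 * p * r))"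
    unfolding power_one_right by algebra
  also have "(p + r) ^ 6 * ((p - r)\<^sup>2 - 4 * p * r) - (p - r) ^ 6 * ((p + r)\<^sup>2 + 4 * p * r) =
      - 128 * (p ^ 3 * r ^ 3 * (p\<^sup>2 + r\<^sup>2))"
    by algebra
  also have "(p + r) * (p - r) = p\<^sup>2 - r\<^sup>2" by algebra
  finally show "((p - r)\<^sup>2 - 4 * p * r) ^ 1 * (p + r) ^ 12 * (4 * p * r * (p - r)\<^sup>2) ^ 3 +
      ((p + r)\<^sup>2 + 4 * p * r) ^ 1 * (p - r) ^ 12 * (- (4 * p * r) * (p + r)\<^sup>2) ^ 3 =
      2 * - 4096 * ((p\<^sup>2) ^ 3 * (r\<^sup>2) ^ 3 * (p\<^sup>2 - r\<^sup>2) ^ 6 * (p\<^sup>2 + r\<^sup>2))"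
    using *[of "p\<^sup>2 - r\<^sup>2" "p\<^sup>2 + r\<^sup>2"] by simp
qed simp

lemma cf_shf_1_24_3: "16 ^ 3 * cf (shf 1 24 3) (2 * m) = -8192 * cf H3 m"
proof (rule cf_shf_double[where k = 6 and \<Gamma> = "\<lambda>x y w. x ^ 3 * w ^ 3 * y ^ 6 * (x + w)", OF has_qexp_H(3) H3_form])
  fix p r :: complex
  have *: "(p - r)\<^sup>2 * (p + r)\<^sup>2 = (p\<^sup>2 - r\<^sup>2)\<^sup>2" "(p + r)\<^sup>2 * (p - r)\<^sup>2 = (p\<^sup>2 - r\<^sup>2)\<^sup>2"
    and **: "(p - r)\<^sup>2 + (p + r)\<^sup>2 = 2 * (p\<^sup>2 + r\<^sup>2)" "(p + r)\<^sup>2 + (p - r)\<^sup>2 = 2 * (p\<^sup>2 + r\<^sup>2)"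
    by algebra+
  have "(2 * Y) * (4 * p * r) ^ 6 * (- X\<^sup>2) ^ 3 + (2 * Y) * (- (4 * p * r)) ^ 6 * (- X\<^sup>2) ^ 3 =
      2 * - 8192 * ((p\<^sup>2) ^ 3 * (r\<^sup>2) ^ 3 * X ^ 6 * Y)" for X Y
    by algebra
  from this[of "p\<^sup>2 + r\<^sup>2" "p\<^sup>2 - r\<^sup>2"]
  show "((p + r)\<^sup>2 + (p - r)\<^sup>2) ^ 1 * (4 * p * r) ^ 6 * (- ((p + r)\<^sup>2 * (p - r)\<^sup>2)) ^ 3 +
      ((p - r)\<^sup>2 + (p + r)\<^sup>2) ^ 1 * (- (4 * p * r)) ^ 6 * (- ((p - r)\<^sup>2 * (p + r)\<^sup>2)) ^ 3 =
      2 * - 8192 * ((p\<^sup>2) ^ 3 * (r\<^sup>2) ^ 3 * (p\<^sup>2 - r\<^sup>2) ^ 6 * (p\<^sup>2 + r\<^sup>2))"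
    unfolding * ** power_one_right .
qed simp

lemma acoef_1_16_1: "acoef 1 16 1 (2 * 4 ^ a) = 0"
  using cf_mf_1_16_1[of "4 ^ a"] by (simp add: acoef_conv_cf cf_H1_pow4)

lemma acoef_0_4_3: "acoef 0 4 3 (2 * 4 ^ a) = 0"
  using cf_mf_0_4_3[of "4 ^ a"] by (simp add: acoef_conv_cf cf_H1_pow4)

lemma cf_shf_1_16_1_eq_0: "cf (shf 1 16 1) (2 * 4 ^ a) = 0"
  using cf_shf_1_16_1[of "4 ^ a"] by (simp add: cf_H1_pow4)

text \<open>For a > 0 one halving leads to H2 at 2 * 4^(a-1) and a second one to H1 at a power of 4.
  Index 1 lies below the order 2 of Delta8^2.\<close>

lemma acoef_0_12_2: "acoef 0 12 2 (4 ^ a) = 0"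
proof (cases a)
  case (Suc b)
  thus ?thesis using cf_mf_0_12_2[of "2 * 4 ^ b"] by (simp add: acoef_conv_cf cf_H2_two_pow4)
qed (simp add: acoef_conv_cf cf_vanishes[OF vanishes_mf])

lemma acoef_1_8_2: "acoef 1 8 2 (4 ^ a) = 0"
proof (cases a)
  case (Suc b)
  thus ?thesis using cf_mf_1_8_2[of "2 * 4 ^ b"] by (simp add: acoef_conv_cf cf_H2_two_pow4)
qed (simp add: acoef_conv_cf cf_vanishes[OF vanishes_mf])

lemma cf_shf_1_8_2_eq_0: "cf (shf 1 8 2) (4 ^ a) = 0"
proof (cases a)
  case (Suc b)
  thus ?thesis using cf_shf_1_8_2[of "2 * 4 ^ b"] by (simp add: cf_H2_two_pow4)
qed (simp add: cf_vanishes[OF vanishes_shf[of 8 2]])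

lemma acoef_1_24_3: "acoef 1 24 3 (2 ^ a) = 0"
proof (cases a)
  case (Suc b)
  thus ?thesis using cf_mf_1_24_3[of "2 ^ b"] by (simp add: acoef_conv_cf cf_H3_pow2)
qed (simp add: acoef_conv_cf cf_vanishes[OF vanishes_mf])

lemma cf_shf_1_24_3_eq_0: "cf (shf 1 24 3) (2 ^ a) = 0"
proof (cases a)
  case (Suc b)
  thus ?thesis using cf_shf_1_24_3[of "2 ^ b"] by (simp add: cf_H3_pow2)
qed (simp add: cf_vanishes[OF vanishes_shf[of 24 6]])

text \<open>Under z -> z + 1 theta3 and theta4 change places and theta2^4 changes sign, so theta3^4
  Delta8 is an odd function of q.\<close>

lemma acoef_0_4k_k:
  assumes "odd (int m - int k)"
  shows "acoef 0 (4 * k) k m = 0"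
  unfolding acoef_conv_cf
proof (rule cf_eq_0_of_twist[OF has_qexp_mf, of 2 _ _ _ k])
  fix z :: complex
  have eq: "mf 0 (4 * k) k w = (theta3 w ^ 4 * (theta2 w ^ 4 * theta4 w ^ 4 / 16)) ^ k" for w
    unfolding mf_def Delta8_def power_mult by (simp only: power_mult_distrib power_0 mult_1_left)
  have "theta3 (z + 1) = theta4 z" by (simp add: theta4_conv_theta3)
  with eq[of "z + 1"] have "mf 0 (4 * k) k (z + 1) = (-1 * (theta3 z ^ 4 * (theta2 z ^ 4 * theta4 z ^ 4 / 16))) ^ k"
    by (simp add: theta4_plus_1 theta2_pow4_plus_1 mult_ac)
  thus "mf 0 (4 * k) k (z + of_real (2 / real 2)) = nome (of_real (2 / real 2)) ^ k * mf 0 (4 * k) k z"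
    using eq[of z] by (simp only: power_mult_distrib) simp
  show "m mod 2 \<noteq> k mod 2" using assms by presburger
qed auto

text \<open>The duplication formulas turn the base into a constant times (theta2 theta3 theta4)^8 at
  2 z, a multiple of the discriminant form, which is invariant under 2 z -> 2 z + 1. Only exponents
  divisible by 4 survive.\<close>

lemma cf_shf_0_16k_k:
  assumes "m mod 4 = 2"
  shows "cf (shf 0 (16 * k) k) m = 0"
proof (rule cf_eq_0_of_twist[of _ 4 0])
  fix z :: complex assume z: "Im z > 0"
  define K where "K = (\<lambda>w. (256 * theta3 w ^ 8 * theta2 w ^ 8 * (- (theta4 w ^ 8) / 16)) ^ k)"
  have eq: "shf 0 (16 * k) k z = K (2 * z)" if z: "Im z > 0" for z
  proof -
    have "theta2 z ^ 16 = (theta2 z ^ 2) ^ 8" by simp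
    also have "\<dots> = 256 * theta3 (2 * z) ^ 8 * theta2 (2 * z) ^ 8"
      unfolding theta2_sq_split[OF z] by (simp add: power_mult_distrib)
    finally have 1: "theta2 z ^ 16 = 256 * theta3 (2 * z) ^ 8 * theta2 (2 * z) ^ 8" .
    have "theta3 z ^ 4 * theta4 z ^ 4 = (theta3 z * theta4 z) ^ 4" by (simp add: power_mult_distrib)
    also have "\<dots> = theta4 (2 * z) ^ 8" unfolding theta3_theta4_mult[OF z] by simp
    finally have 2: "theta3 z ^ 4 * theta4 z ^ 4 = theta4 (2 * z) ^ 8" .
    show ?thesis unfolding shf_def K_def power_mult 1 2 by (simp only: power_mult_distrib) simp
  qed
  have "theta2 (w + 1) ^ 8 = theta2 w ^ 8" for w
  proof -
    have "theta2 (w + 1) ^ 8 = (theta2 (w + 1) ^ 4)\<^sup>2" by simp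
    also have "\<dots> = theta2 w ^ 8" unfolding theta2_pow4_plus_1 by simp
    finally show ?thesis .
  qed
  moreover have "theta3 (w + 1) = theta4 w" for w by (simp add: theta4_conv_theta3)
  ultimately have K: "K (w + 1) = K w" for w
    unfolding K_def by (simp add: theta4_plus_1 mult_ac)
  have "2 * (z + of_real (2 / real 4)) = 2 * z + 1" by (simp add: algebra_simps)
  moreover have "Im (z + of_real (2 / real 4)) > 0" using z by simp
  ultimately show "shf 0 (16 * k) k (z + of_real (2 / real 4)) = nome (of_real (2 / real 4)) ^ 0 * shf 0 (16 * k) k z"
    by (simp only: eq z K power_0 mult_1)
qed (use assms in \<open>auto intro: has_qexp_shf\<close>)

section \<open>Sums of one, two and three squares\<close>

lemma cf_theta3: "cf theta3 n = of_nat (card {m::int. m\<^sup>2 = int n})"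
  by (simp add: qexp_cf[OF qexp_theta3] T3_nth)

lemma acoef_0_1_0:
  assumes "\<nexists>a::int. int m = a\<^sup>2"
  shows "acoef 0 1 0 m = 0"
proof -
  have "{a::int. a\<^sup>2 = int m} = {}" using assms by (metis (mono_tags) empty_Collect_eq)
  moreover have "mf 0 1 0 = theta3" by (simp add: mf_def fun_eq_iff)
  ultimately show ?thesis by (simp add: acoef_conv_cf cf_theta3)
qed

lemma acoef_0_2_0:
  assumes "\<nexists>a b::int. int m = a\<^sup>2 + b\<^sup>2"
  shows "acoef 0 2 0 m = 0"
proof -
  have "mf 0 2 0 = (\<lambda>z. theta3 z ^ 2)" by (simp add: mf_def fun_eq_iff)
  hence "acoef 0 2 0 m = fps_nth (T3 ^ 2) m"
    using qexp_cf[OF qexp_power[OF qexp_theta3]] by (simp add: acoef_conv_cf)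
  also have "\<dots> = of_nat (card (two_squares m))"
    by (simp add: power2_eq_square T3_def sqfps_mult_nth)
  also have "two_squares m = {}" using assms by (simp add: two_squares_def) metis
  finally show ?thesis by simp
qed

lemma square_mod_8: "(x::int)\<^sup>2 mod 8 \<in> {0, 1, 4}"
proof -
  have "x mod 8 \<in> {0, 1, 2, 3, 4, 5, 6, 7}" by auto
  moreover have "x\<^sup>2 mod 8 = (x mod 8)\<^sup>2 mod 8" by (simp add: power_mod)
  ultimately show ?thesis by auto
qed

lemma mod_add3_eq: "(p + q + r) mod m = (p mod m + q mod m + r mod m) mod (m::int)"
proof -
  have "(p mod m + q mod m + r mod m) mod m = ((p mod m + q mod m) mod m + r mod m) mod m"
    by (rule mod_add_left_eq[symmetric])
  also have "\<dots> = ((p + q) mod m + r mod m) mod m" by (simp only: mod_add_eq)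
  also have "\<dots> = (p + q + r) mod m" by (simp only: mod_add_eq)
  finally show ?thesis ..
qed

text \<open>The elementary half of Legendre's theorem: three of the residues 0, 1, 4 never add up to
  7 modulo 8, and a sum of three squares divisible by 4 has only even terms, so a factor 4
  descends.\<close>

lemma not_three_squares: "(x::int)\<^sup>2 + y\<^sup>2 + z\<^sup>2 \<noteq> 4 ^ a * (8 * b + 7)"
proof (induction a arbitrary: x y z)
  case 0
  have "(x\<^sup>2 + y\<^sup>2 + z\<^sup>2) mod 8 \<noteq> 7"
    unfolding mod_add3_eq[of "x\<^sup>2" "y\<^sup>2" "z\<^sup>2"]
    using square_mod_8[of x] square_mod_8[of y] square_mod_8[of z] by auto
  moreover have "(8 * b + 7) mod 8 = 7" by presburger
  ultimately show ?case by auto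
next
  case (Suc a)
  show ?case
  proof
    assume eq: "x\<^sup>2 + y\<^sup>2 + z\<^sup>2 = 4 ^ Suc a * (8 * b + 7)"
    have "(x\<^sup>2 + y\<^sup>2 + z\<^sup>2) mod 4 = 0" by (simp add: eq)
    moreover have sq: "w\<^sup>2 mod 4 = (if even w then 0 else 1)" for w :: int
    proof -
      have "w mod 4 \<in> {0, 1, 2, 3}" by auto
      moreover have "w\<^sup>2 mod 4 = (w mod 4)\<^sup>2 mod 4" by (simp add: power_mod)
      moreover have "even w \<longleftrightarrow> even (w mod 4)" by presburger
      ultimately show ?thesis by auto
    qed
    ultimately have "(x\<^sup>2 mod 4 + y\<^sup>2 mod 4 + z\<^sup>2 mod 4) mod 4 = 0"
      by (simp only: mod_add3_eq[of "x\<^sup>2" "y\<^sup>2" "z\<^sup>2" 4])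
    hence "even x \<and> even y \<and> even z"
      unfolding sq by (auto split: if_splits)
    then obtain u v w where "x = 2 * u" "y = 2 * v" "z = 2 * w" by (auto elim!: evenE)
    with eq have "u\<^sup>2 + v\<^sup>2 + w\<^sup>2 = 4 ^ a * (8 * b + 7)" by (simp add: power_mult_distrib)
    with Suc.IH show False by blast
  qed
qed

lemma acoef_0_3_0: "acoef 0 3 0 (4 ^ a * (8 * b + 7)) = 0"
proof -
  define N :: nat where "N = 4 ^ a * (8 * b + 7)"
  have "mf 0 3 0 = (\<lambda>z. theta3 z ^ 2 * theta3 z)" by (simp add: mf_def fun_eq_iff eval_nat_numeral)
  hence "acoef 0 3 0 N = fps_nth (T3 ^ 2 * T3) N"
    using qexp_cf[OF qexp_mult[OF qexp_power[OF qexp_theta3] qexp_theta3]] by (simp add: acoef_conv_cf)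
  also have "\<dots> = (\<Sum>i=0..N. of_nat (card (two_squares i)) * of_nat (card {m::int. m\<^sup>2 = int (N - i)}))"
  proof -
    have "fps_nth (T3 ^ 2) i = of_nat (card (two_squares i))" for i
      by (simp add: power2_eq_square T3_def sqfps_mult_nth)
    thus ?thesis by (simp only: fps_mult_nth T3_nth)
  qed
  also have "\<dots> = 0"
  proof (rule sum.neutral, rule ballI)
    fix i assume i: "i \<in> {0..N}"
    have "two_squares i = {} \<or> {m::int. m\<^sup>2 = int (N - i)} = {}"
    proof (rule ccontr)
      assume "\<not> ?thesis"
      then obtain x y w where "x\<^sup>2 + y\<^sup>2 = int i" "w\<^sup>2 = int (N - i)"
        by (auto simp: two_squares_def)
      hence "x\<^sup>2 + y\<^sup>2 + w\<^sup>2 = int N" using i by simp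
      thus False using not_three_squares[of x y w a "int b"] by (simp add: N_def)
    qed
    thus "of_nat (card (two_squares i)) * of_nat (card {m::int. m\<^sup>2 = int (N - i)}) = (0::complex)" by auto
  qed
  finally show ?thesis by (simp add: N_def)
qed

subsection \<open>Individual coefficients\<close>

text \<open>Lets a single coefficient be settled by evaluating integer lists, all of one length that
  covers the index in question.\<close>

definition has_trunc :: "complex fps \<Rightarrow> int list \<Rightarrow> bool" where
  "has_trunc A xs \<longleftrightarrow> (\<forall>i<length xs. fps_nth A i = of_int (xs ! i))"

text \<open>The tail of the first factor carries a factor X, so against it the second factor gives
  up its top entry (\<open>butlast\<close>); the result keeps the common length.\<close>

primrec trunc_mult :: "int list \<Rightarrow> int list \<Rightarrow> int list" where
  "trunc_mult [] ys = []"
| "trunc_mult (x # xs) ys = map2 (+) (map ((*) x) ys) (0 # trunc_mult xs (butlast ys))"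

primrec trunc_power :: "int list \<Rightarrow> nat \<Rightarrow> int list" where
  "trunc_power xs 0 = map (\<lambda>i. if i = 0 then 1 else 0) [0..<length xs]"
| "trunc_power xs (Suc n) = trunc_mult xs (trunc_power xs n)"

lemma has_trunc_nth: "has_trunc A xs \<Longrightarrow> i < length xs \<Longrightarrow> fps_nth A i = of_int (xs ! i)"
  by (simp add: has_trunc_def)

lemma length_trunc_mult [simp]: "length xs = length ys \<Longrightarrow> length (trunc_mult xs ys) = length ys"
  by (induction xs arbitrary: ys) auto

lemma length_trunc_power [simp]: "length (trunc_power xs n) = length xs"
  by (induction n) auto

lemma has_trunc_mult:
  assumes "has_trunc A xs" "has_trunc B ys" "length xs = length ys"
  shows "has_trunc (A * B) (trunc_mult xs ys)"
  using assms
proof (induction xs arbitrary: A ys)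
  case (Cons x xs)
  define A' where "A' = fps_shift 1 A"
  have A: "A = fps_const x + fps_X * A'"
  proof (rule fps_ext)
    fix n show "fps_nth A n = fps_nth (fps_const (of_int x) + fps_X * A') n"
      using Cons.prems(1) by (cases n) (auto simp: A'_def has_trunc_def)
  qed
  have "has_trunc A' xs" using Cons.prems(1) by (auto simp: A'_def has_trunc_def)
  moreover have "has_trunc B (butlast ys)" using Cons.prems(2) by (auto simp: has_trunc_def nth_butlast)
  moreover have len: "length xs = length (butlast ys)" using Cons.prems(3) by simp
  ultimately have IH: "has_trunc (A' * B) (trunc_mult xs (butlast ys))" by (rule Cons.IH)
  show ?case
    unfolding has_trunc_def
  proof (intro allI impI)
    fix i assume i: "i < length (trunc_mult (x # xs) ys)"
    have nth: "fps_nth (A * B) i = of_int x * fps_nth B i + (if i = 0 then 0 else fps_nth (A' * B) (i - 1))"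
      by (subst A, cases i) (simp_all add: ring_distribs mult.assoc)
    have i': "i < length ys" using i Cons.prems(3) by simp
    show "fps_nth (A * B) i = of_int (trunc_mult (x # xs) ys ! i)"
      unfolding nth using i' Cons.prems(2,3) IH len
      by (cases i) (simp_all add: has_trunc_def)
  qed
qed (simp add: has_trunc_def)

lemma has_trunc_power: "has_trunc A xs \<Longrightarrow> has_trunc (A ^ n) (trunc_power xs n)"
  by (induction n) (auto intro: has_trunc_mult, auto simp: has_trunc_def)

lemma has_trunc_add: "has_trunc A xs \<Longrightarrow> has_trunc B ys \<Longrightarrow> has_trunc (A + B) (map2 (+) xs ys)"
  by (simp add: has_trunc_def)

lemma has_trunc_diff: "has_trunc A xs \<Longrightarrow> has_trunc B ys \<Longrightarrow> has_trunc (A - B) (map2 (-) xs ys)"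
  by (simp add: has_trunc_def)

definition sq_list :: "nat \<Rightarrow> int list" where
  "sq_list N = map (\<lambda>n. if n = 0 then 1 else if list_ex (\<lambda>k. k * k = n) [1..<Suc n] then 2 else 0) [0..<N]"

definition alt_sq_list :: "nat \<Rightarrow> int list" where
  "alt_sq_list N = map2 (\<lambda>n x. if even n then x else - x) [0..<N] (sq_list N)"

text \<open>Solutions of k^2 + k = n pair up as k and - k - 1, which never coincide. So even n = 0
  gets the value 2 and the search starts at 0, unlike in \<open>sq_list\<close>, where the root 0
  counts once.\<close>

definition tri_list :: "nat \<Rightarrow> int list" where
  "tri_list N = map (\<lambda>n. if list_ex (\<lambda>k. k * k + k = n) [0..<Suc n] then 2 else 0) [0..<N]"

lemma has_trunc_T3: "has_trunc T3 (sq_list N)"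
proof -
  have "card {m::int. m\<^sup>2 = int n} = (if n = 0 then 1 else if list_ex (\<lambda>k. k * k = n) [1..<Suc n] then 2 else 0)" for n
  proof (cases "n = 0")
    case False
    show ?thesis
    proof (cases "list_ex (\<lambda>k. k * k = n) [1..<Suc n]")
      case True
      then obtain k where "k \<in> set [1..<Suc n]" and k: "k * k = n" unfolding list_ex_iff by blast
      hence "k > 0" unfolding set_upt by simp
      from k have "int n = (int k)\<^sup>2" by (auto simp: power2_eq_square)
      hence "{m::int. m\<^sup>2 = int n} = {int k, - int k}" by (auto simp: power2_eq_iff)
      thus ?thesis using \<open>k > 0\<close> True False by simp
    next
      case f: False
      have "{m::int. m\<^sup>2 = int n} = {}"
      proof (rule ccontr)
        assume "{m::int. m\<^sup>2 = int n} \<noteq> {}"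
        then obtain m :: int where "m\<^sup>2 = int n" by blast
        hence m: "nat \<bar>m\<bar> * nat \<bar>m\<bar> = n"
          by (simp add: nat_abs_mult_distrib[symmetric] power2_eq_square)
        moreover from m False have "1 \<le> nat \<bar>m\<bar>" by (cases "m = 0") auto
        ultimately have "nat \<bar>m\<bar> \<in> set [1..<Suc n]" by (auto simp: less_Suc_eq_le)
        thus False using f m by (auto simp: list_ex_iff)
      qed
      hence "card {m::int. m\<^sup>2 = int n} = 0" by simp
      thus ?thesis using f False by simp
    qed
  qed simp
  thus ?thesis by (simp add: has_trunc_def sq_list_def T3_nth del: upt_Suc)
qed

lemma has_trunc_T4: "has_trunc T4 (alt_sq_list N)"
  using has_trunc_T3[of N] by (auto simp: has_trunc_def alt_sq_list_def T4_nth sq_list_def simp del: upt_Suc)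

lemma has_trunc_Psi2: "has_trunc Psi2 (tri_list N)"
proof -
  have "card {m::int. m\<^sup>2 + m = int n} = (if list_ex (\<lambda>k. k * k + k = n) [0..<Suc n] then 2 else 0)" for n
  proof (cases "list_ex (\<lambda>k. k * k + k = n) [0..<Suc n]")
    case True
    then obtain k where k: "k * k + k = n" by (auto simp: list_ex_iff)
    hence n: "int n = int k * int k + int k" by auto
    have "m\<^sup>2 + m = int n \<longleftrightarrow> m = int k \<or> m = - int k - 1" for m
    proof -
      have "m\<^sup>2 + m = int n \<longleftrightarrow> (m - int k) * (m + int k + 1) = 0"
        unfolding n by (auto simp: power2_eq_square algebra_simps)
      thus ?thesis by auto
    qed
    hence "{m::int. m\<^sup>2 + m = int n} = {int k, - int k - 1}" by blast
    thus ?thesis using True by simp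
  next
    case f: False
    have "{m::int. m\<^sup>2 + m = int n} = {}"
    proof (rule ccontr)
      assume "{m::int. m\<^sup>2 + m = int n} \<noteq> {}"
      then obtain m :: int where m: "m\<^sup>2 + m = int n" by blast
      define k where "k = (if m \<ge> 0 then nat m else nat (- m - 1))"
      have "int (k * k + k) = int n" unfolding m[symmetric] k_def by (auto simp: power2_eq_square algebra_simps)
      hence k: "k * k + k = n" by (simp only: of_nat_eq_iff)
      hence "k \<in> set [0..<Suc n]" by auto
      thus False using f k by (auto simp: list_ex_iff)
    qed
    hence "card {m::int. m\<^sup>2 + m = int n} = 0" by simp
    thus ?thesis using f by simp
  qed
  thus ?thesis by (simp add: has_trunc_def tri_list_def Psi2_def del: upt_Suc)
qed

lemma qexp_mf: "qexp (\<lambda>z. 16 ^ \<beta> * mf e \<alpha> \<beta> z)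
   ((T4 ^ 4 - (T3 ^ 4 - T4 ^ 4)) ^ e * T3 ^ \<alpha> * ((T3 ^ 4 - T4 ^ 4) * T4 ^ 4) ^ \<beta>)"
proof (rule qexp_cong)
  show "qexp (\<lambda>z. (theta4 z ^ 4 - theta2 z ^ 4) ^ e * theta3 z ^ \<alpha> * (theta2 z ^ 4 * theta4 z ^ 4) ^ \<beta>)
      ((T4 ^ 4 - (T3 ^ 4 - T4 ^ 4)) ^ e * T3 ^ \<alpha> * ((T3 ^ 4 - T4 ^ 4) * T4 ^ 4) ^ \<beta>)"
    by (intro qexp_mult qexp_power qexp_diff qexp_theta3 qexp_theta4 qexp_theta2_pow4)
qed (simp add: mf_def phi8_def Delta8_def power_divide)

lemma acoef_eq_0I:
  assumes "fps_nth ((T4 ^ 4 - (T3 ^ 4 - T4 ^ 4)) ^ e * T3 ^ \<alpha> * ((T3 ^ 4 - T4 ^ 4) * T4 ^ 4) ^ \<beta>) m = 0"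
  shows "acoef e \<alpha> \<beta> m = 0"
proof -
  have "16 ^ \<beta> * cf (mf e \<alpha> \<beta>) m = cf (\<lambda>z. 16 ^ \<beta> * mf e \<alpha> \<beta> z) m"
    by (rule cf_cmult[OF has_qexp_mf, symmetric])
  also have "\<dots> = 0" using qexp_cf[OF qexp_mf] assms by simp
  finally show ?thesis by (simp add: acoef_conv_cf)
qed

lemma has_trunc_nth_eq_0: "has_trunc A xs \<Longrightarrow> i < length xs \<Longrightarrow> xs ! i = 0 \<Longrightarrow> fps_nth A i = 0"
  by (simp add: has_trunc_def)

lemma has_trunc_eqI: "has_trunc A xs \<Longrightarrow> xs = ys \<Longrightarrow> has_trunc A ys"
  by simp

text \<open>As phi8 = 1 - 24 q + ... and theta3^12 = 1 + 24 q + ..., the linear terms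
  cancel.\<close>

lemma acoef_1_12_0: "acoef 1 12 0 1 = 0"
proof -
  have x4: "has_trunc (T3 ^ 4) [1, 8]"
    by (rule has_trunc_eqI[OF has_trunc_power[OF has_trunc_T3[of 2]]]) code_simp+
  have y4: "has_trunc (T4 ^ 4) [1, -8]"
    by (rule has_trunc_eqI[OF has_trunc_power[OF has_trunc_T4[of 2]]]) code_simp+
  have d: "has_trunc (T3 ^ 4 - T4 ^ 4) [0, 16]"
    by (rule has_trunc_eqI[OF has_trunc_diff[OF x4 y4]]) code_simp+
  have f: "has_trunc (T4 ^ 4 - (T3 ^ 4 - T4 ^ 4)) [1, -24]"
    by (rule has_trunc_eqI[OF has_trunc_diff[OF y4 d]]) code_simp+
  have x: "has_trunc (T3 ^ 12) [1, 24]"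
    by (rule has_trunc_eqI[OF has_trunc_power[OF has_trunc_T3[of 2]]]) code_simp+
  have D: "has_trunc ((T3 ^ 4 - T4 ^ 4) * T4 ^ 4) [0, 16]"
    by (rule has_trunc_eqI[OF has_trunc_mult[OF d y4]]) code_simp+
  have Db: "has_trunc (((T3 ^ 4 - T4 ^ 4) * T4 ^ 4) ^ 0) [1, 0]"
    by (rule has_trunc_eqI[OF has_trunc_power[OF D]]) code_simp+
  have fe: "has_trunc ((T4 ^ 4 - (T3 ^ 4 - T4 ^ 4)) ^ 1) [1, -24]"
    by (rule has_trunc_eqI[OF has_trunc_power[OF f]]) code_simp+
  have g: "has_trunc ((T4 ^ 4 - (T3 ^ 4 - T4 ^ 4)) ^ 1 * T3 ^ 12) [1, 0]"
    by (rule has_trunc_eqI[OF has_trunc_mult[OF fe x]]) code_simp+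
  have h: "has_trunc ((T4 ^ 4 - (T3 ^ 4 - T4 ^ 4)) ^ 1 * T3 ^ 12 * ((T3 ^ 4 - T4 ^ 4) * T4 ^ 4) ^ 0) [1, 0]"
    by (rule has_trunc_eqI[OF has_trunc_mult[OF g Db]]) code_simp+
  show ?thesis by (rule acoef_eq_0I, rule has_trunc_nth_eq_0[OF h]) simp_all
qed

text \<open>The power of Delta8 starts at q^2, so only two products contribute: 256 * 16 - 4096 =
  0.\<close>

lemma acoef_1_20_2: "acoef 1 20 2 3 = 0"
proof -
  have x4: "has_trunc (T3 ^ 4) [1, 8, 24, 32]"
    by (rule has_trunc_eqI[OF has_trunc_power[OF has_trunc_T3[of 4]]]) code_simp+
  have y4: "has_trunc (T4 ^ 4) [1, -8, 24, -32]"
    by (rule has_trunc_eqI[OF has_trunc_power[OF has_trunc_T4[of 4]]]) code_simp+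
  have d: "has_trunc (T3 ^ 4 - T4 ^ 4) [0, 16, 0, 64]"
    by (rule has_trunc_eqI[OF has_trunc_diff[OF x4 y4]]) code_simp+
  have f: "has_trunc (T4 ^ 4 - (T3 ^ 4 - T4 ^ 4)) [1, -24, 24, -96]"
    by (rule has_trunc_eqI[OF has_trunc_diff[OF y4 d]]) code_simp+
  have x: "has_trunc (T3 ^ 20) [1, 40, 760, 9120]"
    by (rule has_trunc_eqI[OF has_trunc_power[OF has_trunc_T3[of 4]]]) code_simp+
  have D: "has_trunc ((T3 ^ 4 - T4 ^ 4) * T4 ^ 4) [0, 16, -128, 448]"
    by (rule has_trunc_eqI[OF has_trunc_mult[OF d y4]]) code_simp+
  have Db: "has_trunc (((T3 ^ 4 - T4 ^ 4) * T4 ^ 4) ^ 2) [0, 0, 256, -4096]"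
    by (rule has_trunc_eqI[OF has_trunc_power[OF D]]) code_simp+
  have fe: "has_trunc ((T4 ^ 4 - (T3 ^ 4 - T4 ^ 4)) ^ 1) [1, -24, 24, -96]"
    by (rule has_trunc_eqI[OF has_trunc_power[OF f]]) code_simp+
  have g: "has_trunc ((T4 ^ 4 - (T3 ^ 4 - T4 ^ 4)) ^ 1 * T3 ^ 20) [1, 16, -176, -8256]"
    by (rule has_trunc_eqI[OF has_trunc_mult[OF fe x]]) code_simp+
  have h: "has_trunc ((T4 ^ 4 - (T3 ^ 4 - T4 ^ 4)) ^ 1 * T3 ^ 20 * ((T3 ^ 4 - T4 ^ 4) * T4 ^ 4) ^ 2) [0, 0, 256, 0]"
    by (rule has_trunc_eqI[OF has_trunc_mult[OF g Db]]) code_simp+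
  show ?thesis by (rule acoef_eq_0I, rule has_trunc_nth_eq_0[OF h]) simp_all
qed

text \<open>Three products contribute: 256 * 552 - 4096 * 42 + 30720 = 0.\<close>

lemma acoef_1_33_2: "acoef 1 33 2 4 = 0"
proof -
  have x4: "has_trunc (T3 ^ 4) [1, 8, 24, 32, 24]"
    by (rule has_trunc_eqI[OF has_trunc_power[OF has_trunc_T3[of 5]]]) code_simp+
  have y4: "has_trunc (T4 ^ 4) [1, -8, 24, -32, 24]"
    by (rule has_trunc_eqI[OF has_trunc_power[OF has_trunc_T4[of 5]]]) code_simp+
  have d: "has_trunc (T3 ^ 4 - T4 ^ 4) [0, 16, 0, 64, 0]"
    by (rule has_trunc_eqI[OF has_trunc_diff[OF x4 y4]]) code_simp+
  have f: "has_trunc (T4 ^ 4 - (T3 ^ 4 - T4 ^ 4)) [1, -24, 24, -96, 24]"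
    by (rule has_trunc_eqI[OF has_trunc_diff[OF y4 d]]) code_simp+
  have x: "has_trunc (T3 ^ 33) [1, 66, 2112, 43648, 654786]"
    by (rule has_trunc_eqI[OF has_trunc_power[OF has_trunc_T3[of 5]]]) code_simp+
  have D: "has_trunc ((T3 ^ 4 - T4 ^ 4) * T4 ^ 4) [0, 16, -128, 448, -1024]"
    by (rule has_trunc_eqI[OF has_trunc_mult[OF d y4]]) code_simp+
  have Db: "has_trunc (((T3 ^ 4 - T4 ^ 4) * T4 ^ 4) ^ 2) [0, 0, 256, -4096, 30720]"
    by (rule has_trunc_eqI[OF has_trunc_power[OF D]]) code_simp+
  have fe: "has_trunc ((T4 ^ 4 - (T3 ^ 4 - T4 ^ 4)) ^ 1) [1, -24, 24, -96, 24]"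
    by (rule has_trunc_eqI[OF has_trunc_power[OF f]]) code_simp+
  have g: "has_trunc ((T4 ^ 4 - (T3 ^ 4 - T4 ^ 4)) ^ 1 * T3 ^ 33) [1, 42, 552, -5552, -348390]"
    by (rule has_trunc_eqI[OF has_trunc_mult[OF fe x]]) code_simp+
  have h: "has_trunc ((T4 ^ 4 - (T3 ^ 4 - T4 ^ 4)) ^ 1 * T3 ^ 33 * ((T3 ^ 4 - T4 ^ 4) * T4 ^ 4) ^ 2) [0, 0, 256, 6656, 0]"
    by (rule has_trunc_eqI[OF has_trunc_mult[OF g Db]]) code_simp+
  show ?thesis by (rule acoef_eq_0I, rule has_trunc_nth_eq_0[OF h]) simp_all
qed

lemma cf_shf_1_40_1: "cf (shf 1 40 1) 24 = 0"
proof -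
  have x4: "has_trunc (T3 ^ 4) [1, 8, 24, 32, 24, 48, 96, 64, 24, 104, 144, 96, 96, 112, 192, 192, 24, 144, 312, 160, 144, 256, 288, 192, 96]"
    by (rule has_trunc_eqI[OF has_trunc_power[OF has_trunc_T3[of 25]]]) code_simp+
  have y4: "has_trunc (T4 ^ 4) [1, -8, 24, -32, 24, -48, 96, -64, 24, -104, 144, -96, 96, -112, 192, -192, 24, -144, 312, -160, 144, -256, 288, -192, 96]"
    by (rule has_trunc_eqI[OF has_trunc_power[OF has_trunc_T4[of 25]]]) code_simp+
  have d: "has_trunc (T3 ^ 4 - T4 ^ 4) [0, 16, 0, 64, 0, 96, 0, 128, 0, 208, 0, 192, 0, 224, 0, 384, 0, 288, 0, 320, 0, 512, 0, 384, 0]"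
    by (rule has_trunc_eqI[OF has_trunc_diff[OF x4 y4]]) code_simp+
  have p: "has_trunc (T3 ^ 4 + T4 ^ 4) [2, 0, 48, 0, 48, 0, 192, 0, 48, 0, 288, 0, 192, 0, 384, 0, 48, 0, 624, 0, 288, 0, 576, 0, 192]"
    by (rule has_trunc_eqI[OF has_trunc_add[OF x4 y4]]) code_simp+
  have xy: "has_trunc (T3 ^ 4 * T4 ^ 4) [1, 0, -16, 0, 112, 0, -448, 0, 1136, 0, -2016, 0, 3136, 0, -5504, 0, 9328, 0, -12112, 0, 14112, 0, -21312, 0, 31808]"
    by (rule has_trunc_eqI[OF has_trunc_mult[OF x4 y4]]) code_simp+
  have d2: "has_trunc ((T3 ^ 4 - T4 ^ 4) * (T3 ^ 4 - T4 ^ 4)) [0, 0, 256, 0, 2048, 0, 7168, 0, 16384, 0, 32256, 0, 57344, 0, 88064, 0, 131072, 0, 193792, 0, 258048, 0, 340992, 0, 458752]"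
    by (rule has_trunc_eqI[OF has_trunc_mult[OF d d]]) code_simp+
  have d4: "has_trunc (((T3 ^ 4 - T4 ^ 4) * (T3 ^ 4 - T4 ^ 4)) * ((T3 ^ 4 - T4 ^ 4) * (T3 ^ 4 - T4 ^ 4))) [0, 0, 0, 0, 65536, 0, 1048576, 0, 7864320, 0, 37748736, 0, 135004160, 0, 396361728, 0, 1010827264, 0, 2306867200, 0, 4818075648, 0, 9389998080, 0, 17274241024]"
    by (rule has_trunc_eqI[OF has_trunc_mult[OF d2 d2]]) code_simp+
  \<comment> \<open>The tenth power of theta2^4 is assembled as 8 + 2 by repeated squaring; naming
    the eighth power keeps the terms small.\<close>
  define e8 where "e8 = ((T3 ^ 4 - T4 ^ 4) * (T3 ^ 4 - T4 ^ 4)) * ((T3 ^ 4 - T4 ^ 4) * (T3 ^ 4 - T4 ^ 4)) * (((T3 ^ 4 - T4 ^ 4) * (T3 ^ 4 - T4 ^ 4)) * ((T3 ^ 4 - T4 ^ 4) * (T3 ^ 4 - T4 ^ 4)))"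
  have d8: "has_trunc e8 [0, 0, 0, 0, 0, 0, 0, 0, 4294967296, 0, 137438953472, 0, 2130303778816, 0, 21440476741632, 0, 158707631521792, 0, 928812447563776, 0, 4512120842485760, 0, 18848927834963968, 0, 69518735790047232]"
    unfolding e8_def by (rule has_trunc_eqI[OF has_trunc_mult[OF d4 d4]]) code_simp+
  have d10: "has_trunc (e8 * ((T3 ^ 4 - T4 ^ 4) * (T3 ^ 4 - T4 ^ 4))) [0, 0, 0, 0, 0, 0, 0, 0, 0, 0, 1099511627776, 0, 43980465111040, 0, 857619069665280, 0, 10907155347537920, 0, 102199605801779200, 0, 756076971816910848, 0, 4623182512007413760, 0, 24150553001774284800]"
    by (rule has_trunc_eqI[OF has_trunc_mult[OF d8 d2]]) code_simp+
  have g: "has_trunc ((T3 ^ 4 + T4 ^ 4) * (e8 * ((T3 ^ 4 - T4 ^ 4) * (T3 ^ 4 - T4 ^ 4)))) [0, 0, 0, 0, 0, 0, 0, 0, 0, 0, 2199023255552, 0, 140737488355328, 0, 3879077022793728, 0, 65302194596872192, 0, 777605409488764928, 0, 7108369061850906624, 0, 52591857771967676416, 0, 326907289751569563648]"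
    by (rule has_trunc_eqI[OF has_trunc_mult[OF p d10]]) code_simp+
  have h: "has_trunc ((T3 ^ 4 + T4 ^ 4) * (e8 * ((T3 ^ 4 - T4 ^ 4) * (T3 ^ 4 - T4 ^ 4))) * (T3 ^ 4 * T4 ^ 4)) [0, 0, 0, 0, 0, 0, 0, 0, 0, 0, 2199023255552, 0, 105553116266496, 0, 1873567813730304, 0, 18014398509481984, 0, 106674618126827520, 0, 398146354557222912, 0, 824176323994845184, 0, 0]"
    by (rule has_trunc_eqI[OF has_trunc_mult[OF g xy]]) code_simp+
  have e8: "e8 * ((T3 ^ 4 - T4 ^ 4) * (T3 ^ 4 - T4 ^ 4)) = (T3 ^ 4 - T4 ^ 4) ^ 10" by (simp add: e8_def eval_nat_numeral mult.assoc)
  \<comment> \<open>The factor -16 cancels the -1/16 that the shadow of Delta8 carries.\<close>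
  have q: "qexp (\<lambda>z. -16 * shf 1 40 1 z) ((T3 ^ 4 + T4 ^ 4) * (T3 ^ 4 - T4 ^ 4) ^ 10 * (T3 ^ 4 * T4 ^ 4))"
  proof (rule qexp_cong)
    show "qexp (\<lambda>z. (theta3 z ^ 4 + theta4 z ^ 4) * (theta2 z ^ 4) ^ 10 * (theta3 z ^ 4 * theta4 z ^ 4))
        ((T3 ^ 4 + T4 ^ 4) * (T3 ^ 4 - T4 ^ 4) ^ 10 * (T3 ^ 4 * T4 ^ 4))"
      by (intro qexp_mult qexp_power qexp_add qexp_theta3 qexp_theta4 qexp_theta2_pow4)
  qed (simp add: shf_def flip: power_mult)
  have "-16 * cf (shf 1 40 1) 24 = cf (\<lambda>z. -16 * shf 1 40 1 z) 24"
    by (rule cf_cmult[OF has_qexp_shf, symmetric]) simp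
  also have "\<dots> = 0"
    unfolding qexp_cf[OF q] by (rule has_trunc_nth_eq_0[OF h[unfolded e8]]) simp_all
  finally show ?thesis by simp
qed

text \<open>This is index 49/4 of the shadow after q^(33/4) is taken out. Divided by 2^34 the
  relevant product is (1 + 57 q^2 + 1344 q^4) (1 - 32 q^2 + 480 q^4), and 480 - 32 * 57 + 1344 =
  0.\<close>

lemma cf_psi2_33: "cf (\<lambda>z. (theta3 z ^ 4 + theta4 z ^ 4) * psi2 z ^ 33 * (theta3 z ^ 4 * theta4 z ^ 4)\<^sup>2) 4 = 0"
proof -
  have x4: "has_trunc (T3 ^ 4) [1, 8, 24, 32, 24]"
    by (rule has_trunc_eqI[OF has_trunc_power[OF has_trunc_T3[of 5]]]) code_simp+
  have y4: "has_trunc (T4 ^ 4) [1, -8, 24, -32, 24]"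
    by (rule has_trunc_eqI[OF has_trunc_power[OF has_trunc_T4[of 5]]]) code_simp+
  have p: "has_trunc (T3 ^ 4 + T4 ^ 4) [2, 0, 48, 0, 48]"
    by (rule has_trunc_eqI[OF has_trunc_add[OF x4 y4]]) code_simp+
  have xy: "has_trunc (T3 ^ 4 * T4 ^ 4) [1, 0, -16, 0, 112]"
    by (rule has_trunc_eqI[OF has_trunc_mult[OF x4 y4]]) code_simp+
  have xy2: "has_trunc ((T3 ^ 4 * T4 ^ 4)\<^sup>2) [1, 0, -32, 0, 480]"
    by (rule has_trunc_eqI[OF has_trunc_power[OF xy]]) code_simp+
  have ps: "has_trunc (Psi2 ^ 33) [8589934592, 0, 283467841536, 0, 4535485464576]"
    by (rule has_trunc_eqI[OF has_trunc_power[OF has_trunc_Psi2[of 5]]]) code_simp+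
  have g: "has_trunc ((T3 ^ 4 + T4 ^ 4) * Psi2 ^ 33) [17179869184, 0, 979252543488, 0, 23089744183296]"
    by (rule has_trunc_eqI[OF has_trunc_mult[OF p ps]]) code_simp+
  have h: "has_trunc ((T3 ^ 4 + T4 ^ 4) * Psi2 ^ 33 * (T3 ^ 4 * T4 ^ 4)\<^sup>2) [17179869184, 0, 429496729600, 0, 0]"
    by (rule has_trunc_eqI[OF has_trunc_mult[OF g xy2]]) code_simp+
  have "qexp (\<lambda>z. (theta3 z ^ 4 + theta4 z ^ 4) * psi2 z ^ 33 * (theta3 z ^ 4 * theta4 z ^ 4)\<^sup>2)
      ((T3 ^ 4 + T4 ^ 4) * Psi2 ^ 33 * (T3 ^ 4 * T4 ^ 4)\<^sup>2)"
    by (intro qexp_mult qexp_power qexp_add qexp_theta3 qexp_theta4 qexp_psi2)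
  from qexp_cf[OF this, of 4] show ?thesis using has_trunc_nth_eq_0[OF h, of 4] by simp
qed

subsection \<open>The form attached to sums of two squares\<close>

text \<open>The coefficients of \<open>theta3\<^sup>2 Delta8\<close> are, up to a constant, the sums of
  \<open>Re ((m + n \<i>) ^ 4)\<close> over the representations \<open>m\<^sup>2 + n\<^sup>2 = N\<close>. Both this and the
  Wronskian identity for \<open>theta3, theta4\<close> that enters the proof hold because the two sides obey the
  same functional equation under \<open>q \<mapsto> q\<^sup>2\<close>, which has no nonzero solution of high order.\<close>

definition qD :: "complex fps \<Rightarrow> complex fps" where
  "qD A = fps_X * fps_deriv A"

lemma qD_nth: "fps_nth (qD A) n = of_nat n * fps_nth A n"
  by (cases n) (auto simp: qD_def)

lemma qD_mult: "qD (A * B) = qD A * B + A * qD B"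
  by (simp add: qD_def algebra_simps)

lemma qD_add: "qD (A + B) = qD A + qD B"
  by (simp add: qD_def algebra_simps)

lemma qD_diff: "qD (A - B) = qD A - qD B"
  by (simp add: qD_def algebra_simps)

lemma qD_numeral [simp]: "qD (numeral k) = 0"
  by (simp add: qD_def)

lemma qD_power4: "qD (A ^ 4) = 4 * A ^ 3 * qD A"
  by (simp add: eval_nat_numeral qD_mult algebra_simps)

lemma qD_compose_X2: "qD (A oo fps_X ^ 2) = 2 * (qD A oo fps_X ^ 2)"
  by (rule fps_ext) (auto simp: qD_nth fps_nth_compose_X_power elim!: evenE)

definition "T3_dil = T3 oo fps_X ^ 2"
definition "T4_dil = T4 oo fps_X ^ 2"

lemma T3_T4_dil_sum: "T3\<^sup>2 + T4\<^sup>2 = 2 * T3_dil\<^sup>2"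
  using T3_T4_squares by (simp add: T3_dil_def)

lemma T3_T4_dil_prod: "T3 * T4 = T4_dil\<^sup>2"
proof (rule qexp_unique)
  show "qexp (\<lambda>z. theta3 z * theta4 z) (T3 * T4)"
    by (intro qexp_mult qexp_theta3 qexp_theta4)
  have "qexp (\<lambda>z. theta4 (of_nat 2 * z) ^ 2) (T4_dil\<^sup>2)"
    unfolding T4_dil_def by (intro qexp_power qexp_dilate qexp_theta4) simp
  thus "qexp (\<lambda>z. theta3 z * theta4 z) (T4_dil\<^sup>2)"
    by (rule qexp_cong) (simp add: theta3_theta4_mult)
qed

lemma low_coeffs:
  "fps_nth T3 0 = 1" "fps_nth T3 1 = 2" "fps_nth T4 0 = 1" "fps_nth T4 1 = -2"
proof -
  have "has_trunc T3 [1, 2]" by (rule has_trunc_eqI[OF has_trunc_T3[of 2]]) code_simp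
  from has_trunc_nth[OF this, of 0] has_trunc_nth[OF this, of 1]
  show "fps_nth T3 0 = 1" "fps_nth T3 1 = 2" "fps_nth T4 0 = 1" "fps_nth T4 1 = -2"
    by (simp_all add: T4_nth)
qed

lemma compose_X2_nth_eq_0:
  assumes "j < 2 * subdegree X" shows "fps_nth (X oo fps_X ^ 2) j = 0"
  using assms by (auto simp: fps_nth_compose_X_power intro!: nth_less_subdegree_zero)

text \<open>In analytic terms q d/dq log (theta3 / theta4) = theta2^4 / 4. With X the difference of
  the two sides, a relation between X(q) and X(q^2) excludes a nonzero lowest coefficient.\<close>

lemma wronskian: "4 * (T4 * qD T3 - T3 * qD T4) = T3 * T4 * (T3 ^ 4 - T4 ^ 4)"
proof -
  define X where "X = 4 * (T4 * qD T3 - T3 * qD T4) - T3 * T4 * (T3 ^ 4 - T4 ^ 4)"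
  let ?X2 = "fps_X ^ 2 :: complex fps"
  have X2: "2 * (X oo ?X2) = 4 * (T4_dil * qD T3_dil - T3_dil * qD T4_dil) - 2 * (T3_dil * T4_dil * (T3_dil ^ 4 - T4_dil ^ 4))"
  proof -
    have "X oo ?X2 = 4 * (T4_dil * (qD T3 oo ?X2) - T3_dil * (qD T4 oo ?X2)) - T3_dil * T4_dil * (T3_dil ^ 4 - T4_dil ^ 4)"
      by (simp add: X_def T3_dil_def T4_dil_def fps_compose_sub_distrib fps_compose_mult_distrib
           fps_compose_power numeral_fps_const)
    moreover have "qD T3_dil = 2 * (qD T3 oo ?X2)" "qD T4_dil = 2 * (qD T4 oo ?X2)"
      by (simp_all only: T3_dil_def T4_dil_def qD_compose_X2)
    ultimately show ?thesis by algebra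
  qed
  have d1: "T3 * qD T3 + T4 * qD T4 = 2 * (T3_dil * qD T3_dil)"
  proof -
    have "qD (T3\<^sup>2 + T4\<^sup>2) = qD (2 * T3_dil\<^sup>2)" by (simp only: T3_T4_dil_sum)
    hence "2 * (T3 * qD T3 + T4 * qD T4) = 2 * (2 * (T3_dil * qD T3_dil))"
      by (simp add: qD_add power2_eq_square qD_mult algebra_simps)
    thus ?thesis by (subst (asm) mult_cancel_left) simp
  qed
  have d2: "qD T3 * T4 + T3 * qD T4 = 2 * (T4_dil * qD T4_dil)"
  proof -
    have "qD (T3 * T4) = qD (T4_dil\<^sup>2)" by (simp only: T3_T4_dil_prod)
    thus ?thesis by (simp add: power2_eq_square qD_mult algebra_simps)
  qed
  \<comment> \<open>After this multiplication the dilated series and their derivatives occur only in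
    combinations that the two dilation relations and their derivatives \<open>d1\<close>,
    \<open>d2\<close> express through T3 and T4.\<close>
  have *: "4 * T3_dil * T4_dil * (2 * (X oo ?X2)) = (T3\<^sup>2 - T4\<^sup>2) * X"
  proof -
    have "2 * T3_dil * T4_dil * (2 * (X oo ?X2)) * 2 = 8 * (T4_dil\<^sup>2 * (2 * (T3_dil * qD T3_dil)) - T3_dil\<^sup>2 * (2 * (T4_dil * qD T4_dil)))
        - (2 * T3_dil\<^sup>2) * T4_dil\<^sup>2 * ((2 * T3_dil\<^sup>2)\<^sup>2 - 4 * (T4_dil\<^sup>2)\<^sup>2)"
      unfolding X2 by algebra
    also have "\<dots> = 8 * (T3 * T4 * (T3 * qD T3 + T4 * qD T4)) - 4 * ((T3\<^sup>2 + T4\<^sup>2) * (qD T3 * T4 + T3 * qD T4))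
        - (T3\<^sup>2 + T4\<^sup>2) * (T3 * T4) * ((T3\<^sup>2 + T4\<^sup>2)\<^sup>2 - 4 * (T3 * T4)\<^sup>2)"
      unfolding d1 d2 T3_T4_dil_sum T3_T4_dil_prod by algebra
    also have "\<dots> = (T3\<^sup>2 - T4\<^sup>2) * X" unfolding X_def by algebra
    finally show ?thesis by (simp add: mult_ac)
  qed
  have X01: "fps_nth X 0 = 0" "fps_nth X 1 = 0"
    using low_coeffs
    by (simp_all add: X_def fps_mult_nth_1 qD_nth fps_nth_power_0 eval_nat_numeral)
  have "X = 0"
  proof (rule ccontr)
    assume "X \<noteq> 0"
    define n where "n = subdegree X"
    have Xn: "fps_nth X n \<noteq> 0" using \<open>X \<noteq> 0\<close> by (simp add: n_def)
    \<comment> \<open>If n is the lowest index, the right-hand side of the relation has order n + 1,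
      because T3^2 - T4^2 = 8 q + ..., and the left-hand side has order at least 2 n. These clash
      once n is at least 2; smaller n is excluded by \<open>X01\<close>.\<close>
    have n: "n \<ge> 2"
    proof (rule ccontr)
      assume "\<not> n \<ge> 2"
      hence "n = 0 \<or> n = 1" by auto
      thus False using Xn X01 by auto
    qed
    have "fps_nth ((T3\<^sup>2 - T4\<^sup>2) * X) (Suc n) = (\<Sum>i=0..Suc n. fps_nth (T3\<^sup>2 - T4\<^sup>2) i * fps_nth X (Suc n - i))"
      by (simp only: fps_mult_nth)
    also have "\<dots> = (\<Sum>i\<in>{1}. fps_nth (T3\<^sup>2 - T4\<^sup>2) i * fps_nth X (Suc n - i))"
    proof (rule sum.mono_neutral_right)
      show "\<forall>i\<in>{0..Suc n} - {1}. fps_nth (T3\<^sup>2 - T4\<^sup>2) i * fps_nth X (Suc n - i) = 0"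
      proof
        fix i assume i: "i \<in> {0..Suc n} - {1}"
        show "fps_nth (T3\<^sup>2 - T4\<^sup>2) i * fps_nth X (Suc n - i) = 0"
        proof (cases "i = 0")
          case True thus ?thesis using low_coeffs by (simp add: power2_eq_square)
        next
          case False
          hence "Suc n - i < subdegree X" using i by (auto simp: n_def)
          thus ?thesis using nth_less_subdegree_zero by auto
        qed
      qed
    qed auto
    also have "\<dots> = 8 * fps_nth X n" using low_coeffs by (simp add: power2_eq_square fps_mult_nth_1)
    finally have "fps_nth ((T3\<^sup>2 - T4\<^sup>2) * X) (Suc n) \<noteq> 0" using Xn by simp
    moreover have "fps_nth (4 * T3_dil * T4_dil * (2 * (X oo ?X2))) (Suc n) = 0"
    proof -
      have "fps_nth ((4 * T3_dil * T4_dil * 2) * (X oo ?X2)) (Suc n) = 0"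
        unfolding fps_mult_nth[of _ "X oo ?X2"]
        using n by (intro sum.neutral) (auto simp: n_def compose_X2_nth_eq_0)
      thus ?thesis by (simp only: mult.assoc)
    qed
    ultimately show False using * by simp
  qed
  thus ?thesis by (simp add: X_def)
qed

text \<open>Up to a constant, the second Rankin-Cohen bracket of a form of weight 1/2 with
  itself.\<close>

definition quartic :: "complex fps \<Rightarrow> complex fps" where
  "quartic A = 2 * A * qD (qD A) - 6 * (qD A)\<^sup>2"

lemma qD_sqfps: "qD (sqfps u) = sqfps (\<lambda>m. of_int (m\<^sup>2) * u m)"
proof (rule fps_ext)
  fix n
  have "fps_nth (qD (sqfps u)) n = (\<Sum>m | m\<^sup>2 = int n. of_nat n * u m)"
    by (simp add: qD_nth sqfps_def sum_distrib_left)
  also have "\<dots> = (\<Sum>m | m\<^sup>2 = int n. of_int (m\<^sup>2) * u m)"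
    by (intro sum.cong refl) simp
  finally show "fps_nth (qD (sqfps u)) n = fps_nth (sqfps (\<lambda>m. of_int (m\<^sup>2) * u m)) n"
    by (simp only: sqfps_def fps_nth_Abs_fps)
qed

lemma quartic_T3_nth:
  "fps_nth (quartic T3) N = (\<Sum>(m, n)\<in>two_squares N. of_int (2 * n ^ 4 - 6 * m\<^sup>2 * n\<^sup>2))"
proof -
  have "quartic T3 = 2 * (sqfps (\<lambda>_. 1) * sqfps (\<lambda>m. of_int (m ^ 4))) - 6 * (sqfps (\<lambda>m. of_int (m\<^sup>2)) * sqfps (\<lambda>m. of_int (m\<^sup>2)))"
    by (simp add: quartic_def T3_def qD_sqfps power2_eq_square[of "sqfps _"] mult.assoc)
  thus ?thesis
    by (simp add: sqfps_mult_nth sum_distrib_left sum_subtractf[symmetric] case_prod_unfold mult.assoc)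
qed

text \<open>Averaging over the exchange of m and n produces the harmonic polynomial Re ((m + n
  i)^4).\<close>

lemma quartic_T3_nth_sym:
  "2 * fps_nth (quartic T3) N = (\<Sum>(m, n)\<in>two_squares N. of_int (2 * (m ^ 4 - 6 * m\<^sup>2 * n\<^sup>2 + n ^ 4)))"
proof -
  have "bij_betw (\<lambda>(m, n). (n, m)) (two_squares N) (two_squares N)"
    by (rule bij_betwI[where g = "\<lambda>(m, n). (n, m)"]) (auto simp: two_squares_def add.commute)
  from sum.reindex_bij_betw[OF this, of "\<lambda>(m, n). of_int (2 * n ^ 4 - 6 * m\<^sup>2 * n\<^sup>2) :: complex"]
  have "fps_nth (quartic T3) N = (\<Sum>(m, n)\<in>two_squares N. of_int (2 * m ^ 4 - 6 * n\<^sup>2 * m\<^sup>2))"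
    by (simp add: quartic_T3_nth case_prod_unfold)
  hence "2 * fps_nth (quartic T3) N = (\<Sum>(m, n)\<in>two_squares N. of_int (2 * m ^ 4 - 6 * n\<^sup>2 * m\<^sup>2)) +
      (\<Sum>(m, n)\<in>two_squares N. of_int (2 * n ^ 4 - 6 * m\<^sup>2 * n\<^sup>2))"
    by (simp only: quartic_T3_nth mult_2)
  also have "\<dots> = (\<Sum>(m, n)\<in>two_squares N. of_int (2 * (m ^ 4 - 6 * m\<^sup>2 * n\<^sup>2 + n ^ 4)))"
    unfolding sum.distrib[symmetric] by (intro sum.cong) (auto simp: algebra_simps)
  finally show ?thesis .
qed

text \<open>The factor is (1 + i)^4 = -4, through the bijection
  \<open>two_squares_double\<close>.\<close>

lemma quartic_T3_double: "fps_nth (quartic T3) (2 * N) = -4 * fps_nth (quartic T3) N"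
proof -
  have "2 * fps_nth (quartic T3) (2 * N) =
      (\<Sum>(u, v)\<in>two_squares N. of_int (2 * ((u + v) ^ 4 - 6 * (u + v)\<^sup>2 * (u - v)\<^sup>2 + (u - v) ^ 4)))"
    using sum.reindex_bij_betw[OF two_squares_double, of "\<lambda>(m, n). of_int (2 * (m ^ 4 - 6 * m\<^sup>2 * n\<^sup>2 + n ^ 4)) :: complex" N]
    by (simp only: quartic_T3_nth_sym case_prod_unfold fst_conv snd_conv)
  also have "\<dots> = (\<Sum>(u, v)\<in>two_squares N. -4 * of_int (2 * (u ^ 4 - 6 * u\<^sup>2 * v\<^sup>2 + v ^ 4)))"
  proof (intro sum.cong refl, clarify)
    fix u v :: int
    have "2 * ((u + v) ^ 4 - 6 * (u + v)\<^sup>2 * (u - v)\<^sup>2 + (u - v) ^ 4) = -4 * (2 * (u ^ 4 - 6 * u\<^sup>2 * v\<^sup>2 + v ^ 4))"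
      by algebra
    thus "of_int (2 * ((u + v) ^ 4 - 6 * (u + v)\<^sup>2 * (u - v)\<^sup>2 + (u - v) ^ 4)) =
        - 4 * complex_of_int (2 * (u ^ 4 - 6 * u\<^sup>2 * v\<^sup>2 + v ^ 4))"
      by (simp only: of_int_mult) simp
  qed
  also have "\<dots> = -4 * (2 * fps_nth (quartic T3) N)"
    unfolding quartic_T3_nth_sym by (simp only: sum_distrib_left case_prod_unfold)
  finally show ?thesis by simp
qed

text \<open>In the proof X is the difference of both sides and Y is X with q replaced by -q. Index
  doubling gives X + Y = - 8 X(q^2), the Wronskian gives T4^2 X = T3^2 Y, and eliminating Y leaves a
  relation between X(q) and X(q^2).\<close>

lemma quartic_T3: "4 * quartic T3 = T3\<^sup>2 * (T3 ^ 4 - T4 ^ 4) * T4 ^ 4"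
proof -
  let ?X2 = "fps_X ^ 2 :: complex fps"
  define X where "X = 4 * quartic T3 - T3\<^sup>2 * (T3 ^ 4 - T4 ^ 4) * T4 ^ 4"
  define Y where "Y = 4 * quartic T4 + T4\<^sup>2 * (T3 ^ 4 - T4 ^ 4) * T3 ^ 4"
  have qD_minus: "qD (A oo - fps_X) = qD A oo - fps_X" for A
    by (rule fps_ext) (simp add: qD_nth fps_compose_uminus')
  have quartic_T4: "quartic T4 = quartic T3 oo - fps_X"
    by (simp add: quartic_def T4_def qD_minus fps_compose_sub_distrib fps_compose_mult_distrib
        fps_compose_power numeral_fps_const)
  have "quartic T3 + quartic T4 = - 8 * (quartic T3 oo ?X2)"
  proof (rule fps_ext)
    fix N
    have "fps_nth (- 8 * (quartic T3 oo ?X2)) N = - 8 * fps_nth (quartic T3 oo ?X2) N"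
      by (simp only: numeral_fps_const fps_const_neg fps_mult_left_const_nth)
    thus "fps_nth (quartic T3 + quartic T4) N = fps_nth (- 8 * (quartic T3 oo ?X2)) N"
      by (cases "even N") (auto simp: quartic_T4 fps_compose_uminus' fps_nth_compose_X_power quartic_T3_double elim!: evenE)
  qed
  moreover have "T4\<^sup>2 * (T3 ^ 4 - T4 ^ 4) * T3 ^ 4 - T3\<^sup>2 * (T3 ^ 4 - T4 ^ 4) * T4 ^ 4 =
      8 * (T3_dil\<^sup>2 * (T3_dil ^ 4 - T4_dil ^ 4) * T4_dil ^ 4)"
  proof -
    have "8 * (T3_dil\<^sup>2 * (T3_dil ^ 4 - T4_dil ^ 4) * T4_dil ^ 4) = (2 * T3_dil\<^sup>2) * ((2 * T3_dil\<^sup>2)\<^sup>2 - 4 * (T4_dil\<^sup>2)\<^sup>2) * (T4_dil\<^sup>2)\<^sup>2"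
      by algebra
    also have "\<dots> = T4\<^sup>2 * (T3 ^ 4 - T4 ^ 4) * T3 ^ 4 - T3\<^sup>2 * (T3 ^ 4 - T4 ^ 4) * T4 ^ 4"
      unfolding T3_T4_dil_sum[symmetric] T3_T4_dil_prod[symmetric] by algebra
    finally show ?thesis ..
  qed
  moreover have "X oo ?X2 = 4 * (quartic T3 oo ?X2) - T3_dil\<^sup>2 * (T3_dil ^ 4 - T4_dil ^ 4) * T4_dil ^ 4"
    by (simp add: X_def T3_dil_def T4_dil_def fps_compose_sub_distrib fps_compose_mult_distrib
         fps_compose_power numeral_fps_const)
  ultimately have XY: "X + Y = - 8 * (X oo ?X2)"
    unfolding X_def Y_def by algebra
  have d: "4 * (T4 * qD (qD T3) - T3 * qD (qD T4)) =
      (qD T3 * T4 + T3 * qD T4) * (T3 ^ 4 - T4 ^ 4) + T3 * T4 * (4 * T3 ^ 3 * qD T3 - 4 * T4 ^ 3 * qD T4)"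
    using arg_cong[OF wronskian, of qD]
    by (simp add: qD_diff qD_mult qD_power4 algebra_simps)
  have "T4\<^sup>2 * X - T3\<^sup>2 * Y = 2 * T3 * T4 * (4 * (T4 * qD (qD T3) - T3 * qD (qD T4)))
     - 6 * (4 * (T4 * qD T3 - T3 * qD T4)) * (T4 * qD T3 + T3 * qD T4)
     - T3\<^sup>2 * T4\<^sup>2 * (T3 ^ 4 - T4 ^ 4) * (T3 ^ 4 + T4 ^ 4)"
    unfolding X_def Y_def quartic_def by algebra
  also have "\<dots> = (4 * (T4 * qD T3 - T3 * qD T4)) * T3 * T4 * (T3 ^ 4 + T4 ^ 4)
     - T3\<^sup>2 * T4\<^sup>2 * (T3 ^ 4 - T4 ^ 4) * (T3 ^ 4 + T4 ^ 4)"
    unfolding d wronskian[symmetric] using wronskian by algebra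
  also have "\<dots> = 0" unfolding wronskian by algebra
  finally have "T4\<^sup>2 * X = T3\<^sup>2 * Y" by simp
  hence "(T3\<^sup>2 + T4\<^sup>2) * X = T3\<^sup>2 * (X + Y)" by (simp add: algebra_simps)
  \<comment> \<open>At a lowest index n > 0 the right-hand side contributes nothing, having order at
    least 2 n; at n = 0 the relation reads 2 x = - 8 x. Either way the lowest coefficient is
    0.\<close>
  hence *: "(2 * T3_dil\<^sup>2) * X = (- 8 * T3\<^sup>2) * (X oo ?X2)"
    unfolding XY T3_T4_dil_sum by (simp only: mult_ac)
  have "X = 0"
  proof (rule ccontr)
    assume "X \<noteq> 0"
    define n where "n = subdegree X"
    have Xn: "fps_nth X n \<noteq> 0" using \<open>X \<noteq> 0\<close> by (simp add: n_def)
    have P0: "fps_nth T3_dil 0 = 1" by (simp add: T3_dil_def fps_nth_compose_X_power)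
    have l: "fps_nth ((2 * T3_dil\<^sup>2) * X) n = 2 * fps_nth X n"
    proof -
      have "fps_nth ((2 * T3_dil\<^sup>2) * X) n = (\<Sum>i=0..n. fps_nth (2 * T3_dil\<^sup>2) i * fps_nth X (n - i))"
        by (simp only: fps_mult_nth)
      also have "\<dots> = (\<Sum>i\<in>{0}. fps_nth (2 * T3_dil\<^sup>2) i * fps_nth X (n - i))"
        by (rule sum.mono_neutral_right) (auto simp: n_def intro!: nth_less_subdegree_zero)
      finally show ?thesis using P0 by (simp add: power2_eq_square)
    qed
    have r: "fps_nth ((- 8 * T3\<^sup>2) * (X oo ?X2)) n = (if n = 0 then - 8 * fps_nth X n else 0)"
    proof (cases "n = 0")
      case True
      thus ?thesis by (simp add: fps_nth_compose_X_power power2_eq_square)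
    next
      case False
      have "(\<Sum>i=0..n. fps_nth (- 8 * T3\<^sup>2) i * fps_nth (X oo ?X2) (n - i)) = 0"
        using False by (intro sum.neutral) (auto simp: n_def compose_X2_nth_eq_0)
      thus ?thesis using False by (simp only: fps_mult_nth[of "- 8 * T3\<^sup>2"]) simp
    qed
    show False using l r Xn * by (auto split: if_splits)
  qed
  thus ?thesis by (simp add: X_def)
qed

lemma acoef_0_2_1:
  assumes "\<nexists>a b::int. int m = a\<^sup>2 + b\<^sup>2"
  shows "acoef 0 2 1 m = 0"
proof (rule acoef_eq_0I)
  have "two_squares m = {}" using assms by (simp add: two_squares_def) metis
  hence "fps_nth (quartic T3) m = 0" by (simp add: quartic_T3_nth)
  hence "fps_nth (4 * quartic T3) m = 0" by simp
  thus "fps_nth ((T4 ^ 4 - (T3 ^ 4 - T4 ^ 4)) ^ 0 * T3 ^ 2 * ((T3 ^ 4 - T4 ^ 4) * T4 ^ 4) ^ 1) m = 0"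
    by (simp add: quartic_T3 mult.assoc)
qed

subsection \<open>Inversion of theta3\<close>

lemma has_sum_integral_int:
  fixes F :: "int \<Rightarrow> real \<Rightarrow> complex"
  assumes cont: "\<And>n. continuous_on {a..b} (F n)"
    and bound: "\<And>n x. x \<in> {a..b} \<Longrightarrow> norm (F n x) \<le> M n"
    and M: "M summable_on UNIV"
  shows "continuous_on {a..b} (\<lambda>x. \<Sum>\<^sub>\<infinity>n. F n x)"
    and "((\<lambda>n. integral {a..b} (F n)) has_sum integral {a..b} (\<lambda>x. \<Sum>\<^sub>\<infinity>n. F n x)) UNIV"
proof -
  have ul: "uniform_limit {a..b} (\<lambda>X x. \<Sum>n\<in>X. F n x) (\<lambda>x. \<Sum>\<^sub>\<infinity>n. F n x) (finite_subsets_at_top UNIV)"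
    by (rule Weierstrass_m_test_general[OF bound M]) auto
  have c: "continuous_on {a..b} (\<lambda>x. \<Sum>n\<in>X. F n x)" for X
    by (intro continuous_on_sum cont)
  show "continuous_on {a..b} (\<lambda>x. \<Sum>\<^sub>\<infinity>n. F n x)"
    by (rule uniform_limit_theorem[OF _ ul]) (auto simp: c)
  obtain I J where I: "\<And>X. ((\<lambda>x. \<Sum>n\<in>X. F n x) has_integral I X) {a..b}"
    and J: "((\<lambda>x. \<Sum>\<^sub>\<infinity>n. F n x) has_integral J) {a..b}" and IJ: "(I \<longlongrightarrow> J) (finite_subsets_at_top UNIV)"
    using uniform_limit_integral[OF ul c] by auto
  have "I X = (\<Sum>n\<in>X. integral {a..b} (F n))" if "finite X" for X
    using I[of X] that cont by (simp add: has_integral_iff integral_sum integrable_continuous_real)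
  hence "eventually (\<lambda>X. I X = (\<Sum>n\<in>X. integral {a..b} (F n))) (finite_subsets_at_top UNIV)"
    using eventually_finite_subsets_at_top_weakI by blast
  with IJ have "((\<lambda>X. \<Sum>n\<in>X. integral {a..b} (F n)) \<longlongrightarrow> J) (finite_subsets_at_top UNIV)"
    using Lim_transform_eventually by blast
  thus "((\<lambda>n. integral {a..b} (F n)) has_sum integral {a..b} (\<lambda>x. \<Sum>\<^sub>\<infinity>n. F n x)) UNIV"
    using J by (simp add: has_sum_def has_integral_iff)
qed

section \<open>Fourier uniqueness at one point\<close>

abbreviation ef :: "int \<Rightarrow> real \<Rightarrow> complex" where
  "ef k x \<equiv> exp (2 * of_real pi * \<i> * of_int k * of_real x)"

lemma ef_add: "ef k x * ef l x = ef (k + l) x"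
  by (simp add: ring_distribs flip: exp_add)

lemma cos_sq_ef: "of_real ((cos (pi * x))\<^sup>2) = (2 + ef 1 x + ef (-1) x) / 4"
proof -
  have "(cos (pi * x))\<^sup>2 = (1 + cos (2 * (pi * x))) / 2"
    by (simp add: cos_double_cos)
  hence "complex_of_real ((cos (pi * x))\<^sup>2) = (1 + cos (of_real (2 * (pi * x)))) / 2"
    by (simp only: cos_of_real of_real_divide of_real_add of_real_1 of_real_numeral)
  also have "\<dots> = (2 + ef 1 x + ef (-1) x) / 4"
    by (simp add: cos_exp_eq field_simps)
  finally show ?thesis .
qed

text \<open>The kernels \<open>cos (pi x) ^ (2 n)\<close> are trigonometric polynomials concentrating at 0, so a
  continuous function with vanishing Fourier coefficients vanishes at 0.\<close>

lemma fourier_unique_at_0: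
  fixes \<phi> :: "real \<Rightarrow> complex"
  assumes cont: "continuous_on {-1/2..1/2} \<phi>"
    and zero: "\<And>k. integral {-1/2..1/2} (\<lambda>x. \<phi> x * ef k x) = 0"
  shows "\<phi> 0 = 0"
proof (rule ccontr)
  assume nz: "\<phi> 0 \<noteq> 0"
  define C where "C = (\<lambda>n x. (cos (pi * x)) ^ (2 * n))"
  have I0: "integral {-1/2..1/2} (\<lambda>x. \<phi> x * of_real (C n x) * ef k x) = 0" for n k
  proof (induction n arbitrary: k)
    case 0 show ?case using zero by (simp add: C_def)
  next
    case (Suc n)
    have int: "(\<lambda>x. \<phi> x * of_real (C n x) * ef j x) integrable_on {-1/2..1/2}" for j
      unfolding C_def by (intro integrable_continuous_real continuous_intros cont)
    \<comment> \<open>A factor cos^2 is a combination of the frequencies -1, 0, 1, so vanishing for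
      all k passes from n to n + 1.\<close>
    have "\<phi> x * of_real (C (Suc n) x) * ef k x = (1/2) * (\<phi> x * of_real (C n x) * ef k x) +
        ((1/4) * (\<phi> x * of_real (C n x) * ef (k + 1) x) + (1/4) * (\<phi> x * of_real (C n x) * ef (k - 1) x))" for x
    proof -
      have "C (Suc n) x = C n x * (cos (pi * x))\<^sup>2" by (simp add: C_def power2_eq_square)
      hence 1: "of_real (C (Suc n) x) = of_real (C n x) * ((2 + ef 1 x + ef (-1) x) / 4)"
        by (simp only: of_real_mult cos_sq_ef)
      have 2: "ef (k + 1) x = ef k x * ef 1 x" "ef (k - 1) x = ef k x * ef (-1) x"
        by (simp_all only: ef_add diff_conv_add_uminus)
      have "f * (c * ((2 + a + b) / 4)) * e = (1/2) * (f * c * e) + ((1/4) * (f * c * (e * a)) + (1/4) * (f * c * (e * b)))"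
        for f c a b e :: complex by (simp add: field_simps)
      thus ?thesis unfolding 1 2 .
    qed
    hence "integral {-1/2..1/2} (\<lambda>x. \<phi> x * of_real (C (Suc n) x) * ef k x) =
        integral {-1/2..1/2} (\<lambda>x. (1/2) * (\<phi> x * of_real (C n x) * ef k x) +
        ((1/4) * (\<phi> x * of_real (C n x) * ef (k + 1) x) + (1/4) * (\<phi> x * of_real (C n x) * ef (k - 1) x)))"
      by (simp only:)
    also have "\<dots> = (1/2) * integral {-1/2..1/2} (\<lambda>x. \<phi> x * of_real (C n x) * ef k x) +
      ((1/4) * integral {-1/2..1/2} (\<lambda>x. \<phi> x * of_real (C n x) * ef (k + 1) x) +
       (1/4) * integral {-1/2..1/2} (\<lambda>x. \<phi> x * of_real (C n x) * ef (k - 1) x))"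
      by (subst integral_add, (intro integrable_add integrable_on_mult_right int)+,
          subst integral_add, (intro integrable_add integrable_on_mult_right int)+, simp only: integral_mult_right)
    also have "\<dots> = 0" by (simp only: Suc.IH) simp
    finally show ?case .
  qed
  \<comment> \<open>Multiplying by the conjugate of \<phi> 0 makes the value at 0 a positive real,
    so that signs can be used.\<close>
  define u where "u = (\<lambda>x. Re (cnj (\<phi> 0) * \<phi> x))"
  define c where "c = u 0"
  have c: "c > 0" using nz unfolding complex_neq_0 by (simp add: c_def u_def power2_eq_square)
  have contu: "continuous_on {-1/2..1/2} u"
    unfolding u_def by (intro continuous_intros cont)
  have contC: "continuous_on S (C n)" for n S
    unfolding C_def by (intro continuous_intros)
  have I1: "integral {-1/2..1/2} (\<lambda>x. u x * C n x) = 0" for n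
  proof -
    have int: "(\<lambda>x. \<phi> x * of_real (C n x)) integrable_on {-1/2..1/2}"
      unfolding C_def by (intro integrable_continuous_real continuous_intros cont)
    have "integral {-1/2..1/2} (\<lambda>x. \<phi> x * of_real (C n x)) = 0" using I0[of n 0] by simp
    with integrable_integral[OF int]
    have "((\<lambda>x. \<phi> x * of_real (C n x)) has_integral 0) {-1/2..1/2}" by (simp only:)
    hence "((\<lambda>x. cnj (\<phi> 0) * (\<phi> x * of_real (C n x))) has_integral cnj (\<phi> 0) * 0) {-1/2..1/2}"
      by (rule has_integral_mult_right)
    from has_integral_linear[OF this bounded_linear_Re]
    have "((\<lambda>x. u x * C n x) has_integral 0) {-1/2..1/2}"
      by (simp add: o_def u_def mult.assoc[symmetric])
    thus ?thesis by (simp add: has_integral_iff)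
  qed
  obtain M where M: "\<And>x. x \<in> {-1/2..1/2} \<Longrightarrow> \<bar>u x\<bar> \<le> M" "M \<ge> 0"
  proof -
    have "bounded (u ` {-1/2..1/2})"
      by (intro compact_imp_bounded compact_continuous_image contu) auto
    then obtain M where M: "\<forall>t\<in>u ` {-1/2..1/2}. norm t \<le> M" unfolding bounded_iff by blast
    have "\<bar>u x\<bar> \<le> M" if "x \<in> {-1/2..1/2}" for x using M imageI[OF that, of u] by auto
    moreover from this[of 0] have "M \<ge> 0" by auto
    ultimately show ?thesis using that by blast
  qed
  obtain \<delta> where \<delta>: "0 < \<delta>" "\<delta> < 1/2" "\<And>x. \<bar>x\<bar> \<le> \<delta> \<Longrightarrow> u x \<ge> c / 2"
  proof -
    have "0 \<in> {-1/2..1/2::real}" by simp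
    from contu[unfolded continuous_on_iff, rule_format, OF this, of "c / 2"] c
    obtain d where d: "d > 0" "\<And>x. x \<in> {-1/2..1/2} \<Longrightarrow> \<bar>x\<bar> < d \<Longrightarrow> \<bar>u x - c\<bar> < c / 2"
      by (auto simp: dist_real_def c_def)
    define e where "e = min (d / 2) (1/4)"
    have "u x \<ge> c / 2" if "\<bar>x\<bar> \<le> e" for x
    proof -
      have "x \<in> {-1/2..1/2}" "\<bar>x\<bar> < d" using that d(1) by (auto simp: e_def)
      from d(2)[OF this] show ?thesis by linarith
    qed
    moreover have "0 < e" "e < 1/2" using d(1) by (auto simp: e_def)
    ultimately show ?thesis using that by blast
  qed
  \<comment> \<open>Squared cosines at \<delta> / 2 and \<delta>: the kernel is at least A^n up to
    \<delta> / 2 and at most B^n beyond \<delta>. In between the integrand is nonnegative. Because B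
    < A, the positive inner part outgrows the rest.\<close>
  define A where "A = (cos (pi * (\<delta> / 2)))\<^sup>2"
  define B where "B = (cos (pi * \<delta>))\<^sup>2"
  have cpos: "cos (pi * x) > 0" if "\<bar>x\<bar> < 1/2" for x
  proof -
    have "\<bar>pi * x\<bar> < pi / 2" using that by (simp add: abs_mult)
    hence "- (pi / 2) < pi * x" "pi * x < pi / 2" unfolding abs_less_iff by linarith+
    thus ?thesis by (rule cos_gt_zero_pi)
  qed
  have cmono: "cos (pi * x) \<le> cos (pi * y)" if "\<bar>y\<bar> \<le> \<bar>x\<bar>" "\<bar>x\<bar> \<le> 1" for x y
  proof -
    have "cos \<bar>pi * x\<bar> \<le> cos \<bar>pi * y\<bar>" using that by (intro cos_monotone_0_pi_le) (auto simp: abs_mult mult_left_mono)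
    thus ?thesis by simp
  qed
  have Cpos: "C n x \<ge> 0" for n x by (simp add: C_def power_mult)
  have AB: "B > 0" "B < A"
  proof -
    have "cos (pi * \<delta>) < cos (pi * (\<delta> / 2))" using \<delta> by (intro cos_monotone_0_pi) auto
    moreover have "cos (pi * \<delta>) > 0" using \<delta> by (intro cpos) auto
    ultimately show "B > 0" "B < A" by (auto simp: A_def B_def intro!: power_strict_mono)
  qed
  have key: "c / 2 * \<delta> * A ^ n \<le> M * B ^ n" for n
  proof -
    have inn: "u x * C n x \<ge> (if \<bar>x\<bar> \<le> \<delta> / 2 then c / 2 * A ^ n else - (M * B ^ n))" if x: "x \<in> {-1/2..1/2}" for x
    proof -
      consider "\<bar>x\<bar> \<le> \<delta> / 2" | "\<bar>x\<bar> > \<delta> / 2" "\<bar>x\<bar> \<le> \<delta>" | "\<bar>x\<bar> > \<delta>" by linarith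
      thus ?thesis
      proof cases
        case 1
        have "cos (pi * (\<delta> / 2)) \<le> cos (pi * x)" using 1 \<delta> by (intro cmono) auto
        moreover have "cos (pi * (\<delta> / 2)) \<ge> 0" using cpos[of "\<delta> / 2"] \<delta> by simp
        ultimately have "A ^ n \<le> C n x" by (auto simp: A_def C_def power_mult intro!: power_mono)
        moreover have "u x \<ge> c / 2" using 1 \<delta> by auto
        ultimately have "c / 2 * A ^ n \<le> u x * C n x" using c AB Cpos by (intro mult_mono) auto
        thus ?thesis using 1 by simp
      next
        case 2
        have "u x \<ge> 0" using \<delta>(3)[OF 2(2)] c by linarith
        hence "u x * C n x \<ge> 0" using Cpos by simp
        moreover have "M * B ^ n \<ge> 0" using M AB by simp
        ultimately show ?thesis using 2 by simp
      next
        case 3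
        have "cos (pi * x) \<le> cos (pi * \<delta>)" using 3 \<delta> x by (intro cmono) auto
        moreover have "cos (pi * x) \<ge> 0"
        proof (cases "\<bar>x\<bar> < 1/2")
          case True thus ?thesis using cpos[of x] by simp
        next
          case False
          hence "\<bar>x\<bar> = 1/2" using x by auto
          hence "x = 1/2 \<or> x = -1/2" by auto
          thus ?thesis by (elim disjE; hypsubst) simp_all
        qed
        ultimately have "C n x \<le> B ^ n" by (auto simp: B_def C_def power_mult intro!: power_mono)
        hence "\<bar>u x * C n x\<bar> \<le> M * B ^ n" unfolding abs_mult using M x Cpos[of n x] by (intro mult_mono) auto
        thus ?thesis using 3 \<delta> by (simp add: abs_le_iff)
      qed
    qed
    define v where "v = (\<lambda>x::real. if \<bar>x\<bar> \<le> \<delta> / 2 then c / 2 * A ^ n else - (M * B ^ n))"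
    define w where "w = (\<lambda>x::real. - (M * B ^ n) + (if x \<in> {-(\<delta>/2)..\<delta>/2} then c / 2 * A ^ n + M * B ^ n else 0))"
    have "v = w" by (auto simp: v_def w_def fun_eq_iff abs_le_iff)
    have h: "((\<lambda>x::real. if x \<in> {-(\<delta>/2)..\<delta>/2} then c / 2 * A ^ n + M * B ^ n else 0) has_integral \<delta> * (c / 2 * A ^ n + M * B ^ n)) {-1/2..1/2}"
    proof -
      have "((\<lambda>_. c / 2 * A ^ n + M * B ^ n) has_integral \<delta> * (c / 2 * A ^ n + M * B ^ n)) {-(\<delta>/2)..\<delta>/2}"
        using has_integral_const_real[of "c / 2 * A ^ n + M * B ^ n" "-(\<delta>/2)" "\<delta>/2"] \<delta> by simp
      moreover have "{-(\<delta>/2)..\<delta>/2} \<subseteq> {-1/2..1/2}" using \<delta> by auto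
      ultimately show ?thesis by (subst has_integral_restrict)
    qed
    have "((\<lambda>_. - (M * B ^ n)) has_integral - (M * B ^ n)) {-1/2..1/2::real}"
      using has_integral_const_real[of "- (M * B ^ n)" "-1/2" "1/2"] by simp
    from has_integral_add[OF this h]
    have "(v has_integral - (M * B ^ n) + \<delta> * (c / 2 * A ^ n + M * B ^ n)) {-1/2..1/2}"
      unfolding \<open>v = w\<close> w_def .
    moreover have "((\<lambda>x. u x * C n x) has_integral 0) {-1/2..1/2}"
      using I1[of n] integrable_continuous_real[OF continuous_on_mult[OF contu contC]]
      by (simp add: has_integral_iff)
    ultimately have "- (M * B ^ n) + \<delta> * (c / 2 * A ^ n + M * B ^ n) \<le> 0"
      by (rule has_integral_le) (use inn in \<open>auto simp: v_def\<close>)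
    moreover have "\<delta> * (M * B ^ n) \<ge> 0" using \<delta> M AB by simp
    ultimately show ?thesis by (simp add: algebra_simps)
  qed
  have "(\<lambda>n. M * (B / A) ^ n) \<longlonglongrightarrow> M * 0"
    using AB by (intro tendsto_mult tendsto_const LIMSEQ_power_zero) auto
  moreover have "c / 2 * \<delta> \<le> M * (B / A) ^ n" for n
    using key[of n] AB by (simp add: power_divide field_simps)
  ultimately have "c / 2 * \<delta> \<le> M * 0"
    by (intro LIMSEQ_le_const) auto
  thus False using c \<delta> by (simp add: mult_le_0_iff)
qed

section \<open>Gaussian integrals and Poisson summation\<close>

lemma gaussian_integrable:
  assumes "y > 0"
  shows "integrable lborel (\<lambda>x. complex_of_real (exp (- pi * y * x\<^sup>2)) * ef k x)"
proof (rule Bochner_Integration.integrable_bound)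
  have "integrable lborel (normal_density 0 (sqrt (1 / (2 * pi * y))))"
    using assms by (intro integrable_normal_density) simp
  hence "integrable lborel (\<lambda>x. normal_density 0 (sqrt (1 / (2 * pi * y))) x * sqrt (1 / y))"
    by (intro integrable_mult_left) 
  moreover have "normal_density 0 (sqrt (1 / (2 * pi * y))) x * sqrt (1 / y) = exp (- pi * y * x\<^sup>2)" for x
    using assms by (simp add: normal_density_def real_sqrt_divide field_simps)
  ultimately show "integrable lborel (\<lambda>x. exp (- pi * y * x\<^sup>2))" by simp
qed (auto simp: norm_mult)

text \<open>This is the characteristic function of the standard normal distribution at t = 2 pi k /
  s, after the substitution x -> s x with s^2 = 2 pi y.\<close>

lemma gaussian_fourier:
  assumes y: "y > 0"
  shows "(LINT x|lborel. complex_of_real (exp (- pi * y * x\<^sup>2)) * ef k x) =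
    of_real (exp (- pi * (real_of_int k)\<^sup>2 / y) / sqrt y)"
proof -
  define s where "s = sqrt (2 * pi * y)"
  have s: "s > 0" "s\<^sup>2 = 2 * pi * y" using y by (auto simp: s_def)
  define t where "t = 2 * pi * real_of_int k / s"
  have "complex_of_real (exp (- t\<^sup>2 / 2)) = (CLINT x|density lborel std_normal_density. iexp (t * x))"
    using fun_cong[OF char_std_normal_distribution, of t] by (simp add: char_def)
  also have "\<dots> = (LINT x|lborel. std_normal_density x *\<^sub>R iexp (t * x))"
    by (rule integral_density) (auto simp: normal_density_nonneg)
  also have "\<dots> = \<bar>s\<bar> *\<^sub>R (LINT x|lborel. std_normal_density (0 + s * x) *\<^sub>R iexp (t * (0 + s * x)))"
    using s by (intro lborel_integral_real_affine) auto
  also have "(\<lambda>x. std_normal_density (0 + s * x) *\<^sub>R iexp (t * (0 + s * x))) =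
      (\<lambda>x. of_real (1 / sqrt (2 * pi)) * (complex_of_real (exp (- pi * y * x\<^sup>2)) * ef k x))"
  proof
    fix x
    have d: "std_normal_density (s * x) = 1 / sqrt (2 * pi) * exp (- pi * y * x\<^sup>2)"
      using s(2) by (simp add: std_normal_density_def power_mult_distrib)
    have "t * (s * x) = 2 * pi * real_of_int k * x" using s by (simp add: t_def)
    hence e: "iexp (t * (s * x)) = ef k x" by (simp only:) (simp add: mult_ac)
    show "std_normal_density (0 + s * x) *\<^sub>R iexp (t * (0 + s * x)) =
        of_real (1 / sqrt (2 * pi)) * (complex_of_real (exp (- pi * y * x\<^sup>2)) * ef k x)"
      unfolding add_0 d e by (simp only: scaleR_conv_of_real of_real_mult mult.assoc)
  qed
  finally have "complex_of_real (exp (- t\<^sup>2 / 2)) = of_real (s / sqrt (2 * pi)) *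
      (LINT x|lborel. complex_of_real (exp (- pi * y * x\<^sup>2)) * ef k x)"
    using s by (simp add: scaleR_conv_of_real)
  moreover have "s / sqrt (2 * pi) = sqrt y" using y by (simp add: s_def real_sqrt_mult)
  moreover have "- t\<^sup>2 / 2 = - pi * (real_of_int k)\<^sup>2 / y"
    unfolding t_def power_divide s(2) using y by (simp add: power2_eq_square field_simps)
  ultimately have "complex_of_real (exp (- pi * (real_of_int k)\<^sup>2 / y)) = of_real (sqrt y) *
      (LINT x|lborel. complex_of_real (exp (- pi * y * x\<^sup>2)) * ef k x)" by simp
  thus ?thesis using y by (simp add: field_simps)
qed

lemma integral_unit_intervals:
  fixes F :: "real \<Rightarrow> complex"
  assumes "continuous_on UNIV F"
  shows "(\<Sum>n=-int N..int N. integral {-1/2..1/2} (\<lambda>x. F (x + of_int n))) =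
    integral {- real N - 1/2..real N + 1/2} F"
proof -
  have int: "F integrable_on {a..b}" for a b
    by (intro integrable_continuous_real continuous_on_subset[OF assms]) auto
  have sh: "integral {-1/2..1/2} (\<lambda>x. F (x + of_int n)) = integral {of_int n - 1/2..of_int n + 1/2} F" for n
    using integral_shift_real_ivl[of "of_int n - 1/2" "of_int n" "of_int n + 1/2" F] by simp
  define J where "J = (\<lambda>n::int. integral {-1/2..1/2} (\<lambda>x. F (x + of_int n)))"
  have "(\<Sum>n=-int N..int N. J n) = integral {- real N - 1/2..real N + 1/2} F"
  proof (induction N)
    case 0 show ?case by (simp add: J_def)
  next
    case (Suc N)
    have set: "{- int (Suc N)..int (Suc N)} = insert (- int (Suc N)) (insert (int (Suc N)) {- int N..int N})" by auto
    have J1: "J (- int (Suc N)) = integral {- real (Suc N) - 1/2..- real N - 1/2} F"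
    proof -
      have "{real_of_int (- int (Suc N)) - 1/2..real_of_int (- int (Suc N)) + 1/2} = {- real (Suc N) - 1/2..- real N - 1/2}"
        by simp
      thus ?thesis unfolding J_def sh by (rule arg_cong)
    qed
    have J2: "J (int (Suc N)) = integral {real N + 1/2..real (Suc N) + 1/2} F"
    proof -
      have "{real_of_int (int (Suc N)) - 1/2..real_of_int (int (Suc N)) + 1/2} = {real N + 1/2..real (Suc N) + 1/2}"
        by simp
      thus ?thesis unfolding J_def sh by (rule arg_cong)
    qed
    have "integral {- real (Suc N) - 1/2..real (Suc N) + 1/2} F =
        integral {- real (Suc N) - 1/2..- real N - 1/2} F + integral {- real N - 1/2..real (Suc N) + 1/2} F"
      by (rule Henstock_Kurzweil_Integration.integral_combine[symmetric]) (auto intro: int)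
    also have "integral {- real N - 1/2..real (Suc N) + 1/2} F =
        integral {- real N - 1/2..real N + 1/2} F + integral {real N + 1/2..real (Suc N) + 1/2} F"
      by (rule Henstock_Kurzweil_Integration.integral_combine[symmetric]) (auto intro: int)
    finally have "integral {- real (Suc N) - 1/2..real (Suc N) + 1/2} F =
        J (- int (Suc N)) + ((\<Sum>n=-int N..int N. J n) + J (int (Suc N)))"
      by (simp only: J1 J2 Suc.IH)
    also have "\<dots> = (\<Sum>n=-int (Suc N)..int (Suc N). J n)"
      unfolding set by (subst sum.insert, simp, simp, subst sum.insert, simp, simp, simp)
    finally show ?case ..
  qed
  thus ?thesis by (simp only: J_def)
qed

lemma integral_lborel_symmetric_limit:
  fixes F :: "real \<Rightarrow> complex"
  assumes "integrable lborel F"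
  shows "(\<lambda>N. integral {- real N - 1/2..real N + 1/2} F) \<longlonglongrightarrow> (LINT x|lborel. F x)"
proof -
  have si: "set_integrable lborel {- real N - 1/2..real N + 1/2} F" for N
    using assms unfolding set_integrable_def by (intro integrable_mult_indicator) auto
  have "(\<lambda>N. LINT x|lborel. indicator {- real N - 1/2..real N + 1/2} x *\<^sub>R F x) \<longlonglongrightarrow> (LINT x|lborel. F x)"
  proof (rule integral_dominated_convergence[where w = "\<lambda>x. norm (F x)"])
    show "AE x in lborel. (\<lambda>N. indicator {- real N - 1/2..real N + 1/2} x *\<^sub>R F x) \<longlonglongrightarrow> F x"
    proof (rule AE_I2)
      fix x :: real
      obtain N0 where "\<bar>x\<bar> \<le> real N0" using real_arch_simple by blast
      hence "eventually (\<lambda>N. indicator {- real N - 1/2..real N + 1/2} x *\<^sub>R F x = F x) sequentially"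
        unfolding eventually_sequentially by (intro exI[of _ N0]) (auto simp: indicator_def)
      thus "(\<lambda>N. indicator {- real N - 1/2..real N + 1/2} x *\<^sub>R F x) \<longlonglongrightarrow> F x"
        by (rule tendsto_eventually)
    qed
  qed (use assms in \<open>auto simp: indicator_def\<close>)
  moreover have "(LINT x|lborel. indicator {- real N - 1/2..real N + 1/2} x *\<^sub>R F x) =
      integral {- real N - 1/2..real N + 1/2} F" for N
    using set_borel_integral_eq_integral(2)[OF si[of N]] by (simp add: set_lebesgue_integral_def)
  ultimately show ?thesis by simp
qed

text \<open>A geometric majorant uniform in x, from (x + n)^2 \<ge> n^2 / 2 - x^2 \<ge> |n| / 2 - 1.
  The case x = 0 also bounds the Fourier coefficients.\<close>

lemma gaussian_bound:
  assumes y: "y > 0" and x: "x \<in> {-1/2..1/2}"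
  shows "exp (- pi * y * (x + of_int n)\<^sup>2) \<le> exp (pi * y) * exp (- pi * y / 2) ^ nat \<bar>n\<bar>"
proof -
  have "\<bar>n\<bar> \<le> n\<^sup>2" by (rule abs_le_square_int)
  hence n: "\<bar>real_of_int n\<bar> \<le> (real_of_int n)\<^sup>2" by (metis of_int_abs of_int_le_iff of_int_power)
  have "0 \<le> (x + of_int n / 2)\<^sup>2 + x\<^sup>2" by simp
  hence "(x + of_int n)\<^sup>2 \<ge> (real_of_int n)\<^sup>2 / 2 - x\<^sup>2"
    using zero_le_power2[of "2 * x + of_int n"] by (simp add: power2_eq_square algebra_simps)
  moreover have "x\<^sup>2 \<le> 1"
    using x by (intro power_le_one_iff[THEN iffD2, of "\<bar>x\<bar>" 2, simplified]) auto
  ultimately have "(x + of_int n)\<^sup>2 \<ge> \<bar>real_of_int n\<bar> / 2 - 1" using n by linarith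
  hence "pi * y * (\<bar>real_of_int n\<bar> / 2 - 1) \<le> pi * y * (x + of_int n)\<^sup>2"
    using y by (intro mult_left_mono) auto
  hence "exp (- pi * y * (x + of_int n)\<^sup>2) \<le> exp (pi * y + real (nat \<bar>n\<bar>) * (- pi * y / 2))"
    by (simp add: algebra_simps)
  also have "\<dots> = exp (pi * y) * exp (- pi * y / 2) ^ nat \<bar>n\<bar>"
    by (simp only: exp_add exp_of_nat_mult)
  finally show ?thesis .
qed

lemma gaussian_summable:
  assumes y: "y > 0"
  shows "(\<lambda>n::int. C * (exp (- pi * y / 2) ^ nat \<bar>n\<bar>)) summable_on UNIV"
  using y by (intro summable_on_cmult_right summable_on_geometric_int) auto

lemma ef_periodic: "ef k (x + of_int n) = ef k x"
proof -
  have "ef k (of_int n) = 1"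
    using exp_integer_2pi[of "of_int (k * n)"] by (simp add: mult_ac)
  thus ?thesis by (simp add: ring_distribs exp_add)
qed

text \<open>Poisson summation for the Gaussian: \<open>g\<close> is its periodisation and
  \<open>h\<close> the Fourier series with coefficients \<open>c\<close>. Both are continuous with
  equal Fourier coefficients, so they agree at 0, where they are the two sides.\<close>

lemma theta3_inversion_imaginary:
  assumes y: "y > 0"
  shows "theta3 (\<i> * of_real y) = of_real (1 / sqrt y) * theta3 (\<i> * of_real (1 / y))"
proof -
  define G where "G = (\<lambda>(n::int) x. complex_of_real (exp (- pi * y * (x + of_int n)\<^sup>2)))"
  define c where "c = (\<lambda>k::int. complex_of_real (exp (- pi * (real_of_int k)\<^sup>2 / y) / sqrt y))"
  define K where "K = (\<lambda>(n::int) x. c n * ef n x)"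
  define g where "g = (\<lambda>x. \<Sum>\<^sub>\<infinity>n. G n x)"
  define h where "h = (\<lambda>x. \<Sum>\<^sub>\<infinity>n. K n x)"
  have iy: "1 / y > 0" using y by simp
  have cont_G: "continuous_on S (\<lambda>x. G n x * ef k x)" and cont_G': "continuous_on S (G n)" for S n k
    unfolding G_def by (intro continuous_intros)+
  have cont_K: "continuous_on S (\<lambda>x. K n x * ef k x)" and cont_K': "continuous_on S (K n)" for S n k
    unfolding K_def by (intro continuous_intros)+
  have bound_G: "norm (G n x * ef k x) \<le> exp (pi * y) * exp (- pi * y / 2) ^ nat \<bar>n\<bar>" if "x \<in> {-1/2..1/2}" for n x k
    using gaussian_bound[OF y that, of n] by (simp add: G_def norm_mult)
  have bound_K: "norm (K n x * ef k x) \<le> exp (pi * (1 / y)) / sqrt y * exp (- pi * (1 / y) / 2) ^ nat \<bar>n\<bar>" for n x k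
  proof -
    have "norm (K n x * ef k x) = exp (- pi * (1 / y) * (0 + of_int n)\<^sup>2) / sqrt y"
      using y by (simp add: K_def c_def norm_mult norm_divide)
    also have "\<dots> \<le> exp (pi * (1 / y)) * exp (- pi * (1 / y) / 2) ^ nat \<bar>n\<bar> / sqrt y"
      using y by (intro divide_right_mono gaussian_bound) auto
    finally show ?thesis by simp
  qed
  have g: "continuous_on {-1/2..1/2} g"
    unfolding g_def
  proof (rule has_sum_integral_int(1)[OF cont_G' _ gaussian_summable[OF y]])
    show "norm (G n x) \<le> exp (pi * y) * exp (- pi * y / 2) ^ nat \<bar>n\<bar>" if "x \<in> {-1/2..1/2}" for n x
      using bound_G[OF that, of n 0] by simp
  qed
  have h: "continuous_on {-1/2..1/2} h"
    unfolding h_def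
  proof (rule has_sum_integral_int(1)[OF cont_K' _ gaussian_summable[OF iy]])
    show "norm (K n x) \<le> exp (pi * (1 / y)) / sqrt y * exp (- pi * (1 / y) / 2) ^ nat \<bar>n\<bar>" for n x
      using bound_K[of n x 0] by simp
  qed
  have int_g: "integral {-1/2..1/2} (\<lambda>x. g x * ef k x) = c k" for k
  proof -
    define F where "F = (\<lambda>x. complex_of_real (exp (- pi * y * x\<^sup>2)) * ef k x)"
    have FG: "G n x * ef k x = F (x + of_int n)" for n x
      unfolding G_def F_def ef_periodic ..
    have "((\<lambda>n. integral {-1/2..1/2} (\<lambda>x. G n x * ef k x)) has_sum
        integral {-1/2..1/2} (\<lambda>x. \<Sum>\<^sub>\<infinity>n. G n x * ef k x)) UNIV"
      by (rule has_sum_integral_int(2)[OF cont_G bound_G gaussian_summable[OF y]])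
    hence hs: "((\<lambda>n. integral {-1/2..1/2} (\<lambda>x. F (x + of_int n))) has_sum
        integral {-1/2..1/2} (\<lambda>x. g x * ef k x)) UNIV"
      by (simp only: FG[symmetric] g_def infsum_cmult_left')
    \<comment> \<open>An unconditional sum may be evaluated along symmetric intervals, where the
      unit integrals join into the integral of F over [-N - 1/2, N + 1/2].\<close>
    have "filterlim (\<lambda>N. {- int N..int N}) (finite_subsets_at_top UNIV) sequentially"
    proof (rule filterlim_finite_subsets_at_top[THEN iffD2, rule_format])
      fix X :: "int set" assume "finite X \<and> X \<subseteq> UNIV"
      hence fin: "finite X" by simp
      define B where "B = (\<Sum>n\<in>X. \<bar>n\<bar>)"
      have B: "\<bar>n\<bar> \<le> B" if "n \<in> X" for n
        unfolding B_def using member_le_sum[OF that, of abs] fin by simp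
      show "\<forall>\<^sub>F N in sequentially. finite {- int N..int N} \<and> X \<subseteq> {- int N..int N} \<and> {- int N..int N} \<subseteq> UNIV"
        unfolding eventually_sequentially
      proof (intro exI[of _ "nat B"] allI impI conjI subsetI)
        fix N n assume "nat B \<le> N" "n \<in> X"
        with B[of n] show "n \<in> {- int N..int N}" by auto
      qed auto
    qed
    from filterlim_compose[OF hs[unfolded has_sum_def] this]
    have "(\<lambda>N. \<Sum>n=-int N..int N. integral {-1/2..1/2} (\<lambda>x. F (x + of_int n))) \<longlonglongrightarrow>
        integral {-1/2..1/2} (\<lambda>x. g x * ef k x)" .
    moreover have "continuous_on UNIV F" unfolding F_def by (intro continuous_intros)
    ultimately have "(\<lambda>N. integral {- real N - 1/2..real N + 1/2} F) \<longlonglongrightarrow> integral {-1/2..1/2} (\<lambda>x. g x * ef k x)"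
      by (simp only: integral_unit_intervals)
    moreover have "(\<lambda>N. integral {- real N - 1/2..real N + 1/2} F) \<longlonglongrightarrow> (LINT x|lborel. F x)"
      unfolding F_def by (rule integral_lborel_symmetric_limit[OF gaussian_integrable[OF y]])
    ultimately have "integral {-1/2..1/2} (\<lambda>x. g x * ef k x) = (LINT x|lborel. F x)"
      by (rule LIMSEQ_unique)
    thus ?thesis unfolding F_def gaussian_fourier[OF y] c_def .
  qed
  have int_ef: "integral {-1/2..1/2} (ef m) = (if m = 0 then 1 else 0)" for m
  proof (cases "m = 0")
    case False
    define f where "f = (\<lambda>x::real. ef m x / (2 * of_real pi * \<i> * of_int m))"
    have "(ef m has_integral (f (1/2) - f (-1/2))) {-1/2..1/2}"
      using False unfolding f_def
      by (intro fundamental_theorem_of_calculus)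
         (auto intro!: derivative_eq_intros has_vector_derivative_real_field simp: field_simps)
    moreover have "f (1/2) = f (-1/2)"
      using ef_periodic[of m "-1/2" 1] by (simp add: f_def)
    ultimately show ?thesis using False by (simp add: has_integral_iff)
  qed auto
  have int_h: "integral {-1/2..1/2} (\<lambda>x. h x * ef k x) = c k" for k
  proof -
    have "((\<lambda>n. integral {-1/2..1/2} (\<lambda>x. K n x * ef k x)) has_sum
        integral {-1/2..1/2} (\<lambda>x. \<Sum>\<^sub>\<infinity>n. K n x * ef k x)) UNIV"
      by (rule has_sum_integral_int(2)[OF cont_K bound_K gaussian_summable[OF iy]])
    \<comment> \<open>Pairing with \<open>ef k\<close> picks out the frequency -k, and
      \<open>c\<close> is even.\<close>
    moreover have "integral {-1/2..1/2} (\<lambda>x. K n x * ef k x) = (if n = - k then c k else 0)" for n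
    proof -
      have "(\<lambda>x. K n x * ef k x) = (\<lambda>x. c n * ef (n + k) x)"
        unfolding K_def ef_add[symmetric] by (intro ext mult.assoc)
      hence "integral {-1/2..1/2} (\<lambda>x. K n x * ef k x) = c n * (if n + k = 0 then 1 else 0)"
        by (simp only: integral_mult_right int_ef)
      moreover have "c (- k) = c k" by (simp add: c_def)
      ultimately show ?thesis by (cases "n = - k") auto
    qed
    ultimately have "((\<lambda>n. if n = - k then c k else 0) has_sum integral {-1/2..1/2} (\<lambda>x. h x * ef k x)) UNIV"
      by (simp only: h_def infsum_cmult_left')
    moreover have "((\<lambda>n. if n = - k then c k else 0) has_sum c k) UNIV"
      using has_sum_finite_neutralI[of "{- k}" UNIV "\<lambda>n. if n = - k then c k else 0" "c k"] by simp
    ultimately show ?thesis by (rule has_sum_unique)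
  qed
  have "g 0 - h 0 = 0"
  proof (rule fourier_unique_at_0[where \<phi> = "\<lambda>x. g x - h x"])
    show "continuous_on {-1/2..1/2} (\<lambda>x. g x - h x)" by (intro continuous_intros g h)
    fix k
    have "integral {-1/2..1/2} (\<lambda>x. (g x - h x) * ef k x) =
        integral {-1/2..1/2} (\<lambda>x. g x * ef k x) - integral {-1/2..1/2} (\<lambda>x. h x * ef k x)"
      unfolding left_diff_distrib
      by (intro integral_diff integrable_continuous_real continuous_intros g h)
    thus "integral {-1/2..1/2} (\<lambda>x. (g x - h x) * ef k x) = 0" by (simp only: int_g int_h) simp
  qed
  moreover have "g 0 = theta3 (\<i> * of_real y)"
    unfolding g_def G_def theta3_def
    by (intro infsum_cong) (simp add: exp_of_real[symmetric] mult_ac)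
  moreover have "h 0 = of_real (1 / sqrt y) * theta3 (\<i> * of_real (1 / y))"
    unfolding h_def K_def c_def theta3_def infsum_cmult_right'[symmetric]
    by (intro infsum_cong) (simp add: exp_of_real[symmetric] field_simps)
  ultimately show ?thesis by simp
qed

lemma holomorphic_theta3: "theta3 holomorphic_on {z. Im z > 0}"
proof -
  have "(eval_fps T3 \<circ> nome) holomorphic_on {z. Im z > 0}"
  proof (rule holomorphic_on_compose_gen)
    show "nome holomorphic_on {z. Im z > 0}" by (intro holomorphic_intros)
    show "eval_fps T3 holomorphic_on eball 0 (fps_conv_radius T3)" by (rule holomorphic_on_eval_fps) simp
    show "nome ` {z. Im z > 0} \<subseteq> eball 0 (fps_conv_radius T3)"
    proof (rule image_subsetI)
      fix z :: complex assume "z \<in> {z. Im z > 0}"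
      hence "Im z > 0" by simp
      from qexp_radius[OF qexp_theta3 this] show "nome z \<in> eball 0 (fps_conv_radius T3)"
        unfolding in_eball_iff dist_0_norm .
    qed
  qed
  thus ?thesis by (rule holomorphic_transform) (simp add: qexp_eval[OF qexp_theta3])
qed

text \<open>Both sides are holomorphic, since i / z has positive real part and so avoids the branch
  cut, and they agree on the positive imaginary axis, which accumulates at i.\<close>

lemma theta3_inversion:
  assumes "Im z > 0"
  shows "(\<i> / z) powr (1/2) * theta3 (- 1 / z) = theta3 z"
proof -
  define U where "U = {z::complex. Im z > 0}"
  define F where "F = (\<lambda>z. (\<i> / z) powr (1/2) * theta3 (- 1 / z) - theta3 z)"
  have Im_inv: "Im (- 1 / z) > 0" if "Im z > 0" for z
  proof -
    have "Im (- 1 / z) = Im z / (norm z)\<^sup>2" by (simp add: Im_divide cmod_power2)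
    moreover have "z \<noteq> 0" using that by auto
    ultimately show ?thesis using that by simp
  qed
  have Re_inv: "Re (\<i> / z) > 0" if "Im z > 0" for z
  proof -
    have "Re (\<i> / z) = Im z / (norm z)\<^sup>2" by (simp add: Re_divide cmod_power2)
    moreover have "z \<noteq> 0" using that by auto
    ultimately show ?thesis using that by simp
  qed
  have "F z = 0"
  proof (rule analytic_continuation[where f = F and w = z and S = U and U = "(\<lambda>y. \<i> * of_real y) ` {0<..}" and \<xi> = \<i>])
    show "F holomorphic_on U"
    proof -
      have "(theta3 \<circ> (\<lambda>z. - 1 / z)) holomorphic_on U"
        using holomorphic_theta3 Im_inv
        by (intro holomorphic_on_compose_gen[where t = "{z. Im z > 0}"] holomorphic_intros) (auto simp: U_def)
      hence "(\<lambda>z. theta3 (- 1 / z)) holomorphic_on U" by (simp add: o_def)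
      moreover have "\<i> / z \<notin> \<real>\<^sub>\<le>\<^sub>0" if "z \<in> U" for z
        using Re_inv[of z] that by (auto simp: U_def complex_nonpos_Reals_iff)
      moreover have "z \<noteq> 0" if "z \<in> U" for z using that by (auto simp: U_def)
      ultimately show ?thesis
        unfolding F_def using holomorphic_theta3 by (intro holomorphic_intros) (auto simp: U_def)
    qed
    show "open U" unfolding U_def by (rule open_halfspace_Im_gt)
    show "connected U" unfolding U_def by (intro convex_connected convex_halfspace_Im_gt)
    show "\<i> islimpt (\<lambda>y. \<i> * of_real y) ` {0<..}"
    proof (rule islimptI)
      fix T assume "\<i> \<in> T" "open T"
      then obtain e where e: "e > 0" "ball \<i> e \<subseteq> T" by (auto simp: open_contains_ball)
      have "dist \<i> (\<i> * of_real (1 + e / 2)) = e / 2"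
        using e by (simp add: dist_norm ring_distribs norm_mult)
      hence "\<i> * of_real (1 + e / 2) \<in> T" using e by auto
      moreover have "\<i> * of_real (1 + e / 2) \<noteq> \<i>" using e by (simp add: complex_eq_iff)
      ultimately show "\<exists>w\<in>(\<lambda>y. \<i> * of_real y) ` {0<..}. w \<in> T \<and> w \<noteq> \<i>"
        using e by (intro bexI[of _ "\<i> * of_real (1 + e / 2)"] imageI) auto
    qed
    fix w assume "w \<in> (\<lambda>y. \<i> * of_real y) ` {0<..}"
    then obtain y where y: "y > 0" "w = \<i> * of_real y" by auto
    have "\<i> / w = of_real (1 / y)" "- 1 / w = \<i> * of_real (1 / y)"
      using y by (auto simp: field_simps)
    moreover have "complex_of_real (1 / y) powr (1/2) = of_real (1 / sqrt y)"
      using y powr_of_real[of "1 / y" "1/2"] by (simp add: powr_half_sqrt real_sqrt_divide)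
    ultimately have "F w = of_real (1 / sqrt y) * theta3 (\<i> * of_real (1 / y)) - theta3 (\<i> * of_real y)"
      unfolding F_def by (simp only: y)
    thus "F w = 0" by (simp only: theta3_inversion_imaginary[OF y(1)]) simp
  qed (use assms in \<open>auto simp: U_def\<close>)
  thus ?thesis by (simp add: F_def)
qed

subsection \<open>Shadows\<close>

text \<open>A positive factor leaves the argument unchanged, so no branch correction arises when z
  is rescaled by 4 or 1/4.\<close>

lemma powr_half_mult_square:
  fixes x :: complex
  assumes "r > 0" "x \<noteq> 0"
  shows "(of_real (r\<^sup>2) * x) powr (1/2) = of_real r * x powr (1/2)"
proof -
  have r: "r\<^sup>2 > 0" using assms by simp
  note Ln_times_of_real[OF r assms(2)]
  also note Ln_of_real[OF r]
  also have "ln (r\<^sup>2) = 2 * ln r" using assms by (simp add: ln_realpow)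
  finally have "Ln (of_real (r\<^sup>2) * x) = of_real (2 * ln r) + Ln x" .
  hence "(of_real (r\<^sup>2) * x) powr (1/2) = exp (of_real (ln r) + 1/2 * Ln x)"
    using assms by (simp add: powr_def ring_distribs)
  thus ?thesis using assms by (simp add: powr_def exp_add exp_of_real)
qed

text \<open>The other theta constants reduce to theta3 by theta4 w = 2 theta3(4w) - theta3 w and
  theta2 w = theta3(w/4) - theta3 w, with inversion applied at z / 4 and 4 z as well as at z.
  Passing from w = - 1 / z to u = w + 1 exchanges theta3 and theta4 and puts nome(1/4) before
  theta2.\<close>

lemma theta_shadows:
  fixes z :: complex
  assumes z: "Im z > 0"
  defines "s \<equiv> (\<i> / z) powr (1/2)" and "u \<equiv> 1 - 1 / z"
  shows "s * theta3 u = theta2 z" "s * theta4 u = theta3 z" "s * theta2 u = nome (1/4) * theta4 z"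
proof -
  define w where "w = - 1 / z"
  have z0: "z \<noteq> 0" using z by auto
  have u: "u = w + 1" by (simp add: u_def w_def)
  have w: "Im w > 0"
  proof -
    have "Im w = Im z / (norm z)\<^sup>2" by (simp add: w_def Im_divide cmod_power2)
    thus ?thesis using z z0 by simp
  qed
  have s3: "s * theta3 w = theta3 z"
    using theta3_inversion[OF z] by (simp add: s_def w_def)
  have 4: "2 * s * theta3 (4 * w) = theta3 (z / 4)"
  proof -
    have "(\<i> / (z / 4)) powr (1/2) * theta3 (- 1 / (z / 4)) = theta3 (z / 4)"
      using z by (intro theta3_inversion) simp
    moreover have "\<i> / (z / 4) = of_real (2\<^sup>2) * (\<i> / z)" by simp
    hence "(\<i> / (z / 4)) powr (1/2) = 2 * s"
      using powr_half_mult_square[of 2 "\<i> / z"] z0 by (simp only: s_def) simp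
    moreover have "- 1 / (z / 4) = 4 * w" by (simp add: w_def)
    ultimately show ?thesis by simp
  qed
  have 5: "s * theta3 (w / 4) = 2 * theta3 (4 * z)"
  proof -
    have "(\<i> / (4 * z)) powr (1/2) * theta3 (- 1 / (4 * z)) = theta3 (4 * z)"
      using z by (intro theta3_inversion) simp
    moreover have "\<i> / (4 * z) = of_real ((1/2)\<^sup>2) * (\<i> / z)" by (simp add: power_divide)
    hence "(\<i> / (4 * z)) powr (1/2) = s / 2"
      using powr_half_mult_square[of "1/2" "\<i> / z"] z0 by (simp only: s_def) simp
    moreover have "- 1 / (4 * z) = w / 4" by (simp add: w_def)
    ultimately have "s / 2 * theta3 (w / 4) = theta3 (4 * z)" by (simp only:)
    thus ?thesis by (simp add: field_simps)
  qed
  have "theta3 u = theta4 w" by (simp add: u theta4_conv_theta3)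
  also have "\<dots> = 2 * theta3 (4 * w) - theta3 w"
    using theta3_split[OF w] theta4_split[OF w] by simp
  finally have u3: "theta3 u = 2 * theta3 (4 * w) - theta3 w" .
  have "s * theta3 u = 2 * s * theta3 (4 * w) - s * theta3 w" unfolding u3 by (simp add: algebra_simps)
  also have "\<dots> = theta3 (z / 4) - theta3 z" by (simp only: 4 s3)
  also have "\<dots> = theta2 z" using theta3_split[of "z / 4"] z by simp
  finally show "s * theta3 u = theta2 z" .
  show "s * theta4 u = theta3 z" using s3 by (simp add: u theta4_plus_1)
  have "theta2 w = theta3 (w / 4) - theta3 w" using theta3_split[of "w / 4"] w by simp
  hence "s * theta2 w = 2 * theta3 (4 * z) - theta3 z" by (simp only: right_diff_distrib s3 5)
  also have "\<dots> = theta4 z" using theta3_split[OF z] theta4_split[OF z] by simp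
  finally show "s * theta2 u = nome (1/4) * theta4 z" by (simp add: u theta2_plus_1 mult.left_commute)
qed

text \<open>The weight is half of 4 e + \<alpha> + 8 \<beta>, so the principal power is a natural
  power of s and distributes over the factors: s^4 to phi8, s to theta3, s^8 to Delta8. The signs
  come from nome(1/4)^4 = -1.\<close>

lemma Sh_mf:
  assumes z: "Im z > 0"
  shows "Sh (weight e \<alpha> \<beta>) (mf e \<alpha> \<beta>) z = shf e \<alpha> \<beta> z"
proof -
  define s where "s = (\<i> / z) powr (1/2)"
  define u where "u = 1 - 1 / z"
  note sh = theta_shadows[OF z, folded s_def u_def]
  have "\<i> / z \<noteq> 0" using z by auto
  hence "(\<i> / z) powr (of_real (weight e \<alpha> \<beta>)) = s ^ (4 * e + \<alpha> + 8 * \<beta>)"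
    by (simp add: powr_def s_def weight_def algebra_simps flip: exp_of_nat_mult)
  also have "\<dots> = (s ^ 4) ^ e * s ^ \<alpha> * (s ^ 8) ^ \<beta>" by (simp only: power_add power_mult)
  finally have "Sh (weight e \<alpha> \<beta>) (mf e \<alpha> \<beta>) z =
      ((s ^ 4) ^ e * s ^ \<alpha> * (s ^ 8) ^ \<beta>) * (phi8 u ^ e * theta3 u ^ \<alpha> * Delta8 u ^ \<beta>)"
    by (simp only: Sh_def mf_def u_def)
  also have "\<dots> = (s ^ 4 * phi8 u) ^ e * (s * theta3 u) ^ \<alpha> * (s ^ 8 * Delta8 u) ^ \<beta>"
    by (simp only: power_mult_distrib mult_ac)
  also have "s ^ 4 * phi8 u = (s * theta4 u) ^ 4 - (s * theta2 u) ^ 4"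
    by (simp add: phi8_def power_mult_distrib algebra_simps)
  also have "s ^ 8 * Delta8 u = (s * theta2 u) ^ 4 * (s * theta4 u) ^ 4 / 16"
    by (simp add: Delta8_def power_mult_distrib mult_ac flip: power_add)
  also have "(s * theta2 u) ^ 4 = - (theta4 z ^ 4)"
  proof -
    have "nome (1/4) ^ 4 = -1" by (simp only: nome_power) simp
    thus ?thesis by (simp only: sh power_mult_distrib) simp
  qed
  finally show ?thesis by (simp add: sh shf_def mult.commute)
qed

lemma bcoef_conv_shf: "bcoef e \<alpha> \<beta> m = fcoeff (shf e \<alpha> \<beta>) m"
  unfolding bcoef_def fcoeff_def
  by (intro arg_cong[where f = "\<lambda>x. 1/2 * x"] integral_cong) (simp add: Sh_mf)

lemma bcoef_nat: "bcoef e \<alpha> \<beta> (real n) = cf (shf e \<alpha> \<beta>) n"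
  by (simp add: bcoef_conv_shf cf_def)

text \<open>The exponentials cancel inside the integral, for any real s. With s = \<alpha> / 4 this
  moves the fractional exponents of a shadow to integers.\<close>

lemma fcoeff_nome_mult:
  "fcoeff (\<lambda>z. exp (\<i> * of_real pi * (of_real s * z)) * F z) (s + m) = fcoeff F m"
proof -
  have "exp (\<i> * of_real pi * (of_real s * w)) * F w * exp (- \<i> * of_real pi * of_real (s + m) * w) =
      F w * exp (- \<i> * of_real pi * of_real m * w)" for w
  proof -
    have "exp (\<i> * of_real pi * (of_real s * w)) * exp (- \<i> * of_real pi * of_real (s + m) * w) =
        exp (- \<i> * of_real pi * of_real m * w)"
      by (simp add: algebra_simps flip: exp_add)
    thus ?thesis by (simp add: mult_ac)
  qed
  thus ?thesis unfolding fcoeff_def by (simp only:)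
qed

lemma bcoef_conv_psi2:
  "bcoef e \<alpha> \<beta> (real \<alpha> / 4 + real k) =
    cf (\<lambda>z. (theta3 z ^ 4 + theta4 z ^ 4) ^ e * psi2 z ^ \<alpha> * (- (theta3 z ^ 4 * theta4 z ^ 4) / 16) ^ \<beta>) k"
proof -
  have "nome (z / 4) ^ \<alpha> = exp (\<i> * of_real pi * (of_real (real \<alpha> / 4) * z))" for z
    unfolding nome_power by (rule arg_cong[where f = exp]) simp
  hence "shf e \<alpha> \<beta> = (\<lambda>z. exp (\<i> * of_real pi * (of_real (real \<alpha> / 4) * z)) *
      ((theta3 z ^ 4 + theta4 z ^ 4) ^ e * psi2 z ^ \<alpha> * (- (theta3 z ^ 4 * theta4 z ^ 4) / 16) ^ \<beta>))"
    by (simp add: shf_def fun_eq_iff theta2_conv_psi2 power_mult_distrib mult_ac)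
  thus ?thesis unfolding bcoef_conv_shf cf_def by (simp only: fcoeff_nome_mult)
qed

lemma cf_psi2: "cf psi2 n = of_nat (card {x::int. x\<^sup>2 + x = int n})"
  by (simp add: qexp_cf[OF qexp_psi2] Psi2_def)

lemma bcoef_0_1_0:
  assumes "m \<in> sh_index 1" "\<nexists>a::int. m = real_of_int (a\<^sup>2) / 4"
  shows "bcoef 0 1 0 m = 0"
proof -
  obtain n where m: "m = real 1 / 4 + real (2 * n)" using assms(1) by (auto simp: sh_index_def)
  have "{x::int. x\<^sup>2 + x = int (2 * n)} = {}"
  proof (rule ccontr)
    assume "{x::int. x\<^sup>2 + x = int (2 * n)} \<noteq> {}"
    then obtain x :: int where "x\<^sup>2 + x = int (2 * n)" by blast
    hence "real_of_int (x\<^sup>2 + x) = real (2 * n)" by simp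
    \<comment> \<open>Completing the square: 1/4 + x^2 + x = (2 x + 1)^2 / 4.\<close>
    hence "m = real_of_int ((2 * x + 1)\<^sup>2) / 4" unfolding m by (simp add: power2_eq_square field_simps)
    with assms(2) show False by blast
  qed
  hence "cf psi2 (2 * n) = 0" unfolding cf_psi2 by (simp only: card.empty) simp
  thus ?thesis unfolding m bcoef_conv_psi2 by simp
qed

lemma bcoef_0_2_0:
  assumes "m \<in> sh_index 2" "\<nexists>a b::int. m = real_of_int (a\<^sup>2 + b\<^sup>2) / 4"
  shows "bcoef 0 2 0 m = 0"
proof -
  obtain n where m: "m = real 2 / 4 + real (2 * n)" using assms(1) by (auto simp: sh_index_def)
  have "cf (\<lambda>z. psi2 z * psi2 z) (2 * n) = 0"
    unfolding cf_mult[OF has_qexp_psi2 has_qexp_psi2]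
  proof (rule sum.neutral, rule ballI)
    fix i assume i: "i \<in> {0..2 * n}"
    have "{x::int. x\<^sup>2 + x = int i} = {} \<or> {y::int. y\<^sup>2 + y = int (2 * n - i)} = {}"
    proof (rule ccontr)
      assume "\<not> ?thesis"
      then obtain x y :: int where "x\<^sup>2 + x = int i" "y\<^sup>2 + y = int (2 * n - i)" by blast
      hence "x\<^sup>2 + x + (y\<^sup>2 + y) = int (2 * n)" using i by simp
      hence "real_of_int (x\<^sup>2 + x + (y\<^sup>2 + y)) = real (2 * n)" by simp
      hence "m = real_of_int ((2 * x + 1)\<^sup>2 + (2 * y + 1)\<^sup>2) / 4"
        unfolding m by (simp add: power2_eq_square field_simps)
      with assms(2) show False by blast
    qed
    thus "cf psi2 i * cf psi2 (2 * n - i) = 0" unfolding cf_psi2 by (elim disjE) (simp_all only: card.empty, simp_all)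
  qed
  thus ?thesis unfolding m bcoef_conv_psi2 by (simp add: power2_eq_square)
qed

text \<open>The part of theta3^2 Delta8 with exponents 2 modulo 4 is a multiple of its own shadow at
  4 z, namely of theta2^2 theta3^4 theta4^4. So the shadow coefficient at m = 1/2 + 2 n is a
  multiple of the coefficient at 4 m = 8 n + 2.\<close>

lemma bcoef_0_2_1:
  assumes "m \<in> sh_index 2" "\<nexists>a b::int. m = real_of_int (a\<^sup>2 + b\<^sup>2) / 4"
  shows "bcoef 0 2 1 m = 0"
proof -
  obtain n where m: "m = real 2 / 4 + real (2 * n)" using assms(1) by (auto simp: sh_index_def)
  define M where "M = (\<lambda>z. psi2 z ^ 2 * (theta3 z ^ 4 * theta4 z ^ 4))"
  have M: "has_qexp M" unfolding M_def by (intro has_qexp_intros)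
  let ?cs = "[0, 1, -2, 0, 2, -2, 2, 0, -2, 1] :: complex list"
  have form: "2 ^ 1 * mf 0 2 1 z = (\<Sum>r<4. bform ?cs 10 0 r (theta3 (4 * z)) (theta2 (4 * z)))" if "Im z > 0" for z
    unfolding mf_split[OF that] sum_lessThan_4 Let_def by simp algebra
  have part: "bform ?cs 10 0 ((8 * n + 2) mod 4) (theta3 (4 * z)) (theta2 (4 * z)) =
      - 2 * (exp (\<i> * of_real pi * (of_real 2 * z)) * M (of_nat 4 * z))" if "Im z > 0" for z
  proof -
    have "(8 * n + 2) mod 4 = 2" by presburger
    moreover have "bform ?cs 10 0 2 (theta3 (4 * z)) (theta2 (4 * z)) =
        - 2 * (theta2 (4 * z) ^ 2 * (theta3 (4 * z) ^ 4 * theta4 (4 * z) ^ 4))"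
    proof -
      have "bform ?cs 10 0 2 a b = - 2 * (b ^ 2 * (a ^ 4 * (a ^ 4 - b ^ 4)))" for a b
        by (simp add: power2_eq_square) algebra
      thus ?thesis unfolding theta4_pow4_4z[OF that] .
    qed
    moreover have "theta2 (4 * z) ^ 2 = exp (\<i> * of_real pi * (of_real 2 * z)) * psi2 (4 * z) ^ 2"
    proof -
      have "nome (4 * z / 4) ^ 2 = exp (\<i> * of_real pi * (of_real 2 * z))"
        unfolding nome_power by (rule arg_cong[where f = exp]) simp
      thus ?thesis by (simp only: theta2_conv_psi2 power_mult_distrib)
    qed
    ultimately show ?thesis by (simp add: M_def mult_ac)
  qed
  have "2 ^ 1 * cf (mf 0 2 1) (8 * n + 2) = cf (\<lambda>z. bform ?cs 10 0 ((8 * n + 2) mod 4) (theta3 (4 * z)) (theta2 (4 * z))) (8 * n + 2)"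
    by (rule cf_mf_form[OF form])
  also have "\<dots> = cf (\<lambda>z. exp (\<i> * of_real pi * (of_real 2 * z)) * (- 2 * M (of_nat 4 * z))) (8 * n + 2)"
    by (rule cf_cong, subst part, assumption, rule mult.left_commute)
  \<comment> \<open>Taking out q^2 shifts the index to 8 n = 4 * (2 n), from which the dilation by 4
    removes the factor 4.\<close>
  also have "\<dots> = fcoeff (\<lambda>z. exp (\<i> * of_real pi * (of_real 2 * z)) * (- 2 * M (of_nat 4 * z))) (2 + real (8 * n))"
    by (simp add: cf_def add.commute)
  also have "\<dots> = cf (\<lambda>z. - 2 * M (of_nat 4 * z)) (4 * (2 * n))"
    unfolding fcoeff_nome_mult by (simp add: cf_def)
  also have "\<dots> = - 2 * cf M (2 * n)"
    by (simp only: cf_cmult[OF has_qexp_dilate[OF M zero_less_numeral]] cf_dilate[OF M zero_less_numeral])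
  finally have eq: "2 ^ 1 * cf (mf 0 2 1) (8 * n + 2) = - 2 * cf M (2 * n)" .
  have "\<nexists>a b::int. int (8 * n + 2) = a\<^sup>2 + b\<^sup>2"
  proof
    assume "\<exists>a b::int. int (8 * n + 2) = a\<^sup>2 + b\<^sup>2"
    then obtain a b :: int where "int (8 * n + 2) = a\<^sup>2 + b\<^sup>2" by blast
    hence "real_of_int (a\<^sup>2 + b\<^sup>2) = real (8 * n + 2)" by (metis of_int_of_nat_eq)
    hence "m = real_of_int (a\<^sup>2 + b\<^sup>2) / 4" unfolding m by simp
    with assms(2) show False by blast
  qed
  from acoef_0_2_1[OF this] have "cf M (2 * n) = 0" using eq by (simp add: acoef_conv_cf)
  with cf_cmult[OF M, of "- 1 / 16" "2 * n"]
  have "cf (\<lambda>z. - 1 / 16 * M z) (2 * n) = 0" by (simp only: mult_zero_right)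
  moreover have "(\<lambda>z. - 1 / 16 * M z) = (\<lambda>z. (theta3 z ^ 4 + theta4 z ^ 4) ^ 0 * psi2 z ^ 2 *
      (- (theta3 z ^ 4 * theta4 z ^ 4) / 16) ^ 1)"
    by (simp add: M_def fun_eq_iff)
  ultimately show ?thesis unfolding m bcoef_conv_psi2 by (simp only:)
qed

lemma bcoef_1_33_2: "bcoef 1 33 2 (49/4) = 0"
proof -
  define M where "M = (\<lambda>z. (theta3 z ^ 4 + theta4 z ^ 4) * psi2 z ^ 33 * (theta3 z ^ 4 * theta4 z ^ 4)\<^sup>2)"
  have M: "has_qexp M" unfolding M_def by (intro has_qexp_intros)
  \<comment> \<open>The index splits as 49/4 = 33/4 + 4, and 256 = 16^2 comes from Delta8^2.\<close>
  have "bcoef 1 33 2 (real 33 / 4 + real 4) = cf (\<lambda>z. 1 / 256 * M z) 4"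
    unfolding bcoef_conv_psi2 M_def by (simp add: power_divide)
  also have "\<dots> = 1 / 256 * cf M 4" by (rule cf_cmult[OF M])
  also have "cf M 4 = 0" unfolding M_def by (rule cf_psi2_33)
  finally show ?thesis by simp
qed

lemma bcoef_0_16k_k:
  assumes "m \<in> sh_index (16 * k)" "m = of_int j" "j mod 4 = 2"
  shows "bcoef 0 (16 * k) k m = 0"
proof -
  obtain n where "m = real (16 * k) / 4 + 2 * real n" using assms(1) by (auto simp: sh_index_def)
  hence m: "m = real (4 * k + 2 * n)" by simp
  hence "j = int (4 * k + 2 * n)" using assms(2) by (metis of_int_eq_iff of_int_of_nat_eq)
  hence "(4 * k + 2 * n) mod 4 = 2" using assms(3) by presburger
  thus ?thesis unfolding m bcoef_nat by (rule cf_shf_0_16k_k)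
qed

theorem lemma7p1:
  shows
  \<comment> \<open>(a)\<close>
  "(\<forall>k m::nat. odd (int m - int k) \<longrightarrow> acoef 0 (4*k) k m = 0)
 \<and> (\<forall>k::nat. \<forall>m \<in> sh_index (16*k). (\<exists>j::int. m = of_int j \<and> j mod 4 = 2) \<longrightarrow> bcoef 0 (16*k) k m = 0)
  \<comment> \<open>(b)\<close>
 \<and> (\<forall>m::nat. (\<nexists>a::int. int m = a^2) \<longrightarrow> acoef 0 1 0 m = 0)
 \<and> (\<forall>m \<in> sh_index 1. (\<nexists>a::int. m = real_of_int (a^2) / 4) \<longrightarrow> bcoef 0 1 0 m = 0)
 \<and> (\<forall>m::nat. (\<nexists>a b::int. int m = a^2 + b^2) \<longrightarrow> acoef 0 2 0 m = 0)
 \<and> (\<forall>m \<in> sh_index 2. (\<nexists>a b::int. m = real_of_int (a^2 + b^2) / 4) \<longrightarrow> bcoef 0 2 0 m = 0)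
 \<and> (\<forall>a b::nat. acoef 0 3 0 (4^a * (8*b + 7)) = 0)
 \<and> acoef 1 12 0 1 = 0
  \<comment> \<open>(c)\<close>
 \<and> (\<forall>a b::nat. acoef 0 1 1 (4^a * (8*b + 5)) = 0)
 \<and> (\<forall>m::nat. (\<nexists>a b::int. int m = a^2 + b^2) \<longrightarrow> acoef 0 2 1 m = 0)
 \<and> (\<forall>m \<in> sh_index 2. (\<nexists>a b::int. m = real_of_int (a^2 + b^2) / 4) \<longrightarrow> bcoef 0 2 1 m = 0)
 \<and> (\<forall>a b::nat. acoef 0 3 1 (4^a * (8*b + 7)) = 0)
 \<and> (\<forall>a b::nat. acoef 0 7 1 (4^a * (8*b + 3)) = 0)
 \<and> (\<forall>a b::nat. acoef 1 3 1 (4^a * (8*b + 7)) = 0)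
 \<and> (\<forall>a::nat. acoef 1 16 1 (2 * 4^a) = 0)
 \<and> (\<forall>a::nat. real (2 * 4^a) \<in> sh_index 16 \<longrightarrow> bcoef 1 16 1 (real (2 * 4^a)) = 0)
 \<and> bcoef 1 40 1 24 = 0
  \<comment> \<open>(d)\<close>
 \<and> (\<forall>a b::nat. acoef 0 5 2 (4^a * (8*b + 1)) = 0)
 \<and> (\<forall>a::nat. acoef 0 12 2 (4^a) = 0)
 \<and> (\<forall>a::nat. acoef 1 8 2 (4^a) = 0)
 \<and> (\<forall>a::nat. real (4^a) \<in> sh_index 8 \<longrightarrow> bcoef 1 8 2 (real (4^a)) = 0)
 \<and> acoef 1 20 2 3 = 0
 \<and> acoef 1 33 2 4 = 0
 \<and> bcoef 1 33 2 (49/4) = 0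
  \<comment> \<open>(e)\<close>
 \<and> (\<forall>a::nat. acoef 0 4 3 (2 * 4^a) = 0)
 \<and> (\<forall>a::nat. acoef 1 24 3 (2^a) = 0)
 \<and> (\<forall>a::nat. real (2^a) \<in> sh_index 24 \<longrightarrow> bcoef 1 24 3 (real (2^a)) = 0)"
proof (intro conjI allI ballI impI)
  fix m :: real and k :: nat
  assume "m \<in> sh_index (16 * k)" "\<exists>j::int. m = of_int j \<and> j mod 4 = 2"
  thus "bcoef 0 (16 * k) k m = 0" using bcoef_0_16k_k by blast
next
  show "bcoef 1 40 1 24 = 0" using bcoef_nat[of 1 40 1 24] cf_shf_1_40_1 by simp
qed ((rule acoef_0_4k_k acoef_0_1_0 bcoef_0_1_0 acoef_0_2_0 bcoef_0_2_0 acoef_0_2_1 bcoef_0_2_1; assumption)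
  | (simp only: acoef_0_3_0 acoef_1_12_0 acoef_0_1_1 acoef_0_3_1 acoef_0_7_1 acoef_1_3_1 acoef_1_16_1 bcoef_nat
    cf_shf_1_16_1_eq_0 acoef_0_5_2 acoef_0_12_2 acoef_1_8_2 cf_shf_1_8_2_eq_0 acoef_1_20_2 acoef_1_33_2
    bcoef_1_33_2 acoef_0_4_3 acoef_1_24_3 cf_shf_1_24_3_eq_0))+

end
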